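(* Let $n\ge 2$. For $a>0$ let $(I_a, f(a,\cdot))$ denote the maximal solution of the Cauchy problem $$f_{tt} = (n-1)\coth(f)\,(1+f_t^2),\qquad f(0)=a,\qquad f_t(0)=0 .$$ Then for every $a>0$ this maximal solution gives rise to the generating curve $C_a$, $t\mapsto (\tanh(f(a,t)/2),t)$ (catenary), of a complete minimal rotation hypersurface $\mathcal{C}_a$ (catenoid) in $\mathbb{H}^n\times\mathbb{R}$, with the following properties. 1. The interval $I_a$ is of the form $I_a=\,]-T(a),T(a)[$ for some finite positive number $T(a)$, and $f(a,\cdot)$ is an even function of the second variable. 2. For all $t\in I_a$, $f(a,t)\ge a$. 3. The derivative $f_t(a,\cdot)$ is positive on $]0,T(a)[$ and negative on $]-T(a),0[$. 4. The function $f(a,\cdot)$ is a bijection from $[0,T(a)[$ onto $[a,\infty[$, with inverse function $\lambda(a,\cdot)$ given by $$\lambda(a,\rho)=\sinh^{n-1}(a)\int_a^{\rho}\big(\sinh^{2n-2}(u)-\sinh^{2n-2}(a)\big)^{-1/2}\,du .$$ 5. The catenoid $\mathcal{C}_a$ has finite vertical height $h_R(a)$, $$h_R(a)=2\sinh^{n-1}(a)\int_a^{\infty}\big(\sinh^{2n-2}(u)-\sinh^{2n-2}(a)\big)^{-1/2}\,du .$$ 6. The function $a\mapsto h_R(a)$ increases from $0$ to $\frac{\pi}{n-1}$ when $a$ increases from $0$ to infinity. Furthermore, given $a\neq b$, the generating catenaries $C_a$ and $C_b$ intersect at exactly two symmetric points.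
   Context: $\mathbb{H}^n$ is hyperbolic space in the ball model $\mathbb{B}=\{x\in\mathbb{R}^n:|x|<1\}$ with metric $g_{\mathbb{B}}=\big(\frac{2}{1-|x|^2}\big)^2(dx_1^2+\cdots+dx_n^2)$, and $\mathbb{H}^n\times\mathbb{R}$ carries the product metric $\hat g=g_{\mathbb{B}}+dt^2$. Subscripts $t$ denote derivatives with respect to $t$. The curve $t\mapsto(\tanh(f(a,t)/2),t)$ lies in the vertical plane $\{x_1=\cdots=x_{n-1}=0\}$ (so $f(a,t)$ is the hyperbolic distance to the axis $\{0\}\times\mathbb{R}$ at height $t$), and the rotation hypersurface (about $\{0\}\times\mathbb{R}$) it generates is the image of $(t,\xi)\in I_a\times S^{n-1}\mapsto(\tanh(f(a,t)/2)\,\xi,\,t)\in\mathbb{H}^n\times\mathbb{R}$. The vertical height of $\mathcal{C}_a$ is the length of the interval of values taken by the $t$-coordinate on $\mathcal{C}_a$. "Symmetric points" means symmetric with respect to $t=0$. *)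

theory Defs
  imports "HOL-Analysis.Analysis"
begin

section \<open>Hypersurfaces of a Riemannian metric on an open subset of Euclidean space\<close>

primrec higher_differentiable_on ::
    "nat \<Rightarrow> 'a::euclidean_space set \<Rightarrow> ('a \<Rightarrow> 'b::euclidean_space) \<Rightarrow> bool" where
  "higher_differentiable_on 0 S f \<longleftrightarrow> continuous_on S f"
| "higher_differentiable_on (Suc k) S f \<longleftrightarrow>
     (\<forall>x\<in>S. f differentiable (at x)) \<and>
     (\<forall>v. higher_differentiable_on k S (\<lambda>x. frechet_derivative f (at x) v))"

text \<open>Being \<open>C\<^sup>\<infinity>\<close>; only meaningful (and only used) for open \<open>S\<close>.\<close>

definition smooth_on :: "'a::euclidean_space set \<Rightarrow> ('a \<Rightarrow> 'b::euclidean_space) \<Rightarrow> bool" where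
  "smooth_on S f \<longleftrightarrow> (\<forall>k. higher_differentiable_on k S f)"

text \<open>\<open>g p u v\<close> is the inner product at the point \<open>p\<close> of the vectors \<open>u\<close> and \<open>v\<close>.\<close>

type_synonym 'a metric_tensor = "'a \<Rightarrow> 'a \<Rightarrow> 'a \<Rightarrow> real"

text \<open>Christoffel symbols of the first kind, from Koszul's formula for constant vector fields.
  The Levi-Civita connection \<open>\<nabla>\<close> of \<open>g\<close> is determined by
  \<open>g(\<nabla>\<^sub>u V, w) = g(DV u, w) + christoffel g p u V w\<close> at \<open>p\<close>.\<close>

definition christoffel ::
    "'a::euclidean_space metric_tensor \<Rightarrow> 'a \<Rightarrow> 'a \<Rightarrow> 'a \<Rightarrow> 'a \<Rightarrow> real" where
  "christoffel g p u v w =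
     (frechet_derivative (\<lambda>q. g q v w) (at p) u
    + frechet_derivative (\<lambda>q. g q u w) (at p) v
    - frechet_derivative (\<lambda>q. g q u v) (at p) w) / 2"

text \<open>Embedded smooth hypersurface of the open set \<open>U\<close>: locally a regular level set.\<close>

definition hypersurface :: "'a::euclidean_space set \<Rightarrow> 'a set \<Rightarrow> bool" where
  "hypersurface U M \<longleftrightarrow> M \<subseteq> U \<and>
     (\<forall>p\<in>M. \<exists>W (F :: 'a \<Rightarrow> real). open W \<and> p \<in> W \<and> smooth_on W F \<and>
        M \<inter> W = {q \<in> W. F q = 0} \<and>
        (\<forall>q\<in>M \<inter> W. frechet_derivative F (at q) \<noteq> (\<lambda>_. 0)))"

definition tangent_space :: "'a::euclidean_space set \<Rightarrow> 'a \<Rightarrow> 'a set" where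
  "tangent_space M p = {v. \<exists>\<epsilon>>0. \<exists>\<gamma> :: real \<Rightarrow> 'a.
     smooth_on {-\<epsilon><..<\<epsilon>} \<gamma> \<and> \<gamma> ` {-\<epsilon><..<\<epsilon>} \<subseteq> M \<and> \<gamma> 0 = p \<and>
     (\<gamma> has_vector_derivative v) (at 0)}"

text \<open>A unit normal field of \<open>M\<close> over \<open>M \<inter> W\<close>, given with a smooth extension to the open
  set \<open>W\<close>; derivatives of \<open>\<nu>\<close> are only taken in directions tangent to \<open>M\<close>, so that the
  choice of the extension is irrelevant.\<close>

definition unit_normal_field ::
    "'a::euclidean_space metric_tensor \<Rightarrow> 'a set \<Rightarrow> 'a set \<Rightarrow> ('a \<Rightarrow> 'a) \<Rightarrow> bool" where
  "unit_normal_field g M W \<nu> \<longleftrightarrow> smooth_on W \<nu> \<and>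
     (\<forall>q\<in>M \<inter> W. g q (\<nu> q) (\<nu> q) = 1 \<and> (\<forall>v\<in>tangent_space M q. g q (\<nu> q) v = 0))"

text \<open>\<open>II(u, v) = - g(\<nabla>\<^sub>u \<nu>, v)\<close>.\<close>

definition second_fundamental_form ::
    "'a::euclidean_space metric_tensor \<Rightarrow> ('a \<Rightarrow> 'a) \<Rightarrow> 'a \<Rightarrow> 'a \<Rightarrow> 'a \<Rightarrow> real" where
  "second_fundamental_form g \<nu> p u v =
     - (g p (frechet_derivative \<nu> (at p) u) v + christoffel g p u (\<nu> p) v)"

definition orthonormal_tangent_basis ::
    "'a::euclidean_space metric_tensor \<Rightarrow> 'a set \<Rightarrow> 'a \<Rightarrow> 'a set \<Rightarrow> bool" where
  "orthonormal_tangent_basis g M p B \<longleftrightarrow> finite B \<and> span B = tangent_space M p \<and>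
     (\<forall>u\<in>B. \<forall>v\<in>B. g p u v = (if u = v then 1 else 0))"

text \<open>Normalised trace of the second fundamental form; it does not depend on the chosen
  orthonormal basis.\<close>

definition mean_curvature ::
    "'a::euclidean_space metric_tensor \<Rightarrow> 'a set \<Rightarrow> ('a \<Rightarrow> 'a) \<Rightarrow> 'a \<Rightarrow> real" where
  "mean_curvature g M \<nu> p =
     (\<Sum>e\<in>(SOME B. orthonormal_tangent_basis g M p B). second_fundamental_form g \<nu> p e e)
       / real (DIM('a) - 1)"

definition minimal_hypersurface ::
    "'a::euclidean_space set \<Rightarrow> 'a metric_tensor \<Rightarrow> 'a set \<Rightarrow> bool" where
  "minimal_hypersurface U g M \<longleftrightarrow> hypersurface U M \<and>
     (\<forall>p\<in>M. \<exists>W \<nu>. open W \<and> p \<in> W \<and> unit_normal_field g M W \<nu> \<and>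
        (\<forall>q\<in>M \<inter> W. mean_curvature g M \<nu> q = 0))"

definition riemannian_speed ::
    "'a::euclidean_space metric_tensor \<Rightarrow> (real \<Rightarrow> 'a) \<Rightarrow> real \<Rightarrow> real" where
  "riemannian_speed g \<gamma> s =
     sqrt (g (\<gamma> s) (vector_derivative \<gamma> (at s)) (vector_derivative \<gamma> (at s)))"

text \<open>Intrinsic distance of \<open>M\<close>. The library's piecewise \<open>C\<^sup>1\<close> paths may have unbounded
  derivative, and even infinite length, near a break point, where \<open>integral\<close> would return the
  default value \<open>0\<close>; hence the integrability requirement. The value outside \<open>M\<close> is a dummy.\<close>

definition riemannian_dist ::
    "'a::euclidean_space metric_tensor \<Rightarrow> 'a set \<Rightarrow> 'a \<Rightarrow> 'a \<Rightarrow> real" where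
  "riemannian_dist g M p q =
     (if p \<in> M \<and> q \<in> M
      then Inf {integral {0..1} (riemannian_speed g \<gamma>) |\<gamma>.
             valid_path \<gamma> \<and> path_image \<gamma> \<subseteq> M \<and> pathstart \<gamma> = p \<and> pathfinish \<gamma> = q \<and>
             riemannian_speed g \<gamma> integrable_on {0..1}}
      else 0)"

definition complete_hypersurface ::
    "'a::euclidean_space set \<Rightarrow> 'a metric_tensor \<Rightarrow> 'a set \<Rightarrow> bool" where
  "complete_hypersurface U g M \<longleftrightarrow> hypersurface U M \<and>
     Metric_space M (riemannian_dist g M) \<and>
     Metric_space.mcomplete M (riemannian_dist g M)"

section \<open>The product of hyperbolic space and the real line\<close>

definition HxR :: "((real ^ 'n) \<times> real) set" where
  "HxR = ball 0 1 \<times> UNIV"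

definition HxR_metric :: "((real ^ 'n) \<times> real) metric_tensor" where
  "HxR_metric p u v =
     (2 / (1 - (norm (fst p))\<^sup>2))\<^sup>2 * (fst u \<bullet> fst v) + snd u * snd v"

text \<open>A curve in a vertical plane through the axis is given by coordinates \<open>(r, t)\<close>, \<open>r\<close>
  being the only nonzero ball coordinate and \<open>t\<close> the height.\<close>

definition rotation_hypersurface :: "(real \<times> real) set \<Rightarrow> ((real ^ 'n) \<times> real) set" where
  "rotation_hypersurface C = {(r *\<^sub>R \<xi>, t) |r t \<xi>. (r, t) \<in> C \<and> \<xi> \<in> sphere 0 1}"

definition vertical_height :: "((real ^ 'n) \<times> real) set \<Rightarrow> real" where
  "vertical_height M = Sup (snd ` M) - Inf (snd ` M)"

section \<open>Catenaries\<close>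

definition coth :: "real \<Rightarrow> real" where
  "coth x = cosh x / sinh x"

text \<open>The condition \<open>f t \<noteq> 0\<close> keeps the solution in the domain of \<open>coth\<close>.
  Only the values of \<open>f\<close> on the open interval \<open>I\<close> matter.\<close>

definition cauchy_solution :: "nat \<Rightarrow> real \<Rightarrow> real set \<Rightarrow> (real \<Rightarrow> real) \<Rightarrow> bool" where
  "cauchy_solution n a I f \<longleftrightarrow>
     open I \<and> is_interval I \<and> 0 \<in> I \<and> f 0 = a \<and> deriv f 0 = 0 \<and>
     (\<forall>t\<in>I. f t \<noteq> 0 \<and> f differentiable (at t) \<and>
        (deriv f has_real_derivative (real n - 1) * coth (f t) * (1 + (deriv f t)\<^sup>2)) (at t))"

definition maximal_solution :: "nat \<Rightarrow> real \<Rightarrow> real set \<Rightarrow> (real \<Rightarrow> real) \<Rightarrow> bool" where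
  "maximal_solution n a I f \<longleftrightarrow> cauchy_solution n a I f \<and>
     (\<forall>J h. cauchy_solution n a J h \<and> I \<subseteq> J \<and> (\<forall>t\<in>I. h t = f t) \<longrightarrow> J = I)"

definition catenary :: "real set \<Rightarrow> (real \<Rightarrow> real) \<Rightarrow> (real \<times> real) set" where
  "catenary I f = (\<lambda>t. (tanh (f t / 2), t)) ` I"

definition catenary_integrand :: "nat \<Rightarrow> real \<Rightarrow> real \<Rightarrow> real" where
  "catenary_integrand n a u = (sinh u ^ (2 * n - 2) - sinh a ^ (2 * n - 2)) powr (- (1 / 2))"

end

theory Submission
  imports Defs
begin

text \<open>
  Write \<open>m = n - 1\<close> and let \<open>\<phi> = arctan f\<^sub>t\<close> be the angle of the tangent. Along a solution
  \<open>\<phi>\<^sub>t = m coth f\<close>, and \<open>(1 + f\<^sub>t\<^sup>2) / sinh\<^sup>2\<^sup>m f\<close> is constant, so that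
  \<open>sinh f = sinh a (cos \<phi>)\<^sup>-\<^sup>1\<^sup>/\<^sup>m\<close>. Hence \<open>dt/d\<phi> = tanh f / m\<close> is a function of \<open>\<phi>\<close> alone, namely
  \<open>K(\<phi>) / m\<close> with \<open>K(\<phi>) = sinh a / sqrt (sinh\<^sup>2 a + (cos \<phi>)\<^sup>2\<^sup>/\<^sup>m)\<close>, which extends
  continuously to the whole line. So \<open>t = height \<phi>\<close>, the integral of \<open>K / m\<close> from \<open>0\<close> to \<open>\<phi>\<close>, for
  every solution on every interval (\<open>cauchy_solution_unique\<close>): uniqueness and the bound
  \<open>T(a) = height (\<pi>/2)\<close> come together, without general existence theory, and the inverse of
  \<open>height\<close> on \<open>]-\<pi>/2, \<pi>/2[\<close> provides the solution \<open>profile\<close>.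

  The monotonicity and the limits of \<open>T(a)\<close> are read off from \<open>K\<close>: away from the zeros of the
  cosine it increases strictly with \<open>a\<close> and tends to \<open>0\<close> when \<open>a\<close> does, and everywhere it lies
  between \<open>tanh a\<close> and \<open>1\<close>. The formula for \<open>\<lambda>(a, \<rho>)\<close> is the
  fundamental theorem of calculus for \<open>\<rho> \<mapsto> height (arccos ((sinh a / sinh \<rho>)\<^sup>m))\<close>. For \<open>a < b\<close>
  the difference \<open>\<lambda>(a, \<rho>) - \<lambda>(b, \<rho>)\<close> is strictly decreasing in \<open>\<rho> \<ge> b\<close>, positive at \<open>b\<close>, and tends to
  \<open>T(a) - T(b) < 0\<close>; its only zero is the crossing of the two catenaries at a positive height, and
  the other crossing is its mirror image.

  The hypersurface is the level set \<open>|x| = tanh (f(t) / 2)\<close>. It has a unit normal of the form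
  \<open>(\<alpha>(t) x, \<beta>(t))\<close>, which is linear in \<open>x\<close> and therefore easy to extend and to differentiate.
  With \<open>c = 1 / sqrt (1 + f\<^sub>t\<^sup>2)\<close>, the second fundamental form at a unit tangent vector with vertical
  component \<open>\<tau>\<close> is \<open>- c coth f (1 - (m + 1) (1 + f\<^sub>t\<^sup>2) \<tau>\<^sup>2)\<close>. An orthonormal basis has
  \<open>m + 1\<close> elements, and by Parseval's identity the squares of their vertical components add up to
  \<open>c\<^sup>2\<close>; so the trace vanishes.

  For completeness, both the inclusion into Euclidean space and \<open>- ln (1 - |x|\<^sup>2)\<close> are
  1-Lipschitz for the intrinsic distance. A Cauchy sequence thus converges in the Euclidean sense
  and stays away from the ideal boundary, and since \<open>f \<rightarrow> \<infinity>\<close> at the ends of the interval its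
  limit lies on the hypersurface. Arcs of meridians and of great circles bound the intrinsic
  distance from above and turn Euclidean into intrinsic convergence.
\<close>

section \<open>Catenaries in terms of the tangent angle\<close>

text \<open>Here \<open>m\<close> stands for \<open>n - 1\<close>.\<close>

locale catenary_curve =
  fixes m :: nat and a :: real
  assumes m_pos: "0 < m" and a_pos: "0 < a"
begin

text \<open>The value of \<open>tanh f\<close> at the point with tangent angle \<open>\<phi>\<close>. The root of
  \<open>(cos \<phi>)\<^sup>2\<close> replaces the power \<open>(cos \<phi>)\<^sup>2\<^sup>/\<^sup>m\<close>, so that the function is continuous
  everywhere, in particular at \<open>\<plusminus>\<pi>/2\<close>.\<close>

definition tanh_of_angle :: "real \<Rightarrow> real" where
  "tanh_of_angle \<phi> = sinh a / sqrt ((sinh a)\<^sup>2 + root m ((cos \<phi>)\<^sup>2))"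

text \<open>The height \<open>t\<close> as a function of the tangent angle. As \<open>integral {u..v}\<close> vanishes for
  \<open>v < u\<close>, the integral from \<open>0\<close> to \<open>\<phi>\<close> is written with base point \<open>-\<pi>\<close>; only
  \<open>-\<pi> < \<phi> < \<pi>\<close> is meaningful.\<close>

definition height :: "real \<Rightarrow> real" where
  "height \<phi> = (integral {-pi..\<phi>} tanh_of_angle - integral {-pi..0} tanh_of_angle) / m"

definition T :: real where
  "T = height (pi / 2)"

text \<open>The value \<open>sinh a (cos \<phi>)\<^sup>-\<^sup>1\<^sup>/\<^sup>m\<close> of \<open>sinh f\<close>, for \<open>-\<pi>/2 < \<phi> < \<pi>/2\<close>.\<close>

definition sinh_of_angle :: "real \<Rightarrow> real" where
  "sinh_of_angle \<phi> = sinh a * exp (- ln (cos \<phi>) / m)"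

text \<open>The tangent angle at height \<open>t\<close> and the solution of the Cauchy problem, both for
  \<open>-T < t < T\<close>.\<close>

definition angle :: "real \<Rightarrow> real" where
  "angle t = the_inv_into {-(pi/2)<..<pi/2} height t"

definition profile :: "real \<Rightarrow> real" where
  "profile t = arsinh (sinh_of_angle (angle t))"

lemma sinh_a_pos: "0 < sinh a"
  using a_pos by simp

lemma tanh_of_angle_denom_pos: "0 < (sinh a)\<^sup>2 + root m ((cos \<phi>)\<^sup>2)"
proof -
  have "0 \<le> root m ((cos \<phi>)\<^sup>2)"
    using m_pos by (simp add: real_root_ge_zero)
  then show ?thesis
    using sinh_a_pos by (simp add: add_pos_nonneg)
qed

lemma tanh_of_angle_pos: "0 < tanh_of_angle \<phi>"
  unfolding tanh_of_angle_def
  using sinh_a_pos tanh_of_angle_denom_pos by (intro divide_pos_pos) auto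

lemma tanh_of_angle_le_1: "tanh_of_angle \<phi> \<le> 1"
proof -
  have "sinh a = sqrt ((sinh a)\<^sup>2)" using sinh_a_pos by simp
  also have "\<dots> \<le> sqrt ((sinh a)\<^sup>2 + root m ((cos \<phi>)\<^sup>2))"
    using m_pos by (intro real_sqrt_le_mono) (simp add: real_root_ge_zero)
  finally show ?thesis
    using tanh_of_angle_denom_pos[of \<phi>] by (simp add: tanh_of_angle_def)
qed

lemma tanh_of_angle_minus: "tanh_of_angle (- \<phi>) = tanh_of_angle \<phi>"
  by (simp add: tanh_of_angle_def)

lemma continuous_on_tanh_of_angle: "continuous_on S tanh_of_angle"
  unfolding tanh_of_angle_def
  using tanh_of_angle_denom_pos
  by (intro continuous_intros) (auto simp: less_imp_neq[symmetric])

lemma height_0: "height 0 = 0"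
  by (simp add: height_def)

lemma height_has_derivative:
  assumes "-pi < \<phi>" "\<phi> < pi"
  shows "(height has_real_derivative tanh_of_angle \<phi> / m) (at \<phi>)"
proof -
  have "((\<lambda>x. integral {-pi..x} tanh_of_angle) has_real_derivative tanh_of_angle \<phi>)
      (at \<phi> within {-pi..pi})"
    using assms by (intro integral_has_real_derivative continuous_on_tanh_of_angle) auto
  then have "((\<lambda>x. integral {-pi..x} tanh_of_angle) has_real_derivative tanh_of_angle \<phi>) (at \<phi>)"
    using assms by (simp add: at_within_Icc_at)
  then show ?thesis
    unfolding height_def [abs_def]
    using m_pos by (auto intro!: derivative_eq_intros)
qed

lemma isCont_height: "-pi < \<phi> \<Longrightarrow> \<phi> < pi \<Longrightarrow> isCont height \<phi>"
  using height_has_derivative DERIV_isCont by blast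

lemma height_strict_mono:
  assumes "-pi < x" "x < y" "y < pi"
  shows "height x < height y"
proof (rule DERIV_pos_imp_increasing [OF assms(2)])
  fix z assume "x \<le> z" "z \<le> y"
  then show "\<exists>l. (height has_real_derivative l) (at z) \<and> 0 < l"
    using assms height_has_derivative[of z] tanh_of_angle_pos[of z] m_pos
    by (intro exI[of _ "tanh_of_angle z / m"]) auto
qed

lemma height_less_iff:
  assumes "-pi < x" "x < pi" "-pi < y" "y < pi"
  shows "height x < height y \<longleftrightarrow> x < y"
  using height_strict_mono[of x y] height_strict_mono[of y x] assms
  by (cases x y rule: linorder_cases) auto

lemma height_minus:
  assumes "-pi < \<phi>" "\<phi> < pi"
  shows "height (- \<phi>) = - height \<phi>"
proof -
  have "((\<lambda>x. height x + height (- x)) has_real_derivative 0) (at x)"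
    if "-pi < x" "x < pi" for x
  proof -
    have "((\<lambda>x. height (- x)) has_real_derivative tanh_of_angle (- x) / m * (-1)) (at x)"
      using that by (intro DERIV_chain2[OF height_has_derivative]) (auto intro!: derivative_eq_intros)
    from DERIV_add[OF height_has_derivative[OF that] this] show ?thesis
      by (simp add: tanh_of_angle_minus)
  qed
  then have "\<exists>c. \<forall>x\<in>{-pi<..<pi}. height x + height (- x) = c"
    by (intro has_field_derivative_zero_constant) (auto intro: has_field_derivative_at_within)
  then obtain c where c: "\<And>x. x \<in> {-pi<..<pi} \<Longrightarrow> height x + height (- x) = c"
    by blast
  from c[of 0] c[of \<phi>] assms show ?thesis
    by (simp add: height_0)
qed

lemma T_pos: "0 < T"
  using height_strict_mono[of 0 "pi/2"] by (simp add: T_def height_0)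

lemma height_in:
  assumes "\<phi> \<in> {-(pi/2)<..<pi/2}"
  shows "height \<phi> \<in> {-T<..<T}"
  using height_strict_mono[of \<phi> "pi/2"] height_strict_mono[of "-(pi/2)" \<phi>] height_minus[of "pi/2"]
    assms by (simp add: T_def)

lemma height_bij_betw: "bij_betw height {-(pi/2)<..<pi/2} {-T<..<T}"
  unfolding bij_betw_def
proof
  show "inj_on height {-(pi/2)<..<pi/2}"
    by (rule linorder_inj_onI) (use height_strict_mono in \<open>auto simp: less_imp_neq\<close>)
  show "height ` {-(pi/2)<..<pi/2} = {-T<..<T}"
  proof
    show "height ` {-(pi/2)<..<pi/2} \<subseteq> {-T<..<T}"
      using height_in by blast
    show "{-T<..<T} \<subseteq> height ` {-(pi/2)<..<pi/2}"
    proof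
      fix t assume t: "t \<in> {-T<..<T}"
      have hT: "height (pi/2) = T" "height (-(pi/2)) = -T"
        using height_minus[of "pi/2"] by (auto simp: T_def)
      have "\<exists>x\<ge>-(pi/2). x \<le> pi/2 \<and> height x = t"
        using t hT pi_gt_zero by (intro IVT allI impI isCont_height) (simp, simp, simp, linarith, linarith)
      then obtain x where "-(pi/2) \<le> x" "x \<le> pi/2" "height x = t"
        by blast
      moreover have "x \<noteq> pi/2" "x \<noteq> -(pi/2)"
        using \<open>height x = t\<close> t hT by force+
      ultimately show "t \<in> height ` {-(pi/2)<..<pi/2}"
        by (intro image_eqI[of _ _ x]) auto
    qed
  qed
qed

lemma angle_in: "t \<in> {-T<..<T} \<Longrightarrow> angle t \<in> {-(pi/2)<..<pi/2}"
  and height_angle: "t \<in> {-T<..<T} \<Longrightarrow> height (angle t) = t"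
  unfolding angle_def using height_bij_betw
  by (auto simp: bij_betw_def the_inv_into_into[OF _ _ subset_refl] f_the_inv_into_f
      simp del: greaterThanLessThan_iff)

lemma angle_height: "\<phi> \<in> {-(pi/2)<..<pi/2} \<Longrightarrow> angle (height \<phi>) = \<phi>"
  unfolding angle_def using height_bij_betw
  by (auto simp: bij_betw_def the_inv_into_f_f simp del: greaterThanLessThan_iff)

lemma angle_0: "angle 0 = 0"
  using angle_height[of 0] by (simp add: height_0)

lemma angle_minus: "t \<in> {-T<..<T} \<Longrightarrow> angle (- t) = - angle t"
  using angle_height[of "- angle t"] height_minus[of "angle t"] angle_in[of t] height_angle[of t]
  by auto

lemma angle_pos_iff: "t \<in> {-T<..<T} \<Longrightarrow> 0 < angle t \<longleftrightarrow> 0 < t"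
  using height_less_iff[of 0 "angle t"] angle_in[of t] height_angle[of t] by (auto simp: height_0)

lemma isCont_angle:
  assumes t: "t \<in> {-T<..<T}"
  shows "isCont angle t"
proof -
  define x where "x = angle t"
  have x: "x \<in> {-(pi/2)<..<pi/2}" "height x = t"
    using angle_in height_angle t unfolding x_def by auto
  obtain l where l: "-(pi/2) < l" "l < x" using dense x(1) by auto
  obtain u where u: "x < u" "u < pi/2" using dense[of x "pi/2"] x(1) by auto
  have "isCont angle (height x)"
    by (rule isCont_inverse_function2[of l _ u])
       (use l u in \<open>auto intro!: angle_height isCont_height\<close>)
  then show ?thesis using x by simp
qed

lemma sinh_of_angle_pos: "0 < sinh_of_angle \<phi>"
  using sinh_a_pos by (simp add: sinh_of_angle_def)

lemma cos_pos: "\<phi> \<in> {-(pi/2)<..<pi/2} \<Longrightarrow> 0 < cos \<phi>"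
  using cos_gt_zero_pi by auto

lemma sinh_of_angle_power:
  assumes "\<phi> \<in> {-(pi/2)<..<pi/2}"
  shows "sinh_of_angle \<phi> ^ m = sinh a ^ m / cos \<phi>"
proof -
  have "exp (- ln (cos \<phi>) / m) ^ m = exp (- ln (cos \<phi>))"
    using m_pos by (subst exp_of_nat_mult[symmetric]) simp
  then show ?thesis
    using cos_pos[OF assms] by (simp add: sinh_of_angle_def power_mult_distrib exp_minus field_simps)
qed

lemma tanh_arsinh: "tanh (arsinh x) = x / sqrt (x\<^sup>2 + 1)" for x :: real
  by (simp add: tanh_def cosh_arsinh_real)

lemma tanh_of_angle_eq:
  assumes "\<phi> \<in> {-(pi/2)<..<pi/2}"
  shows "tanh_of_angle \<phi> = tanh (arsinh (sinh_of_angle \<phi>))"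
proof -
  define e where "e = exp (ln (cos \<phi>) / m)"
  have e: "0 < e" "e ^ m = cos \<phi>"
    using cos_pos[OF assms] m_pos by (auto simp: e_def simp flip: exp_of_nat_mult)
  have "root m ((cos \<phi>)\<^sup>2) = e\<^sup>2"
    using e m_pos by (intro real_root_pos_unique) (auto simp flip: power_mult simp: mult.commute[of 2] power_mult)
  moreover have s: "sinh_of_angle \<phi> = sinh a / e"
    by (simp add: sinh_of_angle_def e_def exp_minus field_simps)
  moreover have "sqrt ((sinh a / e)\<^sup>2 + 1) = sqrt ((sinh a)\<^sup>2 + e\<^sup>2) / e"
  proof -
    have "(sinh a / e)\<^sup>2 + 1 = ((sinh a)\<^sup>2 + e\<^sup>2) / e\<^sup>2"
      using e by (simp add: field_simps)
    then show ?thesis using e by (simp add: real_sqrt_divide)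
  qed
  ultimately show ?thesis
    using e by (simp add: tanh_arsinh tanh_of_angle_def)
qed

lemma sinh_of_angle_has_derivative:
  assumes "\<phi> \<in> {-(pi/2)<..<pi/2}"
  shows "(sinh_of_angle has_real_derivative sinh_of_angle \<phi> * tan \<phi> / m) (at \<phi>)"
  unfolding sinh_of_angle_def [abs_def] using cos_pos[OF assms] m_pos
  by (auto intro!: derivative_eq_intros simp: tan_def field_simps)

lemma sinh_of_angle_ge: "\<phi> \<in> {-(pi/2)<..<pi/2} \<Longrightarrow> sinh a \<le> sinh_of_angle \<phi>"
  using cos_pos[of \<phi>] sinh_a_pos m_pos
  by (simp add: sinh_of_angle_def divide_nonneg_pos mult_le_cancel_left1 divide_nonpos_pos)

lemma sinh_profile: "sinh (profile t) = sinh_of_angle (angle t)"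
  by (simp add: profile_def sinh_arsinh_real)

lemma profile_ge: "t \<in> {-T<..<T} \<Longrightarrow> a \<le> profile t"
  using sinh_of_angle_ge[OF angle_in] by (metis sinh_profile sinh_real_le_iff)

lemma profile_pos: "t \<in> {-T<..<T} \<Longrightarrow> 0 < profile t"
  using profile_ge a_pos by force

lemma tanh_profile: "t \<in> {-T<..<T} \<Longrightarrow> tanh (profile t) = tanh_of_angle (angle t)"
  by (simp add: profile_def tanh_of_angle_eq[OF angle_in])

lemma tanh_coth: "x \<noteq> 0 \<Longrightarrow> tanh x * coth x = 1" "x \<noteq> 0 \<Longrightarrow> coth x * tanh x = 1"
  for x :: real
  by (auto simp: coth_def tanh_def field_simps)

lemma angle_has_derivative:
  assumes t: "t \<in> {-T<..<T}"
  shows "(angle has_real_derivative real m * coth (profile t)) (at t)"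
proof -
  have "(angle has_real_derivative inverse (tanh_of_angle (angle t) / m)) (at t)"
  proof (rule DERIV_inverse_function[where f = height and a = "-T" and b = T])
    show "(height has_real_derivative tanh_of_angle (angle t) / real m) (at (angle t))"
      using angle_in[OF t] by (intro height_has_derivative) auto
    show "tanh_of_angle (angle t) / real m \<noteq> 0"
      using tanh_of_angle_pos[of "angle t"] m_pos by auto
  qed (use t isCont_angle[OF t] in \<open>auto intro!: height_angle\<close>)
  moreover have "inverse (tanh_of_angle (angle t) / m) = real m * coth (profile t)"
    using tanh_coth[of "profile t"] profile_pos[OF t] m_pos
    by (simp add: tanh_profile[OF t, symmetric] field_simps)
  ultimately show ?thesis by simp
qed

lemma profile_has_derivative:
  assumes t: "t \<in> {-T<..<T}"
  shows "(profile has_real_derivative tan (angle t)) (at t)"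
proof -
  let ?s = "sinh_of_angle (angle t)"
  have "(profile has_real_derivative
      1 / sqrt (?s\<^sup>2 + 1) * (?s * tan (angle t) / m * (real m * coth (profile t)))) (at t)"
    unfolding profile_def [abs_def]
    apply (rule DERIV_chain2[OF arsinh_real_has_field_derivative])
    apply (rule DERIV_chain2[where f = sinh_of_angle and g = angle, OF sinh_of_angle_has_derivative[OF angle_in[OF t]]])
    using angle_has_derivative[OF t] by (simp add: profile_def)
  moreover have "1 / sqrt (?s\<^sup>2 + 1) * (?s * tan (angle t) / m * (real m * coth (profile t)))
      = (tanh (profile t) * coth (profile t)) * tan (angle t)"
    using m_pos by (simp add: profile_def tanh_arsinh)
  ultimately show ?thesis
    using tanh_coth[of "profile t"] profile_pos[OF t] by simp
qed

lemma deriv_profile: "t \<in> {-T<..<T} \<Longrightarrow> deriv profile t = tan (angle t)"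
  using profile_has_derivative DERIV_imp_deriv by blast

lemma deriv_profile_has_derivative:
  assumes t: "t \<in> {-T<..<T}"
  shows "(deriv profile has_real_derivative
    real m * coth (profile t) * (1 + (deriv profile t)\<^sup>2)) (at t)"
proof -
  have c: "cos (angle t) \<noteq> 0"
    using cos_pos[OF angle_in[OF t]] by simp
  have "((\<lambda>t. tan (angle t)) has_real_derivative
      inverse ((cos (angle t))\<^sup>2) * (real m * coth (profile t))) (at t)"
    by (rule DERIV_chain2[OF DERIV_tan[OF c] angle_has_derivative[OF t]])
  moreover have "inverse ((cos (angle t))\<^sup>2) = 1 + (deriv profile t)\<^sup>2"
    using tan_sec[OF c] deriv_profile[OF t] by (simp add: power_inverse)
  ultimately have "((\<lambda>t. tan (angle t)) has_real_derivative
      real m * coth (profile t) * (1 + (deriv profile t)\<^sup>2)) (at t)"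
    by (simp add: mult.commute)
  moreover have "open {-T<..<T}" by simp
  ultimately show ?thesis
    using has_field_derivative_transform_within_open[of _ _ t "{-T<..<T}" "deriv profile"] t deriv_profile
    by (metis (no_types, lifting))
qed

lemma profile_0: "profile 0 = a"
  by (simp add: profile_def angle_0 sinh_of_angle_def arsinh_sinh_real)

lemma cauchy_solution_profile: "cauchy_solution (Suc m) a {-T<..<T} profile"
  unfolding cauchy_solution_def
proof (intro conjI ballI)
  show "deriv profile 0 = 0"
    using T_pos by (subst deriv_profile) (auto simp: angle_0)
  fix t assume t: "t \<in> {-T<..<T}"
  show "profile t \<noteq> 0" using profile_pos[OF t] by simp
  show "profile differentiable at t"
    using profile_has_derivative[OF t] real_differentiable_def by blast
  show "(deriv profile has_real_derivative
      (real (Suc m) - 1) * coth (profile t) * (1 + (deriv profile t)\<^sup>2)) (at t)"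
    using deriv_profile_has_derivative[OF t] by simp
qed (use T_pos in \<open>auto simp: profile_0 is_interval_oo\<close>)

lemma profile_minus: "t \<in> {-T<..<T} \<Longrightarrow> profile (- t) = profile t"
  by (simp add: profile_def angle_minus sinh_of_angle_def)

lemma deriv_profile_pos: "t \<in> {0<..<T} \<Longrightarrow> 0 < deriv profile t"
  using deriv_profile[of t] angle_pos_iff[of t] angle_in[of t] T_pos
  by (auto intro!: tan_gt_zero)

lemma deriv_profile_neg: "t \<in> {-T<..<0} \<Longrightarrow> deriv profile t < 0"
  using deriv_profile[of t] angle_pos_iff[of "-t"] angle_minus[of t] angle_in[of t] T_pos
    tan_gt_zero[of "- angle t"]
  by auto

text \<open>The tangent angle of an arbitrary solution satisfies \<open>height (arctan (h' t)) = t\<close>, because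
  both sides have derivative \<open>1\<close>. This confines \<open>t\<close> to \<open>]-T, T[\<close> and determines \<open>h\<close>.\<close>

lemma cauchy_solution_unique:
  assumes h: "cauchy_solution (Suc m) a J h" and t: "t \<in> J"
  shows "t \<in> {-T<..<T} \<and> h t = profile t"
proof -
  define q where "q = deriv h"
  have J: "open J" "is_interval J" "0 \<in> J" "h 0 = a" "q 0 = 0"
    and h0: "\<And>t. t \<in> J \<Longrightarrow> h t \<noteq> 0"
    and dh: "\<And>t. t \<in> J \<Longrightarrow> (h has_real_derivative q t) (at t)"
    and dq: "\<And>t. t \<in> J \<Longrightarrow>
      (q has_real_derivative real m * coth (h t) * (1 + (q t)\<^sup>2)) (at t)"
    using h unfolding cauchy_solution_def q_def
    by (auto simp: DERIV_deriv_iff_real_differentiable)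
  have conv: "convex J" using J is_interval_convex by blast
  have conth: "continuous_on J h"
    using dh DERIV_isCont continuous_at_imp_continuous_on by blast
  have hpos: "0 < h s" if "s \<in> J" for s
  proof (rule ccontr)
    assume "\<not> 0 < h s"
    moreover have "connected (h ` J)"
      using connected_continuous_image conth conv convex_connected by blast
    ultimately have "0 \<in> h ` J"
      using J that a_pos unfolding connected_iff_interval
      by (metis image_eqI less_eq_real_def linorder_not_le)
    then show False using h0 by force
  qed
  have sp: "0 < sinh (h s)" if "s \<in> J" for s using hpos[OF that] by simp
  \<comment> \<open>the first integral of the equation\<close>
  define E where "E = (\<lambda>s. (1 + (q s)\<^sup>2) / sinh (h s) ^ (2 * m))"
  have "(E has_real_derivative 0) (at s)" if "s \<in> J" for s
  proof -
    let ?q = "q s" and ?S = "sinh (h s)"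
    have "(E has_real_derivative
       ((2 * ?q * (real m * coth (h s) * (1 + ?q\<^sup>2))) * ?S ^ (2 * m)
        - (1 + ?q\<^sup>2) * (real (2 * m) * ?S ^ (2 * m - 1) * (cosh (h s) * ?q)))
        / (?S ^ (2 * m) * ?S ^ (2 * m))) (at s)"
    proof -
      have "((\<lambda>s. 1 + (q s)\<^sup>2) has_real_derivative
          2 * ?q * (real m * coth (h s) * (1 + ?q\<^sup>2))) (at s)"
        using dq[OF that] by (auto intro!: derivative_eq_intros)
      moreover have "((\<lambda>s. sinh (h s) ^ (2 * m)) has_real_derivative
          real (2 * m) * ?S ^ (2 * m - 1) * (cosh (h s) * ?q)) (at s)"
        using dh[OF that] by (auto intro!: derivative_eq_intros)
      moreover have "?S ^ (2 * m) \<noteq> 0" using sp[OF that] by simp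
      ultimately show ?thesis unfolding E_def by (rule DERIV_divide)
    qed
    moreover have "?S ^ (2 * m) = ?S ^ (2 * m - 1) * ?S"
      using power_minus_mult[of "2 * m" ?S] m_pos by simp
    then have "(2 * ?q * (real m * coth (h s) * (1 + ?q\<^sup>2))) * ?S ^ (2 * m)
        = (1 + ?q\<^sup>2) * (real (2 * m) * ?S ^ (2 * m - 1) * (cosh (h s) * ?q))"
      using sp[OF that] by (simp add: coth_def)
    ultimately show ?thesis by simp
  qed
  then have "\<exists>c. \<forall>s\<in>J. E s = c"
    using conv by (intro has_field_derivative_zero_constant) (auto intro: has_field_derivative_at_within)
  then have "E s = E 0" if "s \<in> J" for s
    using J(3) that by metis
  then have first_integral: "sinh (h s) ^ (2 * m) = sinh a ^ (2 * m) * (1 + (q s)\<^sup>2)"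
    if "s \<in> J" for s
    using that sp[OF that] sinh_a_pos J by (auto simp: E_def field_simps)
  have arc: "arctan x \<in> {-(pi/2)<..<pi/2}" for x
    using arctan_bounded[of x] by auto
  have hs: "h s = arsinh (sinh_of_angle (arctan (q s)))" if s: "s \<in> J" for s
  proof -
    have "(sinh (h s) ^ m)\<^sup>2 = (sinh_of_angle (arctan (q s)) ^ m)\<^sup>2"
    proof -
      have "(sinh (h s) ^ m)\<^sup>2 = sinh a ^ (2 * m) * (1 + (q s)\<^sup>2)"
        using first_integral[OF s] by (simp add: power_mult[symmetric] mult.commute)
      also have "\<dots> = (sinh_of_angle (arctan (q s)) ^ m)\<^sup>2"
        unfolding sinh_of_angle_power[OF arc]
        by (simp add: cos_arctan power_mult_distrib power_mult[symmetric] mult.commute add_nonneg_nonneg)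
      finally show ?thesis .
    qed
    then have "sinh (h s) = sinh_of_angle (arctan (q s))"
      using sp[OF s] sinh_of_angle_pos[of "arctan (q s)"] m_pos
      by (metis less_imp_le power_eq_iff_eq_base zero_le_power pos2)
    then show ?thesis by (metis arsinh_sinh_real)
  qed
  have "((\<lambda>s. height (arctan (q s)) - s) has_real_derivative 0) (at s)" if s: "s \<in> J" for s
  proof -
    let ?q = "q s"
    have ne: "1 + ?q\<^sup>2 \<noteq> 0" by (metis add_pos_nonneg less_numeral_extra(1,3) zero_le_power2)
    have "((\<lambda>s. height (arctan (q s)) - s) has_real_derivative
        tanh_of_angle (arctan ?q) / m * (inverse (1 + ?q\<^sup>2) * (real m * coth (h s) * (1 + ?q\<^sup>2))) - 1)
        (at s)"
      apply (rule DERIV_diff[OF _ DERIV_ident])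
      apply (rule DERIV_chain2[OF height_has_derivative])
      subgoal using arc[of ?q] by simp
      subgoal using arc[of ?q] by simp
      apply (rule DERIV_chain2[OF DERIV_arctan])
      by (rule dq[OF s])
    moreover have "tanh_of_angle (arctan ?q) / m * (inverse (1 + ?q\<^sup>2) * (real m * coth (h s) * (1 + ?q\<^sup>2)))
        = tanh (h s) * coth (h s)"
      using ne m_pos hs[OF s] by (simp add: tanh_of_angle_eq[OF arc])
    ultimately show ?thesis using tanh_coth[of "h s"] hpos[OF s] by simp
  qed
  then have "\<exists>c. \<forall>s\<in>J. height (arctan (q s)) - s = c"
    using conv by (intro has_field_derivative_zero_constant) (auto intro: has_field_derivative_at_within)
  then obtain c where c: "\<And>s. s \<in> J \<Longrightarrow> height (arctan (q s)) - s = c" by blast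
  with J(3,5) have "c = 0" by (force simp: height_0)
  with c[OF t] have "height (arctan (q t)) = t" by simp
  then have "t \<in> {-T<..<T}" "angle t = arctan (q t)"
    using height_in[OF arc] angle_height[OF arc] by metis+
  then show ?thesis using hs[OF t] by (simp add: profile_def)
qed

lemma maximal_solution_profile: "maximal_solution (Suc m) a {-T<..<T} profile"
  unfolding maximal_solution_def using cauchy_solution_profile cauchy_solution_unique by blast

lemma maximal_solution_unique:
  assumes "maximal_solution (Suc m) a J h"
  shows "J = {-T<..<T}" and "\<And>t. t \<in> {-T<..<T} \<Longrightarrow> h t = profile t"
proof -
  have h: "cauchy_solution (Suc m) a J h"
    using assms unfolding maximal_solution_def by blast
  have "J \<subseteq> {-T<..<T}" "\<forall>t\<in>J. profile t = h t"
    using cauchy_solution_unique[OF h] by auto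
  then show "J = {-T<..<T}"
    using assms cauchy_solution_profile unfolding maximal_solution_def by blast
  then show "h t = profile t" if "t \<in> {-T<..<T}" for t
    using cauchy_solution_unique[OF h] that by blast
qed

section \<open>The inverse function and its integral formula\<close>

text \<open>The tangent angle at the point where \<open>f = \<rho>\<close>, on the half \<open>t \<ge> 0\<close> of the curve, and the
  height \<open>\<lambda>(a, \<rho>)\<close> of that point.\<close>

definition angle_at :: "real \<Rightarrow> real" where
  "angle_at \<rho> = arccos ((sinh a / sinh \<rho>) ^ m)"

definition lam :: "real \<Rightarrow> real" where
  "lam \<rho> = height (angle_at \<rho>)"

lemma ratio_bounds:
  assumes "a \<le> \<rho>"
  shows "0 < (sinh a / sinh \<rho>) ^ m" "(sinh a / sinh \<rho>) ^ m \<le> 1"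
proof -
  have "0 < sinh \<rho>" "sinh a \<le> sinh \<rho>" using assms a_pos by auto
  then show "0 < (sinh a / sinh \<rho>) ^ m" "(sinh a / sinh \<rho>) ^ m \<le> 1"
    using sinh_a_pos by (auto intro!: power_le_one)
qed

lemma angle_at_in: "a \<le> \<rho> \<Longrightarrow> angle_at \<rho> \<in> {0..<pi/2}"
  unfolding angle_at_def using ratio_bounds[of \<rho>] arccos_lbound[of "(sinh a / sinh \<rho>) ^ m"]
    arccos_less_arccos[of 0 "(sinh a / sinh \<rho>) ^ m"] by auto

lemma angle_at_in': "a \<le> \<rho> \<Longrightarrow> angle_at \<rho> \<in> {-(pi/2)<..<pi/2}"
  using angle_at_in[of \<rho>] by (auto intro: less_le_trans[of _ 0])

lemma sinh_of_angle_angle_at: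
  assumes "a \<le> \<rho>"
  shows "sinh_of_angle (angle_at \<rho>) = sinh \<rho>"
proof -
  have p: "0 < sinh \<rho>" using assms a_pos by auto
  have "sinh_of_angle (angle_at \<rho>) ^ m = sinh a ^ m / (sinh a / sinh \<rho>) ^ m"
    using ratio_bounds[OF assms] by (subst sinh_of_angle_power[OF angle_at_in'[OF assms]])
      (simp add: angle_at_def)
  also have "\<dots> = sinh \<rho> ^ m" using p sinh_a_pos by (simp add: field_simps)
  finally show ?thesis
    using p sinh_of_angle_pos[of "angle_at \<rho>"] m_pos
    by (metis less_imp_le power_eq_iff_eq_base)
qed

lemma lam_in: "a \<le> \<rho> \<Longrightarrow> lam \<rho> \<in> {0..<T}"
  using angle_at_in[of \<rho>] height_in[OF angle_at_in'] height_strict_mono[of 0 "angle_at \<rho>"]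
  unfolding lam_def by (cases "angle_at \<rho> = 0") (auto simp: height_0 T_pos)

lemma angle_lam: "a \<le> \<rho> \<Longrightarrow> angle (lam \<rho>) = angle_at \<rho>"
  unfolding lam_def using angle_height angle_at_in' by blast

lemma profile_lam: "a \<le> \<rho> \<Longrightarrow> profile (lam \<rho>) = \<rho>"
  by (simp add: profile_def angle_lam sinh_of_angle_angle_at arsinh_sinh_real)

lemma lam_profile:
  assumes t: "t \<in> {0..<T}"
  shows "lam (profile t) = t"
proof -
  have t': "t \<in> {-T<..<T}" using t T_pos by auto
  have an: "angle t \<in> {0..<pi/2}"
    using angle_in[OF t'] angle_pos_iff[OF t'] angle_0 t by (cases "t = 0") auto
  have "(sinh a / sinh (profile t)) ^ m = cos (angle t)"
    using sinh_of_angle_power[OF angle_in[OF t']] sinh_a_pos cos_pos[OF angle_in[OF t']]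
    by (simp add: sinh_profile power_divide)
  then have "angle_at (profile t) = angle t"
    using an unfolding angle_at_def by (simp add: arccos_cos)
  then show ?thesis by (simp add: lam_def height_angle[OF t'])
qed

lemma bij_betw_profile: "bij_betw profile {0..<T} {a..}"
proof (rule bij_betwI[where g = lam])
  show "profile \<in> {0..<T} \<rightarrow> {a..}" using profile_ge T_pos by auto
  show "lam \<in> {a..} \<rightarrow> {0..<T}" using lam_in by auto
qed (use lam_profile profile_lam in auto)


lemma lam_a: "lam a = 0"
  using sinh_a_pos by (simp add: lam_def angle_at_def height_0)

lemma continuous_on_lam: "continuous_on {a..} lam"
  unfolding lam_def angle_at_def
proof (rule continuous_on_compose2[of "{-pi<..<pi}" height])
  show "continuous_on {-pi<..<pi} height"
    by (intro continuous_at_imp_continuous_on ballI isCont_height) auto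
  have nz: "sinh \<rho> \<noteq> 0" if "a \<le> \<rho>" for \<rho> using that a_pos by auto
  show "continuous_on {a..} (\<lambda>\<rho>. arccos ((sinh a / sinh \<rho>) ^ m))"
  proof (intro continuous_on_arccos continuous_intros ballI conjI)
    fix \<rho> assume "\<rho> \<in> {a..}"
    then show "-1 \<le> (sinh a / sinh \<rho>) ^ m" "(sinh a / sinh \<rho>) ^ m \<le> 1" "sinh \<rho> \<noteq> 0"
      using ratio_bounds[of \<rho>] nz[of \<rho>] by auto
  qed
  show "(\<lambda>\<rho>. arccos ((sinh a / sinh \<rho>) ^ m)) ` {a..} \<subseteq> {-pi<..<pi}"
    using angle_at_in' unfolding angle_at_def by fastforce
qed

lemma lam_has_derivative:
  assumes "a < u"
  shows "(lam has_real_derivative sinh a ^ m * catenary_integrand (Suc m) a u) (at u)"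
proof -
  let ?x = "(sinh a / sinh u) ^ m"
  have au: "a \<le> u" "0 < u" using assms a_pos by auto
  have p: "0 < sinh u" "sinh a < sinh u" using assms a_pos by auto
  have x: "0 < ?x" "?x < 1"
    using ratio_bounds[OF au(1)] p sinh_a_pos m_pos by (auto simp: power_less_one_iff)
  have dx: "((\<lambda>u. (sinh a / sinh u) ^ m) has_real_derivative - real m * coth u * ?x) (at u)"
  proof -
    have "((\<lambda>u. (sinh a / sinh u) ^ m) has_real_derivative
       real m * (sinh a / sinh u) ^ (m - 1) * (- (sinh a * cosh u) / (sinh u * sinh u))) (at u)"
      using p by (auto intro!: derivative_eq_intros)
    moreover have "?x = (sinh a / sinh u) ^ (m - 1) * (sinh a / sinh u)"
      by (rule power_minus_mult[OF m_pos, symmetric])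
    then have "real m * (sinh a / sinh u) ^ (m - 1) * (- (sinh a * cosh u) / (sinh u * sinh u))
      = - real m * coth u * ?x"
      by (simp add: coth_def)
    ultimately show ?thesis by simp
  qed
  have an: "angle_at u \<in> {-(pi/2)<..<pi/2}" by (rule angle_at_in'[OF au(1)])
  have "(lam has_real_derivative tanh_of_angle (angle_at u) / m *
      (inverse (- sqrt (1 - ?x\<^sup>2)) * (- real m * coth u * ?x))) (at u)"
    unfolding lam_def
    apply (rule DERIV_chain2[OF height_has_derivative])
    subgoal using an by simp
    subgoal using an by simp
    unfolding angle_at_def
    apply (rule DERIV_chain2[OF DERIV_arccos])
    using x dx by auto
  moreover have "tanh_of_angle (angle_at u) = tanh u"
    by (simp add: tanh_of_angle_eq[OF an] sinh_of_angle_angle_at[OF au(1)] arsinh_sinh_real)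
  then have "tanh_of_angle (angle_at u) / m * (inverse (- sqrt (1 - ?x\<^sup>2)) * (- real m * coth u * ?x))
     = (tanh u * coth u) * ?x / sqrt (1 - ?x\<^sup>2)"
    using m_pos by (simp add: field_simps)
  also have "\<dots> = ?x / sqrt (1 - ?x\<^sup>2)"
    using tanh_coth[of u] au by simp
  also have "\<dots> = sinh a ^ m * catenary_integrand (Suc m) a u"
  proof -
    define A where "A = sinh a ^ m"
    define S where "S = sinh u ^ m"
    have AS: "0 < A" "A < S"
      using p sinh_a_pos m_pos unfolding A_def S_def by (auto intro: power_strict_mono)
    have "catenary_integrand (Suc m) a u = (S\<^sup>2 - A\<^sup>2) powr (- (1/2))"
      by (simp add: catenary_integrand_def A_def S_def power_mult[symmetric] mult.commute)
    also have "\<dots> = 1 / sqrt (S\<^sup>2 - A\<^sup>2)"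
      using AS by (simp add: powr_minus_divide powr_half_sqrt power_mono)
    finally have "sinh a ^ m * catenary_integrand (Suc m) a u = A / sqrt (S\<^sup>2 - A\<^sup>2)"
      by (simp add: A_def)
    moreover have "sqrt (1 - (A / S)\<^sup>2) = sqrt (S\<^sup>2 - A\<^sup>2) / S"
    proof -
      have "1 - (A / S)\<^sup>2 = (S\<^sup>2 - A\<^sup>2) / S\<^sup>2" using AS by (simp add: field_simps)
      then show ?thesis using AS by (simp add: real_sqrt_divide)
    qed
    moreover have "?x = A / S" by (simp add: A_def S_def power_divide)
    ultimately show ?thesis using AS by simp
  qed
  finally show ?thesis using \<open>(lam has_real_derivative _) _\<close> by simp
qed

text \<open>The integrand is unbounded near \<open>a\<close>; the fundamental theorem only needs continuity of
  \<open>lam\<close> there, and a derivative in the interior.\<close>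

lemma integrand_has_integral:
  assumes "a \<le> \<rho>"
  shows "(catenary_integrand (Suc m) a has_integral lam \<rho> / sinh a ^ m) {a..\<rho>}"
proof -
  have nz: "sinh a ^ m \<noteq> 0" using sinh_a_pos by simp
  have "(catenary_integrand (Suc m) a has_integral lam \<rho> / sinh a ^ m - lam a / sinh a ^ m) {a..\<rho>}"
  proof (rule fundamental_theorem_of_calculus_interior[OF assms])
    show "continuous_on {a..\<rho>} (\<lambda>\<rho>. lam \<rho> / sinh a ^ m)"
      using nz by (intro continuous_intros continuous_on_subset[OF continuous_on_lam]) auto
    fix u assume "u \<in> {a<..<\<rho>}"
    then have "((\<lambda>\<rho>. lam \<rho> / sinh a ^ m) has_real_derivative catenary_integrand (Suc m) a u) (at u)"
      using nz lam_has_derivative[of u] by (auto intro!: derivative_eq_intros)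
    then show "((\<lambda>\<rho>. lam \<rho> / sinh a ^ m) has_vector_derivative catenary_integrand (Suc m) a u) (at u)"
      by (simp add: has_real_derivative_iff_has_vector_derivative)
  qed
  then show ?thesis by (simp add: lam_a)
qed

lemma lam_tendsto: "(lam \<longlongrightarrow> T) at_top"
proof -
  have "((\<lambda>\<rho>. sinh a / sinh \<rho>) \<longlongrightarrow> 0) at_top"
    by (intro real_tendsto_divide_at_top[OF tendsto_const] sinh_real_at_top)
  then have "((\<lambda>\<rho>. (sinh a / sinh \<rho>) ^ m) \<longlongrightarrow> 0 ^ m) at_top"
    by (rule tendsto_power)
  then have "((\<lambda>\<rho>. (sinh a / sinh \<rho>) ^ m) \<longlongrightarrow> 0) at_top"
    using m_pos by (simp add: zero_power)
  moreover have "isCont (\<lambda>x. height (arccos x)) 0"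
    by (rule isCont_o2[OF isCont_arccos isCont_height]) auto
  ultimately have "((\<lambda>\<rho>. height (arccos ((sinh a / sinh \<rho>) ^ m))) \<longlongrightarrow> height (arccos 0)) at_top"
    by (rule isCont_tendsto_compose[rotated])
  then show ?thesis by (simp add: lam_def [abs_def] angle_at_def T_def)
qed

lemma integrand_has_integral_inf:
  "(catenary_integrand (Suc m) a has_integral T / sinh a ^ m) {a..}"
proof (rule has_integral_to_inf)
  show "catenary_integrand (Suc m) a integrable_on {a..y}" for y
    using integrand_has_integral[of y] by (cases "a \<le> y") (auto simp: integrable_on_def)
  have "((\<lambda>y. lam y / sinh a ^ m) \<longlongrightarrow> T / sinh a ^ m) at_top"
    using lam_tendsto sinh_a_pos by (intro tendsto_intros) auto
  moreover have "eventually (\<lambda>y. lam y / sinh a ^ m = integral {a..y} (catenary_integrand (Suc m) a)) at_top"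
    using eventually_ge_at_top[of a] by eventually_elim (metis integrand_has_integral integral_unique)
  ultimately show "((\<lambda>y. integral {a..y} (catenary_integrand (Suc m) a)) \<longlongrightarrow> T / sinh a ^ m) at_top"
    by (rule Lim_transform_eventually)
  show "0 \<le> catenary_integrand (Suc m) a y" if "a \<le> y" for y
    by (simp add: catenary_integrand_def)
qed

lemma T_eq_integral: "T = integral {0..pi/2} tanh_of_angle / m"
proof -
  have "integral {-pi..0} tanh_of_angle + integral {0..pi/2} tanh_of_angle = integral {-pi..pi/2} tanh_of_angle"
    by (intro Henstock_Kurzweil_Integration.integral_combine integrable_continuous_real
          continuous_on_tanh_of_angle) auto
  then show ?thesis by (simp add: T_def height_def field_simps)
qed

text \<open>The solution tends to infinity at both ends of its interval.\<close>

lemma bounded_profile_imp: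
  "\<exists>c<T. \<forall>t\<in>{-T<..<T}. profile t \<le> C \<longrightarrow> \<bar>t\<bar> \<le> c"
proof (intro exI conjI ballI impI)
  let ?C = "max a C"
  show "lam ?C < T" using lam_in[of ?C] by auto
  fix t assume t: "t \<in> {-T<..<T}" and le: "profile t \<le> C"
  have abs: "\<bar>t\<bar> \<in> {0..<T}" "profile \<bar>t\<bar> = profile t"
    using t profile_minus[of t] by (auto simp: abs_if)
  have "sinh (profile \<bar>t\<bar>) \<le> sinh ?C" "0 < sinh (profile \<bar>t\<bar>)"
    using abs le profile_pos[OF t] by auto
  then have "(sinh a / sinh ?C) ^ m \<le> (sinh a / sinh (profile \<bar>t\<bar>)) ^ m"
    using sinh_a_pos by (intro power_mono divide_left_mono mult_pos_pos) auto
  then have "angle_at (profile \<bar>t\<bar>) \<le> angle_at ?C"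
    unfolding angle_at_def
    using ratio_bounds[of ?C] ratio_bounds[of "profile \<bar>t\<bar>"] profile_ge[OF t] abs
    by (intro arccos_le_arccos) auto
  then have "lam (profile \<bar>t\<bar>) \<le> lam ?C"
    unfolding lam_def using height_strict_mono[of "angle_at (profile \<bar>t\<bar>)" "angle_at ?C"]
      angle_at_in'[of ?C] angle_at_in'[of "profile \<bar>t\<bar>"] profile_ge[OF t] abs
    by (cases "angle_at (profile \<bar>t\<bar>) = angle_at ?C") (auto)
  then show "\<bar>t\<bar> \<le> lam ?C" using lam_profile[OF abs(1)] by simp
qed

lemma profile_first_integral:
  assumes t: "t \<in> {-T<..<T}"
  shows "1 + (deriv profile t)\<^sup>2 = (sinh (profile t) / sinh a) ^ (2 * m)"
proof -
  have c: "cos (angle t) \<noteq> 0" using cos_pos[OF angle_in[OF t]] by simp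
  have "(sinh (profile t) / sinh a) ^ (2 * m) = ((sinh_of_angle (angle t)) ^ m / sinh a ^ m)\<^sup>2"
    by (simp add: sinh_profile power_divide power_mult[symmetric] mult.commute)
  also have "\<dots> = (1 / cos (angle t))\<^sup>2"
    using sinh_a_pos by (simp add: sinh_of_angle_power[OF angle_in[OF t]])
  also have "\<dots> = 1 + (deriv profile t)\<^sup>2"
    using tan_sec[OF c] deriv_profile[OF t] by (simp add: inverse_eq_divide)
  finally show ?thesis by simp
qed

end

section \<open>Dependence on the initial height\<close>

lemma tanh_of_angle_mono:
  assumes "0 < m" "0 < a" "a < b"
  shows "catenary_curve.tanh_of_angle m a \<phi> \<le> catenary_curve.tanh_of_angle m b \<phi>"
    and "cos \<phi> \<noteq> 0 \<Longrightarrow> catenary_curve.tanh_of_angle m a \<phi> < catenary_curve.tanh_of_angle m b \<phi>"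
proof -
  interpret A: catenary_curve m a using assms by unfold_locales auto
  interpret B: catenary_curve m b using assms by unfold_locales auto
  define c where "c = root m ((cos \<phi>)\<^sup>2)"
  have c: "0 \<le> c" "cos \<phi> \<noteq> 0 \<Longrightarrow> 0 < c"
    using assms(1) by (auto simp: c_def real_root_ge_zero)
  have ab: "0 < sinh a" "sinh a < sinh b" using assms by auto
  \<comment> \<open>in this form the monotonicity in \<open>s = sinh a\<close> is visible\<close>
  have form: "s / sqrt (s\<^sup>2 + c) = 1 / sqrt (1 + c / s\<^sup>2)" if "0 < s" for s
  proof -
    have "1 + c / s\<^sup>2 = (s\<^sup>2 + c) / s\<^sup>2" using that by (simp add: field_simps)
    then show ?thesis using that by (simp add: real_sqrt_divide)
  qed
  have sq: "(sinh a)\<^sup>2 < (sinh b)\<^sup>2" "0 < (sinh b)\<^sup>2 * (sinh a)\<^sup>2" "0 < (sinh b)\<^sup>2"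
    using ab by (auto intro!: power_strict_mono)
  have eqs: "A.tanh_of_angle \<phi> = 1 / sqrt (1 + c / (sinh a)\<^sup>2)"
       "B.tanh_of_angle \<phi> = 1 / sqrt (1 + c / (sinh b)\<^sup>2)"
    using form[of "sinh a"] form[of "sinh b"] ab
    unfolding A.tanh_of_angle_def B.tanh_of_angle_def c_def by auto
  have "c / (sinh b)\<^sup>2 \<le> c / (sinh a)\<^sup>2"
    using c sq by (intro divide_left_mono) auto
  moreover have "0 \<le> c / (sinh b)\<^sup>2" using c by simp
  ultimately show "A.tanh_of_angle \<phi> \<le> B.tanh_of_angle \<phi>"
    unfolding eqs by (intro divide_left_mono real_sqrt_le_mono mult_pos_pos) auto
  assume "cos \<phi> \<noteq> 0"
  then have "c / (sinh b)\<^sup>2 < c / (sinh a)\<^sup>2" "0 < c / (sinh b)\<^sup>2"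
    using c sq by (auto intro!: divide_strict_left_mono)
  then show "A.tanh_of_angle \<phi> < B.tanh_of_angle \<phi>"
    unfolding eqs by (intro divide_strict_left_mono real_sqrt_less_mono mult_pos_pos) auto
qed

text \<open>Strictness is taken from the interval \<open>[0, \<pi>/4]\<close>, away from the zero of the cosine at
  \<open>\<pi>/2\<close>, where \<open>tanh_of_angle\<close> is \<open>1\<close> for every \<open>a\<close>.\<close>

lemma T_strict_mono:
  assumes "0 < m" "0 < a" "a < b"
  shows "catenary_curve.T m a < catenary_curve.T m b"
proof -
  interpret A: catenary_curve m a using assms by unfold_locales auto
  interpret B: catenary_curve m b using assms by unfold_locales auto
  let ?I = "\<lambda>u v f. integral {u..v::real} f :: real"
  have intg: "A.tanh_of_angle integrable_on {u..v}" "B.tanh_of_angle integrable_on {u..v}" for u v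
    by (auto intro!: integrable_continuous_real A.continuous_on_tanh_of_angle B.continuous_on_tanh_of_angle)
  have "?I 0 (pi/4) A.tanh_of_angle < ?I 0 (pi/4) B.tanh_of_angle"
  proof (rule integral_less_real)
    show "A.tanh_of_angle x < B.tanh_of_angle x" if "x \<in> {0<..<pi/4}" for x
      using that tanh_of_angle_mono(2)[OF assms] cos_gt_zero[of x] by force
    show "continuous_on {0..pi/4} A.tanh_of_angle" "continuous_on {0..pi/4} B.tanh_of_angle"
      by (rule A.continuous_on_tanh_of_angle B.continuous_on_tanh_of_angle)+
  qed (auto simp: not_le)
  moreover have "?I (pi/4) (pi/2) A.tanh_of_angle \<le> ?I (pi/4) (pi/2) B.tanh_of_angle"
    by (intro integral_le intg) (rule tanh_of_angle_mono(1)[OF assms])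
  moreover have "?I 0 (pi/4) A.tanh_of_angle + ?I (pi/4) (pi/2) A.tanh_of_angle = ?I 0 (pi/2) A.tanh_of_angle"
    "?I 0 (pi/4) B.tanh_of_angle + ?I (pi/4) (pi/2) B.tanh_of_angle = ?I 0 (pi/2) B.tanh_of_angle"
    by (intro Henstock_Kurzweil_Integration.integral_combine intg; simp)+
  ultimately show ?thesis
    using assms(1) by (simp add: A.T_eq_integral B.T_eq_integral divide_strict_right_mono)
qed

lemma T_tendsto_0:
  assumes m: "0 < m"
  shows "(catenary_curve.T m \<longlongrightarrow> 0) (at_right 0)"
proof (rule tendsto_at_right_sequentially[of 0 1])
  fix S :: "nat \<Rightarrow> real"
  assume S: "\<And>n. 0 < S n" "S \<longlonglongrightarrow> 0"
  have cc: "catenary_curve m (S n)" for n using m S(1) by unfold_locales auto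
  let ?f = "\<lambda>n. catenary_curve.tanh_of_angle m (S n)"
  \<comment> \<open>the pointwise limit, zero except at the zero of the cosine\<close>
  let ?g = "\<lambda>\<phi>. if \<phi> = pi / 2 then 1 else 0 :: real"
  have sinhS: "(\<lambda>n. sinh (S n)) \<longlonglongrightarrow> 0"
    using tendsto_sinh[OF S(2)] by simp
  have "(\<lambda>n. integral {0..pi/2} (?f n)) \<longlonglongrightarrow> integral {0..pi/2} ?g"
  proof (rule dominated_convergence(2)[where h = "\<lambda>_. 1"])
    show "?f n integrable_on {0..pi/2}" for n
      by (intro integrable_continuous_real catenary_curve.continuous_on_tanh_of_angle cc)
    show "norm (?f n x) \<le> 1" if "x \<in> {0..pi/2}" for n x
    proof -
      interpret catenary_curve m "S n" by (rule cc)
      show ?thesis using tanh_of_angle_le_1[of x] tanh_of_angle_pos[of x] by simp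
    qed
    show "(\<lambda>n. ?f n x) \<longlonglongrightarrow> ?g x" if "x \<in> {0..pi/2}" for x
    proof (cases "x = pi/2")
      case True
      have "?f n x = 1" for n
        using m catenary_curve.sinh_a_pos[OF cc[of n]]
        by (simp add: catenary_curve.tanh_of_angle_def[OF cc] True)
      then show ?thesis by (simp add: True)
    next
      case False
      then have "0 < cos x" using that cos_gt_zero_pi[of x] by auto
      then have "0 < root m ((cos x)\<^sup>2)" using m by simp
      then have "(\<lambda>n. sinh (S n) / sqrt ((sinh (S n))\<^sup>2 + root m ((cos x)\<^sup>2)))
          \<longlonglongrightarrow> 0 / sqrt (0\<^sup>2 + root m ((cos x)\<^sup>2))"
        by (intro tendsto_intros sinhS) auto
      then show ?thesis using False by (simp add: catenary_curve.tanh_of_angle_def[OF cc])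
    qed
  qed (rule integrable_const_ivl)
  moreover have "integral {0..pi/2} ?g = integral {0..pi/2} (\<lambda>_. 0 :: real)"
    by (rule integral_spike[of "{pi/2}"]) auto
  ultimately have "(\<lambda>n. integral {0..pi/2} (?f n) / m) \<longlonglongrightarrow> 0 / m"
    by (intro tendsto_divide) (use m in auto)
  then show "(\<lambda>n. catenary_curve.T m (S n)) \<longlonglongrightarrow> 0"
    by (simp add: catenary_curve.T_eq_integral[OF cc])
qed simp

text \<open>The lower bound comes from \<open>root m ((cos \<phi>)\<^sup>2) \<le> 1\<close>.\<close>

lemma T_bounds:
  assumes "0 < m" "0 < a"
  shows "catenary_curve.T m a \<le> pi / 2 / m"
    and "sinh a / sqrt ((sinh a)\<^sup>2 + 1) * (pi / 2) / m \<le> catenary_curve.T m a"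
proof -
  interpret catenary_curve m a using assms by unfold_locales auto
  have r: "0 \<le> root m ((cos x)\<^sup>2)" "root m ((cos x)\<^sup>2) \<le> 1" for x
    using m_pos by (auto simp: real_root_ge_zero real_root_le_1_iff abs_square_le_1)
  have "integral {0..pi/2} tanh_of_angle \<le> integral {0..pi/2} (\<lambda>_. 1)"
    by (intro integral_le integrable_continuous_real continuous_on_tanh_of_angle)
      (auto simp: tanh_of_angle_le_1)
  then show "T \<le> pi / 2 / m"
    unfolding T_eq_integral by (intro divide_right_mono) (simp_all add: mult.commute)
  let ?c = "sinh a / sqrt ((sinh a)\<^sup>2 + 1)"
  have "?c \<le> tanh_of_angle x" for x
    unfolding tanh_of_angle_def using r sinh_a_pos tanh_of_angle_denom_pos[of x]
    by (intro divide_left_mono real_sqrt_le_mono mult_pos_pos) (auto simp: add_pos_nonneg)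
  then have "integral {0..pi/2} (\<lambda>_. ?c) \<le> integral {0..pi/2} tanh_of_angle"
    by (intro integral_le integrable_continuous_real continuous_on_tanh_of_angle) auto
  then show "?c * (pi / 2) / m \<le> T"
    unfolding T_eq_integral by (intro divide_right_mono) (simp_all add: mult.commute)
qed

lemma T_tendsto_at_top:
  assumes m: "0 < m"
  shows "(catenary_curve.T m \<longlongrightarrow> pi / 2 / m) at_top"
proof (rule tendsto_sandwich)
  show "eventually (\<lambda>a. sinh a / sqrt ((sinh a)\<^sup>2 + 1) * (pi / 2) / m \<le> catenary_curve.T m a) at_top"
    using eventually_gt_at_top[of 0] by eventually_elim (rule T_bounds[OF m])
  show "eventually (\<lambda>a. catenary_curve.T m a \<le> pi / 2 / m) at_top"
    using eventually_gt_at_top[of 0] by eventually_elim (rule T_bounds[OF m])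
  have "sinh a / sqrt ((sinh a)\<^sup>2 + 1) = tanh a" for a :: real
    by (simp add: tanh_def flip: cosh_square_eq)
  then have "((\<lambda>a::real. sinh a / sqrt ((sinh a)\<^sup>2 + 1)) \<longlongrightarrow> 1) at_top"
    using tanh_real_at_top by simp
  then have "((\<lambda>a::real. sinh a / sqrt ((sinh a)\<^sup>2 + 1) * (pi / 2) / m) \<longlongrightarrow> 1 * (pi / 2) / m) at_top"
    using m by (intro tendsto_intros) auto
  then show "((\<lambda>a. sinh a / sqrt ((sinh a)\<^sup>2 + 1) * (pi / 2) / m) \<longlongrightarrow> pi / 2 / m) at_top"
    by simp
qed simp

text \<open>The curves are compared at equal distance \<open>\<rho>\<close> from the axis: they meet at height \<open>t \<ge> 0\<close>
  exactly when \<open>t\<close> is the common value of the two inverse functions at some \<open>\<rho> \<ge> b\<close>.\<close>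

lemma catenary_crossing_less:
  assumes m: "0 < m" and a: "0 < a" and ab: "a < b"
  defines "Ta \<equiv> catenary_curve.T m a" and "Tb \<equiv> catenary_curve.T m b"
    and "fa \<equiv> catenary_curve.profile m a" and "fb \<equiv> catenary_curve.profile m b"
  shows "\<exists>t0>0. t0 < Ta \<and> t0 < Tb \<and> (\<forall>t. \<bar>t\<bar> < Ta \<and> \<bar>t\<bar> < Tb \<longrightarrow> (fa t = fb t \<longleftrightarrow> \<bar>t\<bar> = t0))"
proof -
  interpret A: catenary_curve m a using assms by unfold_locales auto
  interpret B: catenary_curve m b using assms by unfold_locales auto
  note defs = assms(4-7)
  define D where "D = (\<lambda>\<rho>. A.lam \<rho> - B.lam \<rho>)"
  have contD: "continuous_on {b..} D"
    unfolding D_def using ab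
    by (intro continuous_on_diff B.continuous_on_lam continuous_on_subset[OF A.continuous_on_lam]) auto
  have mono: "D y < D x" if "b \<le> x" "x < y" for x y
  proof (rule DERIV_neg_imp_decreasing_open[OF that(2)])
    show "continuous_on {x..y} D"
      by (rule continuous_on_subset[OF contD]) (use that in auto)
    fix u assume u: "x < u" "u < y"
    let ?P = "sinh a ^ m" and ?Q = "sinh b ^ m" and ?S = "sinh u ^ m"
    have pos: "0 < ?P" "?P < ?Q" "?Q < ?S"
      using u that ab a m by (auto intro!: power_strict_mono)
    have int: "sinh c ^ m * catenary_integrand (Suc m) c u
        = 1 / sqrt ((?S / sinh c ^ m)\<^sup>2 - 1)" if "0 < sinh c ^ m" "sinh c ^ m < ?S" for c
    proof -
      let ?C = "sinh c ^ m"
      have "catenary_integrand (Suc m) c u = (?S\<^sup>2 - ?C\<^sup>2) powr (- (1/2))"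
        by (simp add: catenary_integrand_def power_mult[symmetric] mult.commute)
      also have "\<dots> = 1 / sqrt (?S\<^sup>2 - ?C\<^sup>2)"
        using that by (simp add: powr_minus_divide powr_half_sqrt power_mono)
      finally have "?C * catenary_integrand (Suc m) c u = ?C / sqrt (?S\<^sup>2 - ?C\<^sup>2)" by simp
      moreover have "sqrt ((?S / ?C)\<^sup>2 - 1) = sqrt (?S\<^sup>2 - ?C\<^sup>2) / ?C"
      proof -
        have "?C\<^sup>2 \<noteq> 0" using that by (metis less_irrefl power_not_zero)
        then have "(?S / ?C)\<^sup>2 - 1 = (?S\<^sup>2 - ?C\<^sup>2) / ?C\<^sup>2"
          by (simp only: power_divide diff_divide_distrib divide_self not_False_eq_True)
        then show ?thesis using that by (simp only: real_sqrt_divide) simp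
      qed
      ultimately show ?thesis by simp
    qed
    have dD: "(D has_real_derivative
        1 / sqrt ((?S / ?P)\<^sup>2 - 1) - 1 / sqrt ((?S / ?Q)\<^sup>2 - 1)) (at u)"
      unfolding D_def using A.lam_has_derivative[of u] B.lam_has_derivative[of u] u that ab pos
      by (intro DERIV_diff) (simp_all add: int)
    have "1 < ?S / ?Q" "?S / ?Q < ?S / ?P"
      using pos by (auto intro!: divide_strict_left_mono)
    then have "1 < (?S / ?Q)\<^sup>2" "(?S / ?Q)\<^sup>2 < (?S / ?P)\<^sup>2"
      by (auto intro!: power_strict_mono simp: one_less_power)
    then have "1 / sqrt ((?S / ?P)\<^sup>2 - 1) < 1 / sqrt ((?S / ?Q)\<^sup>2 - 1)"
      by (intro divide_strict_left_mono real_sqrt_less_mono mult_pos_pos) auto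
    with dD show "\<exists>l. (D has_real_derivative l) (at u) \<and> l < 0"
      by (intro exI[of _ "1 / sqrt ((?S / ?P)\<^sup>2 - 1) - 1 / sqrt ((?S / ?Q)\<^sup>2 - 1)"]) simp
  qed
  have Db: "0 < D b"
  proof -
    have "A.lam b \<noteq> 0" using A.profile_lam[of b] A.profile_0 ab by auto
    then show ?thesis using A.lam_in[of b] ab by (simp add: D_def B.lam_a)
  qed
  have "(D \<longlongrightarrow> A.T - B.T) at_top"
    unfolding D_def by (intro tendsto_diff A.lam_tendsto B.lam_tendsto)
  then have "eventually (\<lambda>\<rho>. D \<rho> < 0) at_top"
    using T_strict_mono[OF m a ab] by (intro order_tendstoD) auto
  then have "eventually (\<lambda>\<rho>. D \<rho> < 0 \<and> b \<le> \<rho>) at_top"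
    using eventually_ge_at_top by (intro eventually_conj)
  then obtain R where R: "D R < 0" "b \<le> R"
    using eventually_happens trivial_limit_at_top_linorder by blast
  have "\<exists>x\<ge>b. x \<le> R \<and> D x = 0"
    using R Db contD by (intro IVT2') (auto intro: continuous_on_subset)
  then obtain r where r: "b \<le> r" "D r = 0" by blast
  have uniq: "x = r" if "b \<le> x" "D x = 0" for x
    using mono[of x r] mono[of r x] that r by (cases x r rule: linorder_cases) auto
  define t0 where "t0 = B.lam r"
  have t0A: "t0 = A.lam r" using r by (simp add: D_def t0_def)
  have t0: "0 \<le> t0" "t0 < A.T" "t0 < B.T"
    using A.lam_in[of r] B.lam_in[of r] r ab t0A t0_def by auto
  have "t0 \<noteq> 0"
    using A.profile_lam[of r] B.profile_lam[of r] r ab t0A t0_def A.profile_0 B.profile_0 by auto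
  have key: "A.profile t = B.profile t \<longleftrightarrow> t = t0" if t: "t \<in> {0..<A.T}" "t \<in> {0..<B.T}" for t
  proof
    assume eq: "A.profile t = B.profile t"
    have "b \<le> B.profile t" using B.profile_ge[of t] t B.T_pos by auto
    moreover have "D (B.profile t) = 0"
      using A.lam_profile[OF t(1)] B.lam_profile[OF t(2)] by (simp add: D_def eq)
    ultimately have "B.profile t = r" by (rule uniq)
    then show "t = t0" using B.lam_profile[OF t(2)] by (simp add: t0_def)
  next
    assume "t = t0"
    then show "A.profile t = B.profile t"
      using A.profile_lam[of r] B.profile_lam[of r] r ab by (simp add: t0A[symmetric] t0_def[symmetric])
  qed
  show ?thesis
  proof (intro exI[of _ t0] conjI allI impI)
    fix t assume t: "\<bar>t\<bar> < Ta \<and> \<bar>t\<bar> < Tb"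
    have "fa \<bar>t\<bar> = fa t" "fb \<bar>t\<bar> = fb t"
      using t A.profile_minus[of t] B.profile_minus[of t] by (auto simp: defs abs_if)
    then show "fa t = fb t \<longleftrightarrow> \<bar>t\<bar> = t0"
      using key[of "\<bar>t\<bar>"] t by (auto simp: defs)
  qed (use t0 \<open>t0 \<noteq> 0\<close> in \<open>auto simp: defs\<close>)
qed

lemma catenary_crossing:
  assumes m: "0 < m" and a: "0 < a" "0 < b" and ab: "a \<noteq> b"
  shows "\<exists>t0>0. t0 < catenary_curve.T m a \<and> t0 < catenary_curve.T m b \<and>
    (\<forall>t. \<bar>t\<bar> < catenary_curve.T m a \<and> \<bar>t\<bar> < catenary_curve.T m b \<longrightarrow>
      (catenary_curve.profile m a t = catenary_curve.profile m b t \<longleftrightarrow> \<bar>t\<bar> = t0))"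
proof (cases "a < b")
  case True
  then show ?thesis using catenary_crossing_less m a by blast
next
  case False
  then have "b < a" using ab by simp
  from catenary_crossing_less[OF m a(2) this] show ?thesis by (metis (no_types, lifting))
qed

section \<open>Calculus of smooth maps\<close>

text \<open>The derivative \<open>D\<close> agrees with \<open>frechet_derivative f\<close> only on \<open>S\<close>. The last assumption,
  invariance under changes outside \<open>S\<close>, is itself proved with this lemma, by induction on \<open>k\<close>.\<close>

lemma higher_differentiable_on_SucI:
  fixes f :: "'a::euclidean_space \<Rightarrow> 'b::euclidean_space"
  assumes D: "\<And>x. x \<in> S \<Longrightarrow> (f has_derivative D x) (at x)"
    and k: "\<And>v. higher_differentiable_on k S (\<lambda>x. D x v)"
    and cong: "\<And>g h :: 'a \<Rightarrow> 'b. (\<And>x. x \<in> S \<Longrightarrow> g x = h x) \<Longrightarrow> higher_differentiable_on k S g \<Longrightarrow>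
      higher_differentiable_on k S h"
  shows "higher_differentiable_on (Suc k) S f"
proof -
  have eq: "D x v = frechet_derivative f (at x) v" if "x \<in> S" for x v
    using frechet_derivative_at[OF D[OF that]] by simp
  have "higher_differentiable_on k S (\<lambda>x. frechet_derivative f (at x) v)" for v
    by (rule cong[OF _ k]) (rule eq)
  moreover have "\<forall>x\<in>S. f differentiable (at x)"
    using D differentiableI by blast
  ultimately show ?thesis by simp
qed

lemma higher_differentiable_on_cong:
  assumes S: "open S" and "\<And>x. x \<in> S \<Longrightarrow> f x = g x" and "higher_differentiable_on k S f"
  shows "higher_differentiable_on k S g"
  using assms(2,3)
proof (induction k arbitrary: f g)
  case 0
  then show ?case by (simp cong: continuous_on_cong)
next
  case (Suc k)
  have "(g has_derivative frechet_derivative f (at x)) (at x)" if x: "x \<in> S" for x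
  proof -
    have "(f has_derivative frechet_derivative f (at x)) (at x)"
      using Suc.prems(2) x frechet_derivative_works by auto
    then show ?thesis
      by (rule has_derivative_transform_within_open[OF _ S x Suc.prems(1)])
  qed
  then show ?case
    using Suc by (intro higher_differentiable_on_SucI) (auto intro: Suc.IH)
qed

lemma higher_differentiable_on_Suc:
  assumes "open S" and "\<And>x. x \<in> S \<Longrightarrow> (f has_derivative D x) (at x)"
    and "\<And>v. higher_differentiable_on k S (\<lambda>x. D x v)"
  shows "higher_differentiable_on (Suc k) S f"
  using assms higher_differentiable_on_cong by (intro higher_differentiable_on_SucI) blast+

lemma higher_differentiable_on_has_derivative:
  assumes "higher_differentiable_on (Suc k) S f" "x \<in> S"
  shows "(f has_derivative frechet_derivative f (at x)) (at x)"
  using assms frechet_derivative_works by auto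

lemma higher_differentiable_on_SucD:
  "higher_differentiable_on (Suc k) S f \<Longrightarrow> higher_differentiable_on k S f"
proof (induction k arbitrary: f)
  case 0
  then show ?case
    by (auto intro!: continuous_at_imp_continuous_on differentiable_imp_continuous_within)
next
  case (Suc k)
  then show ?case by (metis higher_differentiable_on.simps(2))
qed

lemma higher_differentiable_on_const: "open S \<Longrightarrow> higher_differentiable_on k S (\<lambda>_. c)"
proof (induction k arbitrary: c)
  case (Suc k)
  then show ?case
    by (intro higher_differentiable_on_Suc[where D = "\<lambda>_ _. 0"]) auto
qed (simp add: continuous_on_const)

lemma higher_differentiable_on_linear:
  assumes "open S" "bounded_linear h"
  shows "higher_differentiable_on k S h"
proof (cases k)
  case (Suc j)
  then show ?thesis
    using assms by (auto intro!: higher_differentiable_on_Suc[where D = "\<lambda>_. h"]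
        higher_differentiable_on_const bounded_linear_imp_has_derivative simp del: higher_differentiable_on.simps)
qed (use assms in \<open>simp add: linear_continuous_on\<close>)

lemma higher_differentiable_on_add:
  assumes "open S" "higher_differentiable_on k S f" "higher_differentiable_on k S g"
  shows "higher_differentiable_on k S (\<lambda>x. f x + g x)"
  using assms(2,3)
proof (induction k arbitrary: f g)
  case (Suc k)
  show ?case
  proof (rule higher_differentiable_on_Suc[OF assms(1)])
    show "((\<lambda>x. f x + g x) has_derivative
        (\<lambda>v. frechet_derivative f (at x) v + frechet_derivative g (at x) v)) (at x)" if "x \<in> S" for x
      using Suc.prems that by (intro has_derivative_add higher_differentiable_on_has_derivative)
    show "higher_differentiable_on k S
        (\<lambda>x. frechet_derivative f (at x) v + frechet_derivative g (at x) v)" for v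
      using Suc.prems by (intro Suc.IH) auto
  qed
qed (simp add: continuous_on_add)

lemma higher_differentiable_on_bilinear:
  assumes "open S" "bounded_bilinear pr"
    and "higher_differentiable_on k S f" "higher_differentiable_on k S g"
  shows "higher_differentiable_on k S (\<lambda>x. pr (f x) (g x))"
  using assms(3,4)
proof (induction k arbitrary: f g)
  case 0
  then show ?case
    using bounded_bilinear.continuous_on[OF assms(2)] by auto
next
  case (Suc k)
  show ?case
  proof (rule higher_differentiable_on_Suc[OF assms(1)])
    show "((\<lambda>x. pr (f x) (g x)) has_derivative (\<lambda>v. pr (f x) (frechet_derivative g (at x) v)
        + pr (frechet_derivative f (at x) v) (g x))) (at x)" if "x \<in> S" for x
      using Suc.prems that
      by (intro bounded_bilinear.FDERIV[OF assms(2)] higher_differentiable_on_has_derivative)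
    show "higher_differentiable_on k S (\<lambda>x. pr (f x) (frechet_derivative g (at x) v)
        + pr (frechet_derivative f (at x) v) (g x))" for v
      using Suc.prems higher_differentiable_on_SucD[OF Suc.prems(1)]
        higher_differentiable_on_SucD[OF Suc.prems(2)]
      by (intro higher_differentiable_on_add[OF assms(1)] Suc.IH) auto
  qed
qed

lemma higher_differentiable_on_compose_linear:
  assumes "open S" "bounded_linear h" "higher_differentiable_on k S f"
  shows "higher_differentiable_on k S (\<lambda>x. h (f x))"
  using assms(3)
proof (induction k arbitrary: f)
  case 0
  then show ?case by (simp add: bounded_linear.continuous_on[OF assms(2)])
next
  case (Suc k)
  show ?case
  proof (rule higher_differentiable_on_Suc[OF assms(1)])
    show "((\<lambda>x. h (f x)) has_derivative (\<lambda>v. h (frechet_derivative f (at x) v))) (at x)"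
      if "x \<in> S" for x
      using Suc.prems that
      by (intro bounded_linear.has_derivative[OF assms(2)] higher_differentiable_on_has_derivative)
    show "higher_differentiable_on k S (\<lambda>x. h (frechet_derivative f (at x) v))" for v
      using Suc.prems by (intro Suc.IH) auto
  qed
qed

text \<open>The only composition needed: with an affine map on the inside.\<close>

lemma higher_differentiable_on_affine:
  assumes "open S" "bounded_linear L" and sub: "\<And>x. x \<in> S \<Longrightarrow> c + L x \<in> U"
    and "higher_differentiable_on k U \<phi>"
  shows "higher_differentiable_on k S (\<lambda>x. \<phi> (c + L x))"
  using assms(4)
proof (induction k arbitrary: \<phi>)
  case 0
  then have "continuous_on U \<phi>" by simp
  then have "continuous_on S (\<lambda>x. \<phi> (c + L x))"
    by (rule continuous_on_compose2)
      (use sub continuous_on_add[OF continuous_on_const linear_continuous_on[OF assms(2)]] in auto)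
  then show ?case by simp
next
  case (Suc k)
  show ?case
  proof (rule higher_differentiable_on_Suc[OF assms(1)])
    show "((\<lambda>x. \<phi> (c + L x)) has_derivative (\<lambda>v. frechet_derivative \<phi> (at (c + L x)) (L v))) (at x)"
      if "x \<in> S" for x
    proof (rule has_derivative_compose[where f = "\<lambda>x. c + L x" and g = \<phi>])
      show "((\<lambda>x. c + L x) has_derivative L) (at x)"
        using has_derivative_add[OF has_derivative_const bounded_linear_imp_has_derivative[OF assms(2)]]
        by simp
      show "(\<phi> has_derivative frechet_derivative \<phi> (at (c + L x))) (at (c + L x))"
        using Suc.prems sub[OF that] by (rule higher_differentiable_on_has_derivative)
    qed
    show "higher_differentiable_on k S (\<lambda>x. frechet_derivative \<phi> (at (c + L x)) (L v))" for v
      using Suc.prems by (intro Suc.IH) auto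
  qed
qed

lemma higher_differentiable_on_real:
  fixes f :: "real \<Rightarrow> 'a::euclidean_space"
  assumes "open S" "\<And>t. t \<in> S \<Longrightarrow> (f has_vector_derivative f' t) (at t)"
    and "higher_differentiable_on k S f'"
  shows "higher_differentiable_on (Suc k) S f"
proof (rule higher_differentiable_on_Suc[OF assms(1)])
  show "(f has_derivative (\<lambda>v. v *\<^sub>R f' t)) (at t)" if "t \<in> S" for t
    using assms(2)[OF that] by (simp add: has_vector_derivative_def)
  show "higher_differentiable_on k S (\<lambda>t. v *\<^sub>R f' t)" for v
    by (rule higher_differentiable_on_compose_linear[OF assms(1) bounded_linear_scaleR_right assms(3)])
qed

lemma smooth_on_const: "open S \<Longrightarrow> smooth_on S (\<lambda>_. c)"
  by (simp add: smooth_on_def higher_differentiable_on_const del: higher_differentiable_on.simps)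

lemma smooth_on_linear: "open S \<Longrightarrow> bounded_linear h \<Longrightarrow> smooth_on S h"
  by (simp add: smooth_on_def higher_differentiable_on_linear del: higher_differentiable_on.simps)

lemma smooth_on_add: "open S \<Longrightarrow> smooth_on S f \<Longrightarrow> smooth_on S g \<Longrightarrow> smooth_on S (\<lambda>x. f x + g x)"
  by (simp add: smooth_on_def higher_differentiable_on_add del: higher_differentiable_on.simps)

lemma smooth_on_bilinear:
  "open S \<Longrightarrow> bounded_bilinear pr \<Longrightarrow> smooth_on S f \<Longrightarrow> smooth_on S g \<Longrightarrow>
    smooth_on S (\<lambda>x. pr (f x) (g x))"
  by (simp add: smooth_on_def higher_differentiable_on_bilinear del: higher_differentiable_on.simps)

lemmas smooth_on_mult = smooth_on_bilinear[OF _ bounded_bilinear_mult]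
lemmas smooth_on_scaleR = smooth_on_bilinear[OF _ bounded_bilinear_scaleR]
lemmas smooth_on_inner = smooth_on_bilinear[OF _ bounded_bilinear_inner]

lemma smooth_on_compose_linear:
  "open S \<Longrightarrow> bounded_linear h \<Longrightarrow> smooth_on S f \<Longrightarrow> smooth_on S (\<lambda>x. h (f x))"
  by (simp add: smooth_on_def higher_differentiable_on_compose_linear del: higher_differentiable_on.simps)

lemma smooth_on_uminus: "open S \<Longrightarrow> smooth_on S f \<Longrightarrow> smooth_on S (\<lambda>x. - f x)"
  by (rule smooth_on_compose_linear[OF _ bounded_linear_minus[OF bounded_linear_ident]])

lemma smooth_on_diff: "open S \<Longrightarrow> smooth_on S f \<Longrightarrow> smooth_on S g \<Longrightarrow> smooth_on S (\<lambda>x. f x - g x)"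
  using smooth_on_add[OF _ _ smooth_on_uminus] by (metis (no_types, lifting) ext diff_conv_add_uminus)

lemma smooth_on_Pair:
  fixes f :: "'a::euclidean_space \<Rightarrow> 'b::euclidean_space" and g :: "'a \<Rightarrow> 'c::euclidean_space"
  assumes S: "open S" and f: "smooth_on S f" and g: "smooth_on S g"
  shows "smooth_on S (\<lambda>x. (f x, g x))"
proof -
  have "bounded_linear (\<lambda>u::'b. (u, 0::'c))" "bounded_linear (\<lambda>u::'c. (0::'b, u))"
    by (auto intro!: bounded_linear_Pair bounded_linear_ident bounded_linear_zero)
  then have "smooth_on S (\<lambda>x. (f x, 0) + (0, g x))"
    by (intro smooth_on_add S smooth_on_compose_linear[OF S _ f] smooth_on_compose_linear[OF S _ g])
  then show ?thesis by simp
qed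

lemma smooth_on_affine:
  "open S \<Longrightarrow> bounded_linear L \<Longrightarrow> (\<And>x. x \<in> S \<Longrightarrow> c + L x \<in> U) \<Longrightarrow> smooth_on U \<phi> \<Longrightarrow>
    smooth_on S (\<lambda>x. \<phi> (c + L x))"
  unfolding smooth_on_def using higher_differentiable_on_affine by blast

lemma smooth_on_cos_sin:
  fixes S :: "real set"
  assumes S: "open S"
  shows "smooth_on S cos" "smooth_on S sin"
proof -
  have "higher_differentiable_on k S cos \<and> higher_differentiable_on k S sin" for k
  proof (induction k)
    case (Suc k)
    have "higher_differentiable_on (Suc k) S cos"
    proof (rule higher_differentiable_on_real[OF S])
      show "(cos has_vector_derivative - sin t) (at t)" for t :: real
        using DERIV_cos[of t] by (simp add: has_real_derivative_iff_has_vector_derivative)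
      show "higher_differentiable_on k S (\<lambda>t. - sin t)"
        using Suc by (intro higher_differentiable_on_compose_linear[OF S bounded_linear_minus[OF bounded_linear_ident]]) auto
    qed
    moreover have "higher_differentiable_on (Suc k) S sin"
    proof (rule higher_differentiable_on_real[OF S])
      show "(sin has_vector_derivative cos t) (at t)" for t :: real
        using DERIV_sin[of t] by (simp add: has_real_derivative_iff_has_vector_derivative)
    qed (use Suc in blast)
    ultimately show ?case by blast
  qed (auto intro: continuous_intros)
  then show "smooth_on S cos" "smooth_on S sin" by (auto simp: smooth_on_def)
qed

section \<open>Minimality of the rotation hypersurface\<close>

text \<open>What the geometry needs from a solution \<open>f\<close> on \<open>]-T, T[\<close> with derivative \<open>p\<close>: the
  differential equation, its first integral, and \<open>f \<rightarrow> \<infinity>\<close> at both ends. The ball has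
  dimension \<open>m + 1\<close>.\<close>

locale rotation_profile =
  fixes m :: nat and a T :: real and f p :: "real \<Rightarrow> real"
  assumes m_pos: "0 < m" and a_pos: "0 < a" and T_pos: "0 < T"
    and f_pos: "\<And>t. t \<in> {-T<..<T} \<Longrightarrow> 0 < f t"
    and f_has_derivative: "\<And>t. t \<in> {-T<..<T} \<Longrightarrow> (f has_real_derivative p t) (at t)"
    and p_has_derivative: "\<And>t. t \<in> {-T<..<T} \<Longrightarrow>
      (p has_real_derivative real m * coth (f t) * (1 + (p t)\<^sup>2)) (at t)"
    and first_integral: "\<And>t. t \<in> {-T<..<T} \<Longrightarrow>
      1 + (p t)\<^sup>2 = (sinh (f t) / sinh a) ^ (2 * m)"
    and f_proper: "\<And>C. \<exists>c<T. \<forall>t\<in>{-T<..<T}. f t \<le> C \<longrightarrow> \<bar>t\<bar> \<le> c"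
begin

text \<open>Functions of the height \<open>t\<close> along the generating curve: \<open>rad\<close> is the Euclidean distance to
  the axis in the ball model, \<open>flux\<close> equals \<open>1 / sqrt (1 + p\<^sup>2)\<close> by the first integral, and \<open>nu_x\<close> and
  \<open>nu_t\<close> are the coefficients of the unit normal.\<close>

definition coth_f :: "real \<Rightarrow> real" where "coth_f t = coth (f t)"
definition csch :: "real \<Rightarrow> real" where "csch t = 1 / sinh (f t)"
definition rad :: "real \<Rightarrow> real" where "rad t = tanh (f t / 2)"
definition flux :: "real \<Rightarrow> real" where "flux t = (sinh a / sinh (f t)) ^ m"
definition nu_x :: "real \<Rightarrow> real" where "nu_x t = flux t * csch t"
definition nu_t :: "real \<Rightarrow> real" where "nu_t t = - (p t * flux t)"

text \<open>The rotation hypersurface and its unit normal, extended to all points over \<open>]-T, T[\<close>.\<close>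

definition M :: "((real ^ 'n) \<times> real) set" where
  "M = rotation_hypersurface (catenary {-T<..<T} f)"

definition nu :: "(real ^ 'n) \<times> real \<Rightarrow> (real ^ 'n) \<times> real" where
  "nu q = (nu_x (snd q) *\<^sub>R fst q, nu_t (snd q))"

context
  fixes t assumes t: "t \<in> {-T<..<T}"
begin

lemma sinh_f_pos: "0 < sinh (f t)"
  using f_pos[OF t] by simp

lemma csch_pos: "0 < csch t"
  using sinh_f_pos by (simp add: csch_def)

lemma rad_bounds: "0 < rad t" "rad t < 1"
  using f_pos[OF t] by (auto simp: rad_def tanh_real_lt_1)

lemma flux_pos: "0 < flux t"
  using sinh_f_pos a_pos by (simp add: flux_def)

lemma flux_first_integral: "(flux t)\<^sup>2 * (1 + (p t)\<^sup>2) = 1"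
  using sinh_f_pos a_pos
  by (simp add: flux_def first_integral[OF t] power_mult[symmetric] mult.commute power_divide)

lemma conformal_factor_rad: "2 / (1 - (rad t)\<^sup>2) * rad t = sinh (f t)"
  and one_plus_rad: "1 + 2 / (1 - (rad t)\<^sup>2) * (rad t)\<^sup>2 = cosh (f t)"
proof -
  let ?c = "cosh (f t / 2)" and ?s = "sinh (f t / 2)"
  have c: "?c \<noteq> 0" by simp
  have "1 - (rad t)\<^sup>2 = (?c\<^sup>2 - ?s\<^sup>2) / ?c\<^sup>2"
    using c by (simp add: rad_def tanh_def power_divide diff_divide_distrib)
  then have "1 - (rad t)\<^sup>2 = 1 / ?c\<^sup>2"
    by (simp add: hyperbolic_pythagoras)
  then have l: "2 / (1 - (rad t)\<^sup>2) = 2 * ?c\<^sup>2" by simp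
  have d: "sinh (f t) = 2 * ?s * ?c" "cosh (f t) = ?c\<^sup>2 + ?s\<^sup>2"
    using sinh_double[of "f t / 2"] cosh_double[of "f t / 2"] by auto
  show "2 / (1 - (rad t)\<^sup>2) * rad t = sinh (f t)"
    unfolding l d using c by (simp add: rad_def tanh_def power2_eq_square)
  show "1 + 2 / (1 - (rad t)\<^sup>2) * (rad t)\<^sup>2 = cosh (f t)"
    unfolding l d using c hyperbolic_pythagoras[of "f t / 2"]
    by (simp add: rad_def tanh_def power_divide)
qed

lemma conformal_rad_csch: "2 / (1 - (rad t)\<^sup>2) * rad t * csch t = 1"
  using conformal_factor_rad sinh_f_pos by (simp add: csch_def)

lemma one_plus_rad_csch: "(1 + 2 / (1 - (rad t)\<^sup>2) * (rad t)\<^sup>2) * csch t = coth_f t"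
  using one_plus_rad by (simp add: csch_def coth_f_def coth_def)

lemma coth_f_has_derivative: "(coth_f has_real_derivative (1 - (coth_f t)\<^sup>2) * p t) (at t)"
proof -
  have "((\<lambda>t. cosh (f t) / sinh (f t)) has_real_derivative
      (sinh (f t) * p t * sinh (f t) - cosh (f t) * (cosh (f t) * p t)) / (sinh (f t) * sinh (f t))) (at t)"
    using f_has_derivative[OF t] sinh_f_pos by (intro DERIV_divide) (auto intro!: derivative_eq_intros)
  moreover have "(sinh (f t) * p t * sinh (f t) - cosh (f t) * (cosh (f t) * p t)) / (sinh (f t) * sinh (f t))
      = (1 - (coth_f t)\<^sup>2) * p t"
    using sinh_f_pos by (simp add: coth_f_def coth_def field_simps power2_eq_square)
  ultimately show ?thesis by (simp add: coth_f_def [abs_def] coth_def)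
qed

lemma csch_has_derivative: "(csch has_real_derivative - (csch t * coth_f t * p t)) (at t)"
proof -
  have "((\<lambda>t. 1 / sinh (f t)) has_real_derivative
      (0 * sinh (f t) - 1 * (cosh (f t) * p t)) / (sinh (f t) * sinh (f t))) (at t)"
    using f_has_derivative[OF t] sinh_f_pos by (intro DERIV_divide) (auto intro!: derivative_eq_intros)
  then show ?thesis by (simp add: csch_def [abs_def] coth_f_def coth_def mult.commute)
qed

lemma rad_has_derivative: "(rad has_real_derivative (1 - (rad t)\<^sup>2) / 2 * p t) (at t)"
  unfolding rad_def [abs_def] using f_has_derivative[OF t]
  by (auto intro!: derivative_eq_intros)

lemma flux_has_derivative: "(flux has_real_derivative - (m * coth_f t * p t * flux t)) (at t)"
proof -
  have eq: "flux = (\<lambda>t. (sinh a * csch t) ^ m)" by (simp add: flux_def [abs_def] csch_def)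
  have "((\<lambda>t. (sinh a * csch t) ^ m) has_real_derivative
      real m * (sinh a * csch t) ^ (m - 1) * (sinh a * (- (csch t * coth_f t * p t)))) (at t)"
    using csch_has_derivative by (auto intro!: derivative_eq_intros)
  moreover have "(sinh a * csch t) ^ m = (sinh a * csch t) ^ (m - 1) * (sinh a * csch t)"
    by (rule power_minus_mult[OF m_pos, symmetric])
  ultimately show ?thesis by (simp add: eq algebra_simps)
qed

lemma nu_x_has_derivative:
  "(nu_x has_real_derivative - (Suc m * coth_f t * p t * flux t * csch t)) (at t)"
  unfolding nu_x_def [abs_def] using flux_has_derivative csch_has_derivative
  by (auto intro!: derivative_eq_intros simp: algebra_simps)

lemma nu_t_has_derivative: "(nu_t has_real_derivative - (m * coth_f t * flux t)) (at t)"
  unfolding nu_t_def [abs_def] using flux_has_derivative p_has_derivative[OF t]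
  by (auto intro!: derivative_eq_intros simp: coth_f_def algebra_simps power2_eq_square)

end

text \<open>The derivatives of \<open>p\<close>, \<open>coth_f\<close>, \<open>csch\<close>, \<open>rad\<close> and \<open>flux\<close> are polynomials in these five
  functions. So if all five are \<open>C\<^sup>k\<close>, then all five are \<open>C\<^sup>k\<^sup>+\<^sup>1\<close>.\<close>

lemma smooth_profile:
  shows smooth_rad: "smooth_on {-T<..<T} rad"
    and smooth_nu_x: "smooth_on {-T<..<T} nu_x"
    and smooth_nu_t: "smooth_on {-T<..<T} nu_t"
proof -
  let ?I = "{-T<..<T}"
  have I: "open ?I" by simp
  note simps = higher_differentiable_on.simps
  note mult = higher_differentiable_on_bilinear[OF I bounded_bilinear_mult]
  note add = higher_differentiable_on_add[OF I]
  note const = higher_differentiable_on_const[OF I]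
  have conv: "higher_differentiable_on (Suc k) ?I g"
    if "\<And>t. t \<in> ?I \<Longrightarrow> (g has_real_derivative g' t) (at t)" "higher_differentiable_on k ?I g'" for g g' k
    using that by (intro higher_differentiable_on_real[OF I, of _ g'])
      (auto simp: has_real_derivative_iff_has_vector_derivative)
  have "higher_differentiable_on k ?I p \<and> higher_differentiable_on k ?I coth_f \<and>
      higher_differentiable_on k ?I csch \<and> higher_differentiable_on k ?I rad \<and>
      higher_differentiable_on k ?I flux" for k
  proof (induction k)
    case 0
    have contI: "continuous_on ?I g" if "\<And>t. t \<in> ?I \<Longrightarrow> (g has_real_derivative g' t) (at t)" for g g'
      using that DERIV_isCont continuous_at_imp_continuous_on by blast
    then show ?case
      using contI[OF p_has_derivative] contI[OF coth_f_has_derivative] contI[OF csch_has_derivative]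
        contI[OF rad_has_derivative] contI[OF flux_has_derivative]
      by simp
  next
    case (Suc k)
    then have p: "higher_differentiable_on k ?I p" and coth_f: "higher_differentiable_on k ?I coth_f"
      and csch: "higher_differentiable_on k ?I csch" and rad: "higher_differentiable_on k ?I rad"
      and flux: "higher_differentiable_on k ?I flux" by auto
    have sq: "higher_differentiable_on k ?I (\<lambda>t. c + d * (g t * g t))"
      if "higher_differentiable_on k ?I g" for c d and g :: "real \<Rightarrow> real"
      by (intro add const mult that)
    have "higher_differentiable_on (Suc k) ?I p"
      apply (rule conv[of _ "\<lambda>t. m * coth_f t * (1 + 1 * (p t * p t))"])
      subgoal using p_has_derivative by (simp add: coth_f_def power2_eq_square)
      by (intro mult sq const p coth_f)
    moreover have "higher_differentiable_on (Suc k) ?I coth_f"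
      apply (rule conv[of _ "\<lambda>t. (1 + (-1) * (coth_f t * coth_f t)) * p t"])
      subgoal using coth_f_has_derivative by (simp add: power2_eq_square)
      by (intro mult sq const p coth_f)
    moreover have "higher_differentiable_on (Suc k) ?I csch"
      apply (rule conv[of _ "\<lambda>t. (-1) * (csch t * coth_f t * p t)"])
      subgoal using csch_has_derivative by simp
      by (intro mult const p coth_f csch)
    moreover have "higher_differentiable_on (Suc k) ?I rad"
      apply (rule conv[of _ "\<lambda>t. (1 / 2 + (- 1 / 2) * (rad t * rad t)) * p t"])
      subgoal for t using rad_has_derivative[of t] by (simp add: power2_eq_square diff_divide_distrib)
      by (intro mult sq const p rad)
    moreover have "higher_differentiable_on (Suc k) ?I flux"
      apply (rule conv[of _ "\<lambda>t. (- m) * (coth_f t * p t * flux t)"])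
      subgoal using flux_has_derivative by (simp add: mult.assoc)
      by (intro mult const p coth_f flux)
    ultimately show ?case by blast
  qed
  then have s: "smooth_on ?I p" "smooth_on ?I csch" "smooth_on ?I flux" and r: "smooth_on ?I rad"
    unfolding smooth_on_def by blast+
  show "smooth_on ?I rad" by (rule r)
  show "smooth_on ?I nu_x"
    unfolding nu_x_def [abs_def] by (rule smooth_on_mult[OF I s(3,2)])
  show "smooth_on ?I nu_t"
    unfolding nu_t_def [abs_def] by (rule smooth_on_uminus[OF I smooth_on_mult[OF I s(1,3)]])
qed

lemma M_iff: "(x, t) \<in> (M :: ((real ^ 'n) \<times> real) set) \<longleftrightarrow> t \<in> {-T<..<T} \<and> norm x = rad t"
proof
  assume "(x, t) \<in> M"
  then obtain \<xi> where t: "t \<in> {-T<..<T}" and "x = rad t *\<^sub>R \<xi>" "norm \<xi> = 1"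
    unfolding M_def rotation_hypersurface_def catenary_def rad_def
    by (auto simp: image_iff)
  then show "t \<in> {-T<..<T} \<and> norm x = rad t"
    using rad_bounds[OF t] by simp
next
  assume *: "t \<in> {-T<..<T} \<and> norm x = rad t"
  then have "x = rad t *\<^sub>R ((1 / rad t) *\<^sub>R x)" "norm ((1 / rad t) *\<^sub>R x) = 1"
    using rad_bounds[of t] by auto
  then show "(x, t) \<in> M"
    using * unfolding M_def rotation_hypersurface_def catenary_def mem_Collect_eq
    by (intro exI[of _ "rad t"] exI[of _ t] exI[of _ "(1 / rad t) *\<^sub>R x"])
      (auto simp: rad_def)
qed

lemma M_subset: "M \<subseteq> HxR"
  using rad_bounds(2) by (auto simp: HxR_def M_iff)

lemma open_slab: "open ((UNIV :: (real ^ 'n) set) \<times> {-T<..<T})"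
  by (intro open_Times) auto

lemma smooth_on_snd:
  fixes \<phi> :: "real \<Rightarrow> 'b::euclidean_space"
  assumes "smooth_on {-T<..<T} \<phi>"
  shows "smooth_on ((UNIV :: (real ^ 'n) set) \<times> {-T<..<T}) (\<lambda>q. \<phi> (snd q))"
  using smooth_on_affine[OF open_slab bounded_linear_snd, of 0 "{-T<..<T}" \<phi>] assms by auto

lemma hypersurface_M: "hypersurface HxR (M :: ((real ^ 'n) \<times> real) set)"
  unfolding hypersurface_def
proof (intro conjI ballI M_subset)
  fix pt :: "(real ^ 'n) \<times> real" assume pt: "pt \<in> M"
  let ?W = "(UNIV :: (real ^ 'n) set) \<times> {-T<..<T}"
  let ?F = "\<lambda>q :: (real ^ 'n) \<times> real. fst q \<bullet> fst q - rad (snd q) * rad (snd q)"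
  have dF: "(?F has_derivative (\<lambda>v. 2 * (x \<bullet> fst v)
      - 2 * rad t * ((1 - (rad t)\<^sup>2) / 2 * p t) * snd v)) (at (x, t))" if t: "t \<in> {-T<..<T}" for x t
  proof -
    define c where "c = (1 - (rad t)\<^sup>2) / 2 * p t"
    have "(rad has_derivative (\<lambda>h. c * h)) (at (snd (x, t)))"
      using rad_has_derivative[OF t] by (simp only: has_field_derivative_def snd_conv c_def)
    then have "((\<lambda>q. rad (snd q)) has_derivative (\<lambda>v. c * snd v)) (at (x, t))"
      by (rule has_derivative_compose[OF has_derivative_snd[OF has_derivative_ident]])
    then show ?thesis
      unfolding c_def[symmetric]
      by (auto intro!: derivative_eq_intros simp: inner_commute algebra_simps)
  qed
  show "\<exists>W F. open W \<and> pt \<in> W \<and> smooth_on W (F :: _ \<Rightarrow> real) \<and> M \<inter> W = {q \<in> W. F q = 0} \<and>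
      (\<forall>q\<in>M \<inter> W. frechet_derivative F (at q) \<noteq> (\<lambda>_. 0))"
  proof (intro exI[of _ ?W] exI[of _ ?F] conjI ballI)
    show "open ?W" by (rule open_slab)
    show "pt \<in> ?W" using pt by (cases pt) (auto simp: M_iff)
    show "smooth_on ?W ?F"
      by (intro smooth_on_diff open_slab smooth_on_inner smooth_on_mult smooth_on_snd smooth_rad
          smooth_on_linear bounded_linear_fst)
    show "M \<inter> ?W = {q \<in> ?W. ?F q = 0}"
    proof (rule set_eqI)
      fix q :: "(real ^ 'n) \<times> real"
      obtain x t where q: "q = (x, t)" by (cases q)
      have "norm x = rad t \<longleftrightarrow> x \<bullet> x = rad t * rad t" if "t \<in> {-T<..<T}"
        using rad_bounds(1)[OF that] by (metis abs_of_pos norm_eq_square power2_eq_square less_imp_le)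
      then show "q \<in> M \<inter> ?W \<longleftrightarrow> q \<in> {q \<in> ?W. ?F q = 0}"
        by (auto simp: q M_iff)
    qed
    fix q assume "q \<in> M \<inter> ?W"
    then obtain x t where q: "q = (x, t)" and t: "t \<in> {-T<..<T}" and x: "norm x = rad t"
      by (cases q) (auto simp: M_iff)
    have "x \<bullet> x \<noteq> 0" using x rad_bounds(1)[OF t] by auto
    then have "frechet_derivative ?F (at q) (x, 0) \<noteq> 0"
      unfolding q frechet_derivative_at[OF dF[OF t], symmetric] by simp
    then show "frechet_derivative ?F (at q) \<noteq> (\<lambda>_. 0)" by metis
  qed
qed

text \<open>The velocities of curves in \<open>M\<close> are the vectors annihilated by the differential of
  \<open>|x|\<^sup>2 - rad(t)\<^sup>2\<close>, where \<open>rad\<^sup>2 csch p\<close> is \<open>rad\<close> times its derivative. A curve with a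
  given such velocity turns along a great circle while the height moves at constant speed.\<close>

lemma tangent_space_M:
  fixes x :: "real ^ 'n"
  assumes "(x, t) \<in> M"
  shows "tangent_space M (x, t) = {v. x \<bullet> fst v = (rad t)\<^sup>2 * csch t * p t * snd v}"
proof -
  have t: "t \<in> {-T<..<T}" and x: "norm x = rad t" using assms by (auto simp: M_iff)
  have xx: "x \<bullet> x = (rad t)\<^sup>2" using x by (simp add: dot_square_norm)
  have r: "0 < rad t" by (rule rad_bounds[OF t])
  define r' where "r' = (1 - (rad t)\<^sup>2) / 2 * p t"
  have "rad t * ((1 - (rad t)\<^sup>2) / 2) * (2 / (1 - (rad t)\<^sup>2) * rad t * csch t) = rad t * rad t * csch t"
    using power_strict_mono[of "rad t" 1 2] rad_bounds[OF t] by simp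
  then have "rad t * ((1 - (rad t)\<^sup>2) / 2) = (rad t)\<^sup>2 * csch t"
    using conformal_rad_csch[OF t] by (simp add: power2_eq_square)
  then have rr': "rad t * r' = (rad t)\<^sup>2 * csch t * p t"
    by (simp add: r'_def mult.assoc[symmetric])
  show ?thesis unfolding rr'[symmetric]
  proof (intro subset_antisym subsetI CollectI)
    fix v :: "(real ^ 'n) \<times> real" assume "v \<in> tangent_space M (x, t)"
    then obtain \<epsilon> \<gamma> where e: "\<epsilon> > 0" "\<gamma> ` {-\<epsilon><..<\<epsilon>} \<subseteq> M" "\<gamma> 0 = (x, t)"
      and v: "(\<gamma> has_vector_derivative v) (at 0)"
      unfolding tangent_space_def by blast
    have g: "(\<gamma> has_derivative (\<lambda>h. h *\<^sub>R v)) (at 0)" using v by (simp add: has_vector_derivative_def)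
    have fs: "((\<lambda>s. fst (\<gamma> s)) has_derivative (\<lambda>h. h *\<^sub>R fst v)) (at 0)"
      "((\<lambda>s. snd (\<gamma> s)) has_derivative (\<lambda>h. h *\<^sub>R snd v)) (at 0)"
      using has_derivative_fst[OF g] has_derivative_snd[OF g] by auto
    have "((\<lambda>s. fst (\<gamma> s) \<bullet> fst (\<gamma> s)) has_derivative (\<lambda>h. x \<bullet> (h *\<^sub>R fst v) + (h *\<^sub>R fst v) \<bullet> x)) (at 0)"
      using has_derivative_inner[OF fs(1) fs(1)] e(3) by simp
    then have d1: "((\<lambda>s. fst (\<gamma> s) \<bullet> fst (\<gamma> s)) has_real_derivative 2 * (x \<bullet> fst v)) (at 0)"
      by (rule has_derivative_imp_has_field_derivative) (simp add: inner_commute)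
    have "((\<lambda>s. snd (\<gamma> s)) has_real_derivative snd v) (at 0)"
      using fs(2) by (rule has_derivative_imp_has_field_derivative) simp
    then have "((\<lambda>s. rad (snd (\<gamma> s))) has_real_derivative r' * snd v) (at 0)"
      by (rule DERIV_chain2[rotated]) (use rad_has_derivative[OF t] e(3) in \<open>simp add: r'_def\<close>)
    then have d2: "((\<lambda>s. (rad (snd (\<gamma> s)))\<^sup>2) has_real_derivative 2 * (rad t * r' * snd v)) (at 0)"
      using e(3) by (auto intro!: derivative_eq_intros)
    have "fst (\<gamma> s) \<bullet> fst (\<gamma> s) = (rad (snd (\<gamma> s)))\<^sup>2" if "s \<in> {-\<epsilon><..<\<epsilon>}" for s
    proof -
      have "(fst (\<gamma> s), snd (\<gamma> s)) \<in> M" using e(2) that by auto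
      then show ?thesis unfolding M_iff by (simp add: dot_square_norm)
    qed
    then have "((\<lambda>s. (rad (snd (\<gamma> s)))\<^sup>2) has_real_derivative 2 * (x \<bullet> fst v)) (at 0)"
      using e(1) by (intro has_field_derivative_transform_within_open[OF d1, of "{-\<epsilon><..<\<epsilon>}"]) auto
    then have "2 * (x \<bullet> fst v) = 2 * (rad t * r' * snd v)"
      using d2 DERIV_unique by blast
    then show "x \<bullet> fst v = rad t * r' * snd v" by simp
  next
    fix v :: "(real ^ 'n) \<times> real" assume "v \<in> {v. x \<bullet> fst v = rad t * r' * snd v}"
    then have xv: "x \<bullet> fst v = rad t * r' * snd v" by simp
    \<comment> \<open>the velocity on the unit sphere of the direction \<open>x / rad t\<close>\<close>
    define w where "w = (fst v - (r' * snd v / rad t) *\<^sub>R x) /\<^sub>R rad t"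
    have xw: "x \<bullet> w = 0"
      using r by (simp add: w_def inner_diff_right xv xx power2_eq_square)
    define \<epsilon> where "\<epsilon> = (T - \<bar>t\<bar>) / (\<bar>snd v\<bar> + 1)"
    have e: "0 < \<epsilon>"
      unfolding \<epsilon>_def by (rule divide_pos_pos) (use t in auto)
    have dom: "t + s * snd v \<in> {-T<..<T}" if "s \<in> {-\<epsilon><..<\<epsilon>}" for s
    proof -
      have "\<bar>s\<bar> < \<epsilon>" using that by auto
      moreover have "0 < \<bar>snd v\<bar> + 1" by simp
      ultimately have "\<bar>s\<bar> * (\<bar>snd v\<bar> + 1) < T - \<bar>t\<bar>"
        unfolding \<epsilon>_def by (simp only: pos_less_divide_eq)
      moreover have "\<bar>s * snd v\<bar> \<le> \<bar>s\<bar> * (\<bar>snd v\<bar> + 1)"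
        unfolding abs_mult by (rule mult_left_mono) auto
      ultimately have "\<bar>s * snd v\<bar> < T - \<bar>t\<bar>" by (rule le_less_trans[rotated])
      then show ?thesis by auto
    qed
    define k where "k = norm w"
    \<comment> \<open>for \<open>w = 0\<close> this is the constant \<open>x / rad t\<close>\<close>
    define \<eta> where "\<eta> s = cos (s * k) *\<^sub>R (x /\<^sub>R rad t) + sin (s * k) *\<^sub>R (w /\<^sub>R k)" for s
    define \<gamma> where "\<gamma> s = (rad (t + s * snd v) *\<^sub>R \<eta> s, t + s * snd v)" for s
    let ?J = "{-\<epsilon><..<\<epsilon>}"
    have J: "open ?J" by simp
    have lin: "bounded_linear (\<lambda>s::real. s * c)" for c by (rule bounded_linear_mult_left)
    have "smooth_on ?J (\<lambda>s. cos (0 + s * k))" "smooth_on ?J (\<lambda>s. sin (0 + s * k))"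
      by (rule smooth_on_affine[OF J lin _ smooth_on_cos_sin(1)[OF open_UNIV]]; simp)
         (rule smooth_on_affine[OF J lin _ smooth_on_cos_sin(2)[OF open_UNIV]]; simp)
    then have sm_eta: "smooth_on ?J \<eta>"
      unfolding \<eta>_def by (intro smooth_on_add J smooth_on_scaleR smooth_on_const) auto
    have sm_rad: "smooth_on ?J (\<lambda>s. rad (t + s * snd v))"
      by (rule smooth_on_affine[OF J lin dom smooth_rad])
    have "smooth_on ?J \<gamma>"
      unfolding \<gamma>_def
      by (intro smooth_on_Pair J smooth_on_scaleR sm_rad sm_eta smooth_on_add smooth_on_const
            smooth_on_linear lin)
    moreover have "\<gamma> ` ?J \<subseteq> M"
    proof (rule image_subsetI)
      fix s assume s: "s \<in> ?J"
      have "norm (\<eta> s) = 1"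
      proof (cases "k = 0")
        case True
        then show ?thesis using x r by (simp add: \<eta>_def)
      next
        case False
        have "(norm (\<eta> s))\<^sup>2 = (cos (s * k))\<^sup>2 * ((x \<bullet> x) / (rad t)\<^sup>2) + (sin (s * k))\<^sup>2 * ((w \<bullet> w) / k\<^sup>2)"
          unfolding power2_norm_eq_inner \<eta>_def
          using xw by (simp add: inner_add_left inner_add_right inner_commute[of w x]
              power2_eq_square divide_inverse mult_ac)
        also have "\<dots> = 1"
          using False r by (simp add: x dot_square_norm k_def)
        finally show ?thesis by (simp add: power2_eq_1_iff) (metis norm_ge_zero not_one_le_zero neg_0_le_iff_le)
      qed
      then show "\<gamma> s \<in> M"
        using dom[OF s] rad_bounds(1)[OF dom[OF s]] unfolding \<gamma>_def M_iff by simp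
    qed
    moreover have "\<gamma> 0 = (x, t)" using r by (simp add: \<gamma>_def \<eta>_def)
    moreover have "(\<gamma> has_vector_derivative v) (at 0)"
    proof -
      have "((\<lambda>s. cos (s * k)) has_real_derivative 0) (at 0)"
        "((\<lambda>s. sin (s * k)) has_real_derivative k) (at 0)"
        by (auto intro!: derivative_eq_intros)
      then have "(\<eta> has_vector_derivative 0 *\<^sub>R (x /\<^sub>R rad t) + k *\<^sub>R (w /\<^sub>R k)) (at 0)"
        unfolding \<eta>_def
        by (intro has_vector_derivative_add has_vector_derivative_scaleR[OF _ has_vector_derivative_const, simplified])
           (auto simp: has_real_derivative_iff_has_vector_derivative)
      moreover have "k *\<^sub>R (w /\<^sub>R k) = w" by (cases "w = 0") (simp_all add: k_def)
      ultimately have d_eta: "(\<eta> has_vector_derivative w) (at 0)" by simp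
      have d_lin: "((\<lambda>s. t + s * snd v) has_real_derivative snd v) (at 0)"
        by (auto intro!: derivative_eq_intros)
      have "((\<lambda>s. rad (t + s * snd v)) has_real_derivative r' * snd v) (at 0)"
        using rad_has_derivative[OF t] unfolding r'_def
        by (intro DERIV_chain2[of rad, OF _ d_lin]) simp
      from has_vector_derivative_scaleR[OF this d_eta]
      have "((\<lambda>s. rad (t + s * snd v) *\<^sub>R \<eta> s) has_vector_derivative
          rad t *\<^sub>R w + (r' * snd v) *\<^sub>R (x /\<^sub>R rad t)) (at 0)"
        by (simp add: \<eta>_def)
      moreover have "rad t *\<^sub>R w + (r' * snd v) *\<^sub>R (x /\<^sub>R rad t) = fst v"
        using r by (simp add: w_def divide_inverse)
      ultimately have "((\<lambda>s. rad (t + s * snd v) *\<^sub>R \<eta> s) has_vector_derivative fst v) (at 0)"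
        by simp
      from has_vector_derivative_Pair[OF this d_lin[unfolded has_real_derivative_iff_has_vector_derivative]]
      show ?thesis by (simp add: \<gamma>_def [abs_def])
    qed
    ultimately show "v \<in> tangent_space M (x, t)"
      unfolding tangent_space_def using e by blast
  qed
qed

end

lemma conformal_factor_has_derivative:
  fixes x :: "'a::real_inner"
  assumes "norm x < 1"
  shows "((\<lambda>y. (2 / (1 - (norm y)\<^sup>2))\<^sup>2) has_derivative
    (\<lambda>u. 2 * (2 / (1 - (norm x)\<^sup>2)) ^ 3 * (x \<bullet> u))) (at x)"
proof -
  have ne: "1 - x \<bullet> x \<noteq> 0"
    using power_strict_mono[of "norm x" 1 2] assms by (simp add: power2_norm_eq_inner)
  have "((\<lambda>y. (2 / (1 - y \<bullet> y))\<^sup>2) has_derivative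
      (\<lambda>u. 2 * (2 / (1 - x \<bullet> x)) * (2 * (2 * (x \<bullet> u)) / (1 - x \<bullet> x)\<^sup>2))) (at x)"
    using ne by (auto intro!: derivative_eq_intros simp: inner_commute power2_eq_square divide_simps)
  moreover have "2 * (2 / (1 - x \<bullet> x)) * (2 * (2 * (x \<bullet> u)) / (1 - x \<bullet> x)\<^sup>2)
      = 2 * (2 / (1 - x \<bullet> x)) ^ 3 * (x \<bullet> u)" for u
    by (simp add: power2_eq_square power3_eq_cube)
  ultimately show ?thesis by (simp add: power2_norm_eq_inner)
qed

lemma christoffel_HxR:
  fixes x :: "real ^ 'n"
  assumes "norm x < 1"
  defines "l \<equiv> 2 / (1 - (norm x)\<^sup>2)"
  shows "christoffel HxR_metric (x, t) u v w = l ^ 3 *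
    ((x \<bullet> fst u) * (fst v \<bullet> fst w) + (x \<bullet> fst v) * (fst u \<bullet> fst w) - (x \<bullet> fst w) * (fst u \<bullet> fst v))"
proof -
  have "((\<lambda>q. HxR_metric q v w) has_derivative
      (\<lambda>h. 2 * l ^ 3 * (x \<bullet> fst h) * (fst v \<bullet> fst w))) (at (x, t))" for v w :: "(real ^ 'n) \<times> real"
  proof -
    have "((\<lambda>y. (2 / (1 - (norm y)\<^sup>2))\<^sup>2) has_derivative (\<lambda>u. 2 * l ^ 3 * (x \<bullet> u))) (at (fst (x, t)))"
      using conformal_factor_has_derivative[OF assms(1)] by (simp add: l_def)
    from has_derivative_compose[OF has_derivative_fst[OF has_derivative_ident] this]
    have "((\<lambda>q :: (real ^ 'n) \<times> real. (2 / (1 - (norm (fst q))\<^sup>2))\<^sup>2) has_derivative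
        (\<lambda>h. 2 * l ^ 3 * (x \<bullet> fst h))) (at (x, t))" .
    from has_derivative_add[OF has_derivative_mult_left[OF this, of "fst v \<bullet> fst w"]
        has_derivative_const[of "snd v * snd w"]]
    show ?thesis by (simp add: HxR_metric_def)
  qed
  then have "frechet_derivative (\<lambda>q. HxR_metric q v w) (at (x, t)) =
      (\<lambda>h. 2 * l ^ 3 * (x \<bullet> fst h) * (fst v \<bullet> fst w))" for v w :: "(real ^ 'n) \<times> real"
    using frechet_derivative_at by metis
  then show ?thesis
    unfolding christoffel_def by (simp add: field_simps)
qed

context rotation_profile
begin

lemma conformal_factor_pos:
  assumes "t \<in> {-T<..<T}"
  shows "0 < 2 / (1 - (rad t)\<^sup>2)"
  using power_strict_mono[of "rad t" 1 2] rad_bounds[OF assms] by simp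

lemma nu_orthogonal_iff:
  fixes x :: "real ^ 'n"
  assumes "(x, t) \<in> M"
  shows "HxR_metric (x, t) (nu (x, t)) v = 0 \<longleftrightarrow> x \<bullet> fst v = (rad t)\<^sup>2 * csch t * p t * snd v"
proof -
  have t: "t \<in> {-T<..<T}" and x: "norm x = rad t" using assms by (auto simp: M_iff)
  let ?l = "2 / (1 - (rad t)\<^sup>2)"
  have "HxR_metric (x, t) (nu (x, t)) v = ?l\<^sup>2 * (flux t * csch t) * (x \<bullet> fst v) - p t * flux t * snd v"
    by (simp add: HxR_metric_def nu_def nu_x_def nu_t_def x)
  also have "\<dots> = ?l\<^sup>2 * (flux t * csch t) * (x \<bullet> fst v - (rad t)\<^sup>2 * csch t * p t * snd v)"
  proof -
    have "?l\<^sup>2 * csch t * ((rad t)\<^sup>2 * csch t) = (?l * rad t * csch t)\<^sup>2"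
      by (simp only: power2_eq_square mult_ac)
    then have "?l\<^sup>2 * csch t * ((rad t)\<^sup>2 * csch t) = 1"
      by (simp only: conformal_rad_csch[OF t]) simp
    then have "?l\<^sup>2 * csch t * ((rad t)\<^sup>2 * csch t) * (flux t * p t * snd v) = flux t * p t * snd v" by simp
    then show ?thesis by (simp add: algebra_simps)
  qed
  finally show ?thesis
    using flux_pos[OF t] csch_pos[OF t] conformal_factor_pos[OF t] by simp
qed

lemma tangent_space_M_eq_normal:
  assumes "q \<in> M"
  shows "tangent_space M q = {v. HxR_metric q (nu q) v = 0}"
  using assms by (cases q) (simp add: tangent_space_M nu_orthogonal_iff)

lemma nu_unit:
  assumes "q \<in> M"
  shows "HxR_metric q (nu q) (nu q) = 1"
proof -
  obtain x t where q: "q = (x, t)" by (cases q)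
  have t: "t \<in> {-T<..<T}" and x: "norm x = rad t" using assms by (auto simp: q M_iff)
  let ?l = "2 / (1 - (rad t)\<^sup>2)"
  have "HxR_metric q (nu q) (nu q) = ?l\<^sup>2 * ((flux t * csch t)\<^sup>2 * (rad t)\<^sup>2) + (p t * flux t)\<^sup>2"
    by (simp add: HxR_metric_def nu_def nu_x_def nu_t_def x q dot_square_norm power2_eq_square)
  also have "\<dots> = (?l * rad t * csch t)\<^sup>2 * (flux t)\<^sup>2 + (p t * flux t)\<^sup>2"
    by (simp only: power2_eq_square mult_ac)
  also have "\<dots> = (flux t)\<^sup>2 * (1 + (p t)\<^sup>2)"
    unfolding conformal_rad_csch[OF t] by (simp add: power_mult_distrib algebra_simps)
  finally show ?thesis using flux_first_integral[OF t] by simp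
qed

lemma unit_normal_field_nu: "unit_normal_field HxR_metric M (UNIV \<times> {-T<..<T}) nu"
  unfolding unit_normal_field_def
proof (intro conjI ballI)
  show "smooth_on (UNIV \<times> {-T<..<T}) nu"
    unfolding nu_def [abs_def]
    by (intro smooth_on_Pair open_slab smooth_on_scaleR smooth_on_snd smooth_nu_x smooth_nu_t
        smooth_on_linear bounded_linear_fst)
qed (auto simp: nu_unit tangent_space_M_eq_normal)

lemma nu_has_derivative:
  fixes x :: "real ^ 'n"
  assumes t: "t \<in> {-T<..<T}"
  shows "(nu has_derivative (\<lambda>v. (nu_x t *\<^sub>R fst v + (- (Suc m * coth_f t * p t * flux t * csch t) * snd v) *\<^sub>R x,
    - (m * coth_f t * flux t) * snd v))) (at (x, t))"
proof -
  define A where "A = - (Suc m * coth_f t * p t * flux t * csch t)"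
  define B where "B = - (m * coth_f t * flux t)"
  have snd: "(snd has_derivative snd) (at (x, t))" and fst: "(fst has_derivative fst) (at (x, t))"
    by (auto intro!: bounded_linear_imp_has_derivative bounded_linear_snd bounded_linear_fst)
  have "(nu_x has_derivative (\<lambda>h. A * h)) (at (snd (x, t)))"
    using nu_x_has_derivative[OF t] by (simp only: has_field_derivative_def snd_conv A_def)
  from has_derivative_compose[OF snd this]
  have x: "((\<lambda>q. nu_x (snd q)) has_derivative (\<lambda>v. A * snd v)) (at (x, t))" .
  have "(nu_t has_derivative (\<lambda>h. B * h)) (at (snd (x, t)))"
    using nu_t_has_derivative[OF t] by (simp only: has_field_derivative_def snd_conv B_def)
  from has_derivative_compose[OF snd this]
  have y: "((\<lambda>q. nu_t (snd q)) has_derivative (\<lambda>v. B * snd v)) (at (x, t))" .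
  show ?thesis
    using has_derivative_Pair[OF has_derivative_scaleR[OF x fst] y]
    unfolding nu_def [abs_def] A_def[symmetric] B_def[symmetric] by simp
qed

text \<open>Only the height component \<open>snd v\<close> of a unit tangent vector enters: unit length determines the
  length of \<open>fst v\<close>, and tangency determines \<open>x \<bullet> fst v\<close>.\<close>

lemma second_fundamental_form_unit:
  fixes x :: "real ^ 'n"
  assumes M: "(x, t) \<in> M" and v: "v \<in> tangent_space M (x, t)" and unit: "HxR_metric (x, t) v v = 1"
  shows "second_fundamental_form HxR_metric nu (x, t) v v =
    - (coth_f t * flux t) * (1 - (real m + 1) * (1 + (p t)\<^sup>2) * (snd v)\<^sup>2)"
proof -
  have t: "t \<in> {-T<..<T}" and x: "norm x = rad t" using M by (auto simp: M_iff)
  have xx: "x \<bullet> x = (rad t)\<^sup>2" using x by (simp add: dot_square_norm)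
  define l where "l = 2 / (1 - (rad t)\<^sup>2)"
  have l1: "l * rad t * csch t = 1" "(1 + l * (rad t)\<^sup>2) * csch t = coth_f t"
    using conformal_rad_csch[OF t] one_plus_rad_csch[OF t] by (auto simp: l_def)
  let ?\<tau> = "snd v" and ?w = "fst v \<bullet> fst v"
  have xv: "x \<bullet> fst v = (rad t)\<^sup>2 * csch t * p t * ?\<tau>"
    using v by (simp add: tangent_space_M[OF M])
  have w: "l\<^sup>2 * ?w = 1 - ?\<tau>\<^sup>2"
    using unit by (simp add: HxR_metric_def x l_def power2_eq_square)
  have nx: "norm x < 1" using x rad_bounds[OF t] by simp
  have g: "HxR_metric (x, t) u y = l\<^sup>2 * (fst u \<bullet> fst y) + snd u * snd y" for u y
    by (simp add: HxR_metric_def x l_def)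
  have chr: "christoffel HxR_metric (x, t) v (nu (x, t)) v = l ^ 3 * (nu_x t * (rad t)\<^sup>2 * ?w)"
    by (simp add: christoffel_HxR[OF nx] x l_def[symmetric] nu_def xx algebra_simps inner_commute)
  have "second_fundamental_form HxR_metric nu (x, t) v v =
     - (l\<^sup>2 * (nu_x t * ?w - (Suc m * coth_f t * p t * flux t * csch t) * ?\<tau> * (x \<bullet> fst v))
        - m * coth_f t * flux t * ?\<tau>\<^sup>2 + l ^ 3 * (nu_x t * (rad t)\<^sup>2 * ?w))"
    unfolding second_fundamental_form_def chr g
    by (simp add: frechet_derivative_at[OF nu_has_derivative[OF t], symmetric] inner_add_left
        power2_eq_square algebra_simps)
  also have "\<dots> = - (flux t * ((1 + l * (rad t)\<^sup>2) * csch t) * (l\<^sup>2 * ?w)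
     - Suc m * coth_f t * (p t)\<^sup>2 * flux t * ?\<tau>\<^sup>2 * (l * rad t * csch t)\<^sup>2
     - m * coth_f t * flux t * ?\<tau>\<^sup>2)"
    unfolding xv nu_x_def by (simp add: power2_eq_square power3_eq_cube algebra_simps)
  also have "\<dots> = - (coth_f t * flux t) * (1 - (real m + 1) * (1 + (p t)\<^sup>2) * (snd v)\<^sup>2)"
    unfolding l1 w by (simp add: algebra_simps)
  finally show ?thesis .
qed

text \<open>Scaling the ball factor by the conformal factor turns the metric at a point into the
  Euclidean inner product.\<close>

lemma HxR_metric_scaled:
  fixes x :: "real ^ 'n"
  assumes "norm x = rad t"
  shows "HxR_metric (x, t) u v = ((2 / (1 - (rad t)\<^sup>2)) *\<^sub>R fst u, snd u) \<bullet> ((2 / (1 - (rad t)\<^sup>2)) *\<^sub>R fst v, snd v)"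
  using assms by (simp add: HxR_metric_def power2_eq_square)

lemma orthonormal_tangent_basis_exists:
  fixes q :: "(real ^ 'n) \<times> real"
  assumes q: "q \<in> M"
  shows "\<exists>B. orthonormal_tangent_basis HxR_metric M q B"
proof -
  obtain x t where qq: "q = (x, t)" by (cases q)
  have t: "t \<in> {-T<..<T}" and x: "norm x = rad t" using q by (auto simp: qq M_iff)
  define l where "l = 2 / (1 - (rad t)\<^sup>2)"
  have l: "0 < l" using conformal_factor_pos[OF t] by (simp add: l_def)
  define L where "L = (\<lambda>v :: (real ^ 'n) \<times> real. (l *\<^sub>R fst v, snd v))"
  define R where "R = (\<lambda>v :: (real ^ 'n) \<times> real. (fst v /\<^sub>R l, snd v))"
  have R: "linear R" and LR: "L (R v) = v" and RL: "R (L v) = v" for v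
    using l by (auto simp: R_def L_def intro!: linearI simp: scaleR_add_right)
  have g: "HxR_metric q u v = L u \<bullet> L v" for u v
    using HxR_metric_scaled[OF x] by (simp add: qq L_def l_def)
  define H where "H = {w. L (nu q) \<bullet> w = 0}"
  have "subspace H" unfolding H_def by (rule subspace_hyperplane)
  then obtain B where B: "B \<subseteq> H" "pairwise orthogonal B" "\<And>x. x \<in> B \<Longrightarrow> norm x = 1"
    "independent B" "span B = H"
    using orthonormal_basis_subspace by metis
  have "orthonormal_tangent_basis HxR_metric M q (R ` B)"
    unfolding orthonormal_tangent_basis_def
  proof (intro conjI ballI)
    show "finite (R ` B)" using B(4) independent_imp_finite by blast
    have "span (R ` B) = R ` H"
      by (simp add: linear_span_image[OF R] B(5))
    also have "\<dots> = {v. HxR_metric q (nu q) v = 0}"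
    proof (intro subset_antisym subsetI)
      show "v \<in> {v. HxR_metric q (nu q) v = 0}" if "v \<in> R ` H" for v
        using that LR by (auto simp: g H_def)
      show "v \<in> R ` H" if "v \<in> {v. HxR_metric q (nu q) v = 0}" for v
        using that by (intro image_eqI[of _ R "L v"]) (simp_all add: g H_def RL)
    qed
    finally show "span (R ` B) = tangent_space M q"
      by (simp add: tangent_space_M_eq_normal[OF q])
    fix u v assume "u \<in> R ` B" "v \<in> R ` B"
    then obtain u' v' where u': "u = R u'" "u' \<in> B" and v': "v = R v'" "v' \<in> B" by blast
    have "u = v \<longleftrightarrow> u' = v'" using LR u' v' by metis
    then show "HxR_metric q u v = (if u = v then 1 else 0)"
      using B(2,3) u' v' by (auto simp: g LR dot_square_norm pairwise_def orthogonal_def)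
  qed
  then show ?thesis by blast
qed

lemma card_orthonormal_tangent_basis:
  fixes q :: "(real ^ 'n) \<times> real"
  assumes q: "q \<in> M" and B: "orthonormal_tangent_basis HxR_metric M q B"
  shows "card B = CARD('n)"
proof -
  obtain x t where qq: "q = (x, t)" by (cases q)
  have x: "norm x = rad t" using q by (auto simp: qq M_iff)
  define l where "l = 2 / (1 - (rad t)\<^sup>2)"
  define L where "L = (\<lambda>v :: (real ^ 'n) \<times> real. (l *\<^sub>R fst v, snd v))"
  have g: "HxR_metric q u v = L u \<bullet> L v" for u v
    using HxR_metric_scaled[OF x] by (simp add: qq L_def l_def)
  have lin: "linear (\<lambda>v. HxR_metric q u v)" for u
    by (rule linearI) (auto simp: HxR_metric_def inner_add_right algebra_simps)
  have fin: "finite B" and sp: "span B = tangent_space M q"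
    and on: "\<And>u v. u \<in> B \<Longrightarrow> v \<in> B \<Longrightarrow> HxR_metric q u v = (if u = v then 1 else 0)"
    using B by (auto simp: orthonormal_tangent_basis_def)
  have "independent B"
  proof (rule independent_if_scalars_zero[OF fin])
    fix c b assume 0: "(\<Sum>v\<in>B. c v *\<^sub>R v) = 0" and b: "b \<in> B"
    have "0 = HxR_metric q b (\<Sum>v\<in>B. c v *\<^sub>R v)"
      by (simp add: 0 HxR_metric_def)
    also have "\<dots> = (\<Sum>v\<in>B. c v * HxR_metric q b v)"
      by (simp add: linear_sum[OF lin] linear_cmul[OF lin])
    also have "\<dots> = (\<Sum>v\<in>B. if v = b then c v else 0)"
      by (rule sum.cong) (use on b in auto)
    also have "\<dots> = c b" using fin b by simp
    finally show "c b = 0" by simp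
  qed
  \<comment> \<open>a Euclidean normal vector of the tangent hyperplane\<close>
  define w where "w = (l\<^sup>2 *\<^sub>R fst (nu q), snd (nu q))"
  have gw: "HxR_metric q (nu q) v = w \<bullet> v" for v
    by (cases v) (simp add: g L_def w_def power2_eq_square)
  have "w \<noteq> 0"
    using gw[of "nu q"] nu_unit[OF q] by auto
  have "dim (tangent_space M q) = DIM((real ^ 'n) \<times> real) - 1"
    using dim_hyperplane[OF \<open>w \<noteq> 0\<close>] by (simp add: tangent_space_M_eq_normal[OF q] gw)
  then have "dim (span B) = CARD('n)" by (simp add: sp)
  then show ?thesis using dim_eq_card_independent[OF \<open>independent B\<close>] by simp
qed

text \<open>Parseval's identity for the tangential part \<open>\<partial>\<^sub>t - nu_t nu\<close> of the vertical
  field.\<close>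

lemma sum_vertical_components:
  fixes q :: "(real ^ 'n) \<times> real"
  assumes q: "q \<in> M" and B: "orthonormal_tangent_basis HxR_metric M q B"
  shows "(\<Sum>e\<in>B. (snd e)\<^sup>2) = (flux (snd q))\<^sup>2"
proof -
  have fin: "finite B" and sp: "span B = tangent_space M q"
    and on: "\<And>u v. u \<in> B \<Longrightarrow> v \<in> B \<Longrightarrow> HxR_metric q u v = (if u = v then 1 else 0)"
    using B by (auto simp: orthonormal_tangent_basis_def)
  have lin: "linear (\<lambda>v. HxR_metric q u v)" for u
    by (rule linearI) (auto simp: HxR_metric_def inner_add_right algebra_simps)
  have sym: "HxR_metric q u v = HxR_metric q v u" for u v
    by (simp add: HxR_metric_def inner_commute mult.commute)
  have dt: "HxR_metric q u (0, 1) = snd u" for u by (simp add: HxR_metric_def)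
  define \<beta> where "\<beta> = snd (nu q)"
  define w where "w = (0, 1) - \<beta> *\<^sub>R nu q"
  have gw: "HxR_metric q u w = snd u - \<beta> * HxR_metric q u (nu q)" for u
    unfolding w_def by (simp add: linear_diff[OF lin] linear_cmul[OF lin] dt)
  have w: "w \<in> span B"
    using gw[of "nu q"] nu_unit[OF q] by (simp add: sp tangent_space_M_eq_normal[OF q] \<beta>_def)
  then obtain c where c: "w = (\<Sum>v\<in>B. c v *\<^sub>R v)"
    using span_finite[OF fin] by auto
  have c_eq: "c e = snd e" if e: "e \<in> B" for e
  proof -
    have "HxR_metric q e w = (\<Sum>v\<in>B. c v * HxR_metric q e v)"
      by (simp add: c linear_sum[OF lin] linear_cmul[OF lin])
    also have "\<dots> = (\<Sum>v\<in>B. if v = e then c v else 0)"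
      by (rule sum.cong) (use on e in auto)
    also have "\<dots> = c e" using fin e by simp
    finally have "HxR_metric q e w = c e" .
    moreover have "HxR_metric q (nu q) e = 0"
      using span_base[OF e] by (simp add: sp tangent_space_M_eq_normal[OF q])
    ultimately show ?thesis by (simp add: gw sym[of e])
  qed
  have "(\<Sum>e\<in>B. (snd e)\<^sup>2) = (\<Sum>e\<in>B. c e * HxR_metric q w e)"
  proof (rule sum.cong)
    fix e assume e: "e \<in> B"
    have "HxR_metric q (nu q) e = 0"
      using span_base[OF e] by (simp add: sp tangent_space_M_eq_normal[OF q])
    then show "(snd e)\<^sup>2 = c e * HxR_metric q w e"
      by (simp add: sym[of w] gw sym[of e] c_eq[OF e] power2_eq_square)
  qed simp
  also have "\<dots> = HxR_metric q w w"
    by (subst (3) c) (simp add: linear_sum[OF lin] linear_cmul[OF lin])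
  also have "\<dots> = 1 - \<beta>\<^sup>2"
  proof -
    have "HxR_metric q w (nu q) = 0"
      using gw[of "nu q"] nu_unit[OF q] by (simp add: sym[of w] \<beta>_def)
    moreover have "snd w = 1 - \<beta>\<^sup>2" by (simp add: w_def \<beta>_def power2_eq_square)
    ultimately show ?thesis by (simp add: gw[of w])
  qed
  also have "\<dots> = (flux (snd q))\<^sup>2"
  proof -
    have "snd q \<in> {-T<..<T}" using q by (cases q) (simp add: M_iff)
    then show ?thesis
      using flux_first_integral[of "snd q"]
      by (simp add: \<beta>_def nu_def nu_t_def power_mult_distrib algebra_simps)
  qed
  finally show ?thesis .
qed

lemma minimal_M:
  assumes card: "CARD('n) = Suc m"
  shows "minimal_hypersurface HxR HxR_metric (M :: ((real ^ 'n) \<times> real) set)"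
  unfolding minimal_hypersurface_def
proof (intro conjI ballI hypersurface_M)
  fix pt :: "(real ^ 'n) \<times> real" assume pt: "pt \<in> M"
  show "\<exists>W \<nu>. open W \<and> pt \<in> W \<and> unit_normal_field HxR_metric M W \<nu> \<and>
      (\<forall>q\<in>M \<inter> W. mean_curvature HxR_metric M \<nu> q = 0)"
  proof (intro exI[of _ "UNIV \<times> {-T<..<T}"] exI[of _ nu] conjI ballI)
    show "pt \<in> UNIV \<times> {-T<..<T}" using pt by (cases pt) (simp add: M_iff)
    fix q :: "(real ^ 'n) \<times> real" assume "q \<in> M \<inter> (UNIV \<times> {-T<..<T})"
    then have q: "q \<in> M" by simp
    obtain x t where qq: "q = (x, t)" by (cases q)
    have t: "t \<in> {-T<..<T}" using q by (simp add: qq M_iff)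
    define B where "B = (SOME B. orthonormal_tangent_basis HxR_metric M q B)"
    have B: "orthonormal_tangent_basis HxR_metric M q B"
      unfolding B_def by (rule someI_ex[OF orthonormal_tangent_basis_exists[OF q]])
    have "(\<Sum>e\<in>B. second_fundamental_form HxR_metric nu q e e)
        = (\<Sum>e\<in>B. - (coth_f t * flux t) * (1 - (real m + 1) * (1 + (p t)\<^sup>2) * (snd e)\<^sup>2))"
    proof (rule sum.cong)
      fix e assume e: "e \<in> B"
      then have "e \<in> tangent_space M q" "HxR_metric q e e = 1"
        using B span_base[of e B] by (auto simp: orthonormal_tangent_basis_def)
      then show "second_fundamental_form HxR_metric nu q e e =
          - (coth_f t * flux t) * (1 - (real m + 1) * (1 + (p t)\<^sup>2) * (snd e)\<^sup>2)"
        using second_fundamental_form_unit q by (simp add: qq)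
    qed simp
    also have "\<dots> = - (coth_f t * flux t) *
        (real (card B) - (real m + 1) * (1 + (p t)\<^sup>2) * (\<Sum>e\<in>B. (snd e)\<^sup>2))"
      unfolding sum_distrib_left[symmetric] sum_subtractf by simp
    also have "\<dots> = - (coth_f t * flux t) * ((real m + 1) * (1 - (flux t)\<^sup>2 * (1 + (p t)\<^sup>2)))"
      using card_orthonormal_tangent_basis[OF q B] sum_vertical_components[OF q B] card
      by (simp add: qq algebra_simps)
    also have "\<dots> = 0" by (simp add: flux_first_integral[OF t])
    finally show "mean_curvature HxR_metric M nu q = 0"
      unfolding mean_curvature_def B_def by simp
  qed (rule open_slab unit_normal_field_nu)+
qed

end

section \<open>Lengths of curves and completeness\<close>

lemma HxR_metric_nonneg: "0 \<le> HxR_metric q v v"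
  by (simp add: HxR_metric_def)

lemma HxR_metric_scale: "HxR_metric q (c *\<^sub>R v) (c *\<^sub>R v) = c\<^sup>2 * HxR_metric q v v"
  by (simp add: HxR_metric_def power2_eq_square algebra_simps)

text \<open>\<open>\<gamma>\<close> is one of the paths in \<open>S\<close> from \<open>x\<close> to \<open>y\<close> admitted in the definition of the intrinsic
  distance, and \<open>L\<close> is its length.\<close>

definition connects ::
    "((real ^ 'n) \<times> real) set \<Rightarrow> (real ^ 'n) \<times> real \<Rightarrow> (real ^ 'n) \<times> real \<Rightarrow>
      (real \<Rightarrow> (real ^ 'n) \<times> real) \<Rightarrow> real \<Rightarrow> bool" where
  "connects S x y \<gamma> L \<longleftrightarrow> valid_path \<gamma> \<and> path_image \<gamma> \<subseteq> S \<and> pathstart \<gamma> = x \<and> pathfinish \<gamma> = y \<and>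
     (riemannian_speed HxR_metric \<gamma> has_integral L) {0..1}"

lemma riemannian_dist_eq:
  assumes "x \<in> S" "y \<in> S"
  shows "riemannian_dist HxR_metric S x y = Inf {L. \<exists>\<gamma>. connects S x y \<gamma> L}"
proof -
  have "{integral {0..1} (riemannian_speed HxR_metric \<gamma>) |\<gamma>.
             valid_path \<gamma> \<and> path_image \<gamma> \<subseteq> S \<and> pathstart \<gamma> = x \<and> pathfinish \<gamma> = y \<and>
             riemannian_speed HxR_metric \<gamma> integrable_on {0..1}} = {L. \<exists>\<gamma>. connects S x y \<gamma> L}"
    by (auto simp: connects_def has_integral_iff)
  then show ?thesis using assms by (simp add: riemannian_dist_def)
qed

lemma connects_nonneg:
  assumes "connects S x y \<gamma> L"
  shows "0 \<le> L"
proof (rule has_integral_nonneg)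
  show "(riemannian_speed HxR_metric \<gamma> has_integral L) {0..1}"
    using assms unfolding connects_def by blast
qed (simp add: riemannian_speed_def HxR_metric_nonneg)

lemma connects_endpoints: "connects S x y \<gamma> L \<Longrightarrow> x \<in> S \<and> y \<in> S"
  unfolding connects_def using pathstart_in_path_image pathfinish_in_path_image by blast

lemma riemannian_dist_le:
  assumes "connects S x y \<gamma> L"
  shows "riemannian_dist HxR_metric S x y \<le> L"
proof -
  have "bdd_below {L. \<exists>\<gamma>. connects S x y \<gamma> L}"
    using connects_nonneg by (intro bdd_belowI[of _ 0]) blast
  then have "Inf {L. \<exists>\<gamma>. connects S x y \<gamma> L} \<le> L"
    using assms by (intro cInf_lower) blast+
  then show ?thesis
    using connects_endpoints[OF assms] by (simp add: riemannian_dist_eq)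
qed

lemma riemannian_dist_ge:
  assumes "connects S x y \<gamma> L" and "\<And>\<gamma> L. connects S x y \<gamma> L \<Longrightarrow> c \<le> L"
  shows "c \<le> riemannian_dist HxR_metric S x y"
proof -
  have "c \<le> Inf {L. \<exists>\<gamma>. connects S x y \<gamma> L}"
    by (rule cInf_greatest) (use assms in blast)+
  then show ?thesis
    using connects_endpoints[OF assms(1)] by (simp add: riemannian_dist_eq)
qed

lemma riemannian_speed_affine:
  assumes "\<gamma> differentiable at (c * s + b)" "open U" "s \<in> U" "\<And>y. y \<in> U \<Longrightarrow> \<delta> y = \<gamma> (c * y + b)"
  shows "riemannian_speed HxR_metric \<delta> s = \<bar>c\<bar> * riemannian_speed HxR_metric \<gamma> (c * s + b)"
proof -
  let ?v = "vector_derivative \<gamma> (at (c * s + b))"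
  have "((\<lambda>y. c * y + b) has_vector_derivative c) (at s)"
    unfolding has_real_derivative_iff_has_vector_derivative[symmetric]
    by (auto intro!: derivative_eq_intros)
  moreover have "(\<gamma> has_vector_derivative ?v) (at (c * s + b))"
    by (rule vector_derivative_works[THEN iffD1, OF assms(1)])
  ultimately have "(\<gamma> \<circ> (\<lambda>y. c * y + b) has_vector_derivative c *\<^sub>R ?v) (at s)"
    by (rule vector_diff_chain_at)
  then have "(\<delta> has_vector_derivative c *\<^sub>R ?v) (at s)"
    by (rule has_vector_derivative_transform_within_open[OF _ assms(2,3)]) (simp only: assms(4) o_apply)
  then have "vector_derivative \<delta> (at s) = c *\<^sub>R ?v" by (rule vector_derivative_at)
  then show ?thesis
    by (simp add: riemannian_speed_def assms(4)[OF assms(3)] HxR_metric_scale real_sqrt_mult)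
qed

lemma valid_path_differentiable:
  assumes "valid_path \<gamma>"
  obtains S where "finite S" "\<And>s. s \<in> {0..1} - S \<Longrightarrow> \<gamma> differentiable at s"
  using assms unfolding valid_path_def piecewise_C1_differentiable_on_def C1_differentiable_on_eq
  by blast

lemma connects_reversepath:
  assumes "connects S x y \<gamma> L"
  shows "connects S y x (reversepath \<gamma>) L"
proof -
  obtain F where F: "finite F" "\<And>s. s \<in> {0..1} - F \<Longrightarrow> \<gamma> differentiable at s"
    using assms valid_path_differentiable unfolding connects_def by metis
  have "((\<lambda>s. riemannian_speed HxR_metric \<gamma> (-1 *\<^sub>R s + 1)) has_integral L) {0..1}"
    using has_integral_affinity[of "riemannian_speed HxR_metric \<gamma>" L 0 1 "-1" 1] assms
    by (auto simp: connects_def image_diff_atLeastAtMost)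
  then have "(riemannian_speed HxR_metric (reversepath \<gamma>) has_integral L) {0..1}"
  proof (rule has_integral_spike_finite[rotated 2])
    show "finite ((\<lambda>s. 1 - s) ` F)" using F(1) by simp
    fix s assume s: "s \<in> {0..1} - (\<lambda>s. 1 - s) ` F"
    have "1 - s \<notin> F"
    proof
      assume "1 - s \<in> F"
      then have "s \<in> (\<lambda>s. 1 - s) ` F" by (intro image_eqI[of _ _ "1 - s"]) auto
      then show False using s by blast
    qed
    then have "\<gamma> differentiable at (-1 * s + 1)" using s F(2)[of "1 - s"] by simp
    then have "riemannian_speed HxR_metric (reversepath \<gamma>) s = \<bar>-1\<bar> * riemannian_speed HxR_metric \<gamma> (-1 * s + 1)"
      by (rule riemannian_speed_affine[OF _ open_UNIV]) (auto simp: reversepath_def)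
    then show "riemannian_speed HxR_metric (reversepath \<gamma>) s = riemannian_speed HxR_metric \<gamma> (-1 *\<^sub>R s + 1)"
      by simp
  qed
  then show ?thesis using assms by (simp add: connects_def)
qed

lemma connects_join:
  assumes 1: "connects S x y \<gamma> L" and 2: "connects S y z \<delta> K"
  shows "connects S x z (\<gamma> +++ \<delta>) (L + K)"
proof -
  obtain F where F: "finite F" "\<And>s. s \<in> {0..1} - F \<Longrightarrow> \<gamma> differentiable at s"
    using 1 valid_path_differentiable unfolding connects_def by metis
  obtain G where G: "finite G" "\<And>s. s \<in> {0..1} - G \<Longrightarrow> \<delta> differentiable at s"
    using 2 valid_path_differentiable unfolding connects_def by metis
  have "((\<lambda>s. riemannian_speed HxR_metric \<gamma> (2 *\<^sub>R s + 0)) has_integral L /\<^sub>R 2) {0..1/2}"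
    using has_integral_affinity'[of "riemannian_speed HxR_metric \<gamma>" L 0 1 2 0] 1
    by (simp add: connects_def)
  from has_integral_cmul[OF this, of 2]
  have "((\<lambda>s. 2 * riemannian_speed HxR_metric \<gamma> (2 * s + 0)) has_integral L) {0..1/2}" by simp
  then have A: "(riemannian_speed HxR_metric (\<gamma> +++ \<delta>) has_integral L) {0..1/2}"
  proof (rule has_integral_spike_finite[rotated 2])
    show "finite (insert (1/2) ((\<lambda>s. s / 2) ` F))" using F(1) by simp
    fix s :: real assume s: "s \<in> {0..1/2} - insert (1/2) ((\<lambda>s. s / 2) ` F)"
    have "2 * s \<notin> F"
    proof
      assume "2 * s \<in> F"
      then have "s \<in> (\<lambda>s. s / 2) ` F" by (intro image_eqI[of _ _ "2 * s"]) auto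
      then show False using s by blast
    qed
    then have "\<gamma> differentiable at (2 * s + 0)" using s F(2)[of "2 * s"] by simp
    then have "riemannian_speed HxR_metric (\<gamma> +++ \<delta>) s = \<bar>2\<bar> * riemannian_speed HxR_metric \<gamma> (2 * s + 0)"
      by (rule riemannian_speed_affine[of _ _ _ _ "{..<1/2}"]) (use s in \<open>auto simp: joinpaths_def\<close>)
    then show "riemannian_speed HxR_metric (\<gamma> +++ \<delta>) s = 2 * riemannian_speed HxR_metric \<gamma> (2 * s + 0)"
      by simp
  qed
  have "((\<lambda>s. riemannian_speed HxR_metric \<delta> (2 *\<^sub>R s + (-1))) has_integral K /\<^sub>R 2) {1/2..1}"
    using has_integral_affinity'[of "riemannian_speed HxR_metric \<delta>" K 0 1 2 "-1"] 2
    by (simp add: connects_def)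
  from has_integral_cmul[OF this, of 2]
  have "((\<lambda>s. 2 * riemannian_speed HxR_metric \<delta> (2 * s + (-1))) has_integral K) {1/2..1}" by simp
  then have B: "(riemannian_speed HxR_metric (\<gamma> +++ \<delta>) has_integral K) {1/2..1}"
  proof (rule has_integral_spike_finite[rotated 2])
    show "finite (insert (1/2) ((\<lambda>s. (s + 1) / 2) ` G))" using G(1) by simp
    fix s :: real assume s: "s \<in> {1/2..1} - insert (1/2) ((\<lambda>s. (s + 1) / 2) ` G)"
    have "2 * s - 1 \<notin> G"
    proof
      assume "2 * s - 1 \<in> G"
      then have "s \<in> (\<lambda>s. (s + 1) / 2) ` G" by (intro image_eqI[of _ _ "2 * s - 1"]) auto
      then show False using s by blast
    qed
    then have "\<delta> differentiable at (2 * s + (-1))" using s G(2)[of "2 * s - 1"] by simp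
    then have "riemannian_speed HxR_metric (\<gamma> +++ \<delta>) s = \<bar>2\<bar> * riemannian_speed HxR_metric \<delta> (2 * s + (-1))"
      by (rule riemannian_speed_affine[of _ _ _ _ "{1/2<..}"]) (use s in \<open>auto simp: joinpaths_def\<close>)
    then show "riemannian_speed HxR_metric (\<gamma> +++ \<delta>) s = 2 * riemannian_speed HxR_metric \<delta> (2 * s + (-1))"
      by simp
  qed
  have "(riemannian_speed HxR_metric (\<gamma> +++ \<delta>) has_integral (L + K)) {0..1}"
    by (rule has_integral_combine[OF _ _ A B]) auto
  moreover have "path_image (\<gamma> +++ \<delta>) \<subseteq> S"
    using 1 2 path_image_join_subset[of \<gamma> \<delta>] unfolding connects_def by blast
  ultimately show ?thesis
    using 1 2 by (simp add: connects_def valid_path_join)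
qed

text \<open>A function whose differential is bounded by the metric is 1-Lipschitz for the length of
  paths. The inequality is assumed for all vectors at points of \<open>S\<close>, so that it also covers the
  finitely many parameters where \<open>vector_derivative\<close> is a dummy.\<close>

lemma connects_lipschitz:
  fixes \<psi> :: "(real ^ 'n) \<times> real \<Rightarrow> 'b::euclidean_space"
  assumes c: "connects S x y \<gamma> L"
    and d: "\<And>z. z \<in> S \<Longrightarrow> (\<psi> has_derivative \<psi>' z) (at z)"
    and le: "\<And>z v. z \<in> S \<Longrightarrow> norm (\<psi>' z v) \<le> sqrt (HxR_metric z v v)"
  shows "norm (\<psi> y - \<psi> x) \<le> L"
proof -
  obtain F where F: "finite F" "\<And>s. s \<in> {0..1} - F \<Longrightarrow> \<gamma> differentiable at s"
    using c valid_path_differentiable unfolding connects_def by metis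
  have \<gamma>S: "\<gamma> s \<in> S" if "s \<in> {0..1}" for s
    using c that unfolding connects_def path_image_def by blast
  let ?h = "\<lambda>s. \<psi>' (\<gamma> s) (vector_derivative \<gamma> (at s))"
  have cont: "continuous_on {0..1} \<gamma>"
    using c valid_path_imp_path unfolding connects_def path_def by blast
  have "(?h has_integral \<psi> (\<gamma> 1) - \<psi> (\<gamma> 0)) {0..1}"
  proof (rule fundamental_theorem_of_calculus_interior_strong[OF F(1)])
    fix s assume s: "s \<in> {0<..<1} - F"
    have "(\<gamma> has_derivative (\<lambda>h. h *\<^sub>R vector_derivative \<gamma> (at s))) (at s)"
      using F(2)[of s] s vector_derivative_works[of \<gamma> "at s"] by (simp add: has_vector_derivative_def)
    from has_derivative_compose[OF this d[OF \<gamma>S]]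
    have "((\<lambda>s. \<psi> (\<gamma> s)) has_derivative (\<lambda>h. \<psi>' (\<gamma> s) (h *\<^sub>R vector_derivative \<gamma> (at s)))) (at s)"
      using s by simp
    moreover have "linear (\<psi>' (\<gamma> s))"
      by (rule has_derivative_linear[OF d[OF \<gamma>S]]) (use s in auto)
    ultimately show "((\<lambda>s. \<psi> (\<gamma> s)) has_vector_derivative ?h s) (at s)"
      by (simp add: has_vector_derivative_def linear_cmul)
  next
    show "continuous_on {0..1} (\<lambda>s. \<psi> (\<gamma> s))"
    proof (rule continuous_on_compose2[OF _ cont])
      show "continuous_on S \<psi>"
        using d has_derivative_continuous continuous_at_imp_continuous_on by blast
    qed (use \<gamma>S in auto)
  qed simp
  moreover have "(riemannian_speed HxR_metric \<gamma> has_integral L) {0..1}"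
    using c by (simp add: connects_def)
  moreover have "norm (?h s) \<le> riemannian_speed HxR_metric \<gamma> s" if "s \<in> {0..1}" for s
    unfolding riemannian_speed_def by (rule le[OF \<gamma>S[OF that]])
  ultimately have "norm (\<psi> (\<gamma> 1) - \<psi> (\<gamma> 0)) \<le> L"
    using integral_norm_bound_integral[of ?h "{0..1}" "riemannian_speed HxR_metric \<gamma>"]
    by (auto simp: has_integral_iff)
  then show ?thesis using c by (auto simp: connects_def pathstart_def pathfinish_def)
qed

lemma connects_C1:
  assumes d: "\<And>s. s \<in> {0..1} \<Longrightarrow> (\<gamma> has_vector_derivative \<gamma>' s) (at s)"
    and cont: "continuous_on {0..1} \<gamma>'" and S: "\<And>s. s \<in> {0..1} \<Longrightarrow> \<gamma> s \<in> S" "S \<subseteq> HxR"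
    and le: "\<And>s. s \<in> {0..1} \<Longrightarrow> sqrt (HxR_metric (\<gamma> s) (\<gamma>' s) (\<gamma>' s)) \<le> K"
  shows "\<exists>L\<le>K. connects S (\<gamma> 0) (\<gamma> 1) \<gamma> L"
proof -
  have c\<gamma>: "continuous_on {0..1} \<gamma>"
    using d by (meson continuous_at_imp_continuous_on has_vector_derivative_continuous)
  have vd: "vector_derivative \<gamma> (at s) = \<gamma>' s" if "s \<in> {0..1}" for s
    using d[OF that] by (rule vector_derivative_at)
  have "valid_path \<gamma>"
    unfolding valid_path_def
    by (rule C1_differentiable_imp_piecewise) (use d cont in \<open>unfold C1_differentiable_on_def, blast\<close>)
  have ne: "1 - (norm (fst (\<gamma> s)))\<^sup>2 \<noteq> 0" if "s \<in> {0..1}" for s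
    using S that power_strict_mono[of "norm (fst (\<gamma> s))" 1 2] by (fastforce simp: HxR_def)
  have "continuous_on {0..1} (\<lambda>s. sqrt (HxR_metric (\<gamma> s) (\<gamma>' s) (\<gamma>' s)))"
    unfolding HxR_metric_def by (intro continuous_intros c\<gamma> cont) (use ne in auto)
  then have "continuous_on {0..1} (riemannian_speed HxR_metric \<gamma>)"
    by (rule continuous_on_eq) (simp add: riemannian_speed_def vd)
  then have int: "riemannian_speed HxR_metric \<gamma> integrable_on {0..1}"
    by (rule integrable_continuous_real)
  have "integral {0..1} (riemannian_speed HxR_metric \<gamma>) \<le> integral {0..1} (\<lambda>_::real. K)"
    by (intro integral_le int) (use le in \<open>auto simp: riemannian_speed_def vd\<close>)
  then have "integral {0..1} (riemannian_speed HxR_metric \<gamma>) \<le> K" by simp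
  moreover have "connects S (\<gamma> 0) (\<gamma> 1) \<gamma> (integral {0..1} (riemannian_speed HxR_metric \<gamma>))"
    using \<open>valid_path \<gamma>\<close> int S(1)
    by (auto simp: connects_def path_image_def pathstart_def pathfinish_def has_integral_integral[symmetric])
  ultimately show ?thesis by blast
qed

text \<open>In dimension at least \<open>2\<close> any two unit vectors, equal and antipodal ones included, lie on a
  great circle.\<close>

lemma orthonormal_pair:
  fixes \<xi> \<zeta> :: "'a::euclidean_space"
  assumes "2 \<le> DIM('a)" and \<xi>: "norm \<xi> = 1" and \<zeta>: "norm \<zeta> = 1"
  obtains w where "norm w = 1" "\<xi> \<bullet> w = 0"
    "\<zeta> = cos (arccos (\<xi> \<bullet> \<zeta>)) *\<^sub>R \<xi> + sin (arccos (\<xi> \<bullet> \<zeta>)) *\<^sub>R w"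
proof -
  let ?c = "\<xi> \<bullet> \<zeta>"
  have c: "\<bar>?c\<bar> \<le> 1" using Cauchy_Schwarz_ineq2[of \<xi> \<zeta>] assms by simp
  have cs: "cos (arccos ?c) = ?c" "sin (arccos ?c) = sqrt (1 - ?c\<^sup>2)"
    using c by (auto simp: sin_arccos_abs)
  have \<xi>\<xi>: "\<xi> \<bullet> \<xi> = 1" "\<zeta> \<bullet> \<zeta> = 1" using \<xi> \<zeta> by (auto simp: dot_square_norm)
  define u where "u = \<zeta> - ?c *\<^sub>R \<xi>"
  have u: "\<xi> \<bullet> u = 0" "u \<bullet> u = 1 - ?c\<^sup>2"
    using \<xi>\<xi> by (auto simp: u_def inner_diff_left inner_diff_right inner_commute power2_eq_square)
  have nu: "norm u = sqrt (1 - ?c\<^sup>2)" using u(2) by (simp add: norm_eq_sqrt_inner)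
  show thesis
  proof (cases "u = 0")
    case True
    obtain y where y: "y \<noteq> 0" "orthogonal \<xi> y" using orthogonal_to_vector_exists[OF assms(1)] by blast
    show ?thesis
      by (rule that[of "y /\<^sub>R norm y"])
        (use True y nu in \<open>auto simp: cs orthogonal_def u_def\<close>)
  next
    case False
    show ?thesis
      by (rule that[of "u /\<^sub>R norm u"])
        (use False u in \<open>auto simp: cs nu[symmetric] u_def\<close>)
  qed
qed

context rotation_profile
begin

lemma conformal_rad_derivative:
  assumes "t \<in> {-T<..<T}"
  shows "2 / (1 - (rad t)\<^sup>2) * ((1 - (rad t)\<^sup>2) / 2 * p t) = p t"
  using conformal_factor_pos[OF assms] by simp

text \<open>A piece of a meridian, with speed \<open>sqrt (1 + p\<^sup>2)\<close> with respect to the height.\<close>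

lemma connects_meridian:
  fixes \<xi> :: "real ^ 'n"
  assumes t: "t \<in> {-T<..<T}" and u: "u \<in> {-T<..<T}" and \<xi>: "norm \<xi> = 1"
    and C: "\<And>y. y \<in> closed_segment t u \<Longrightarrow> sqrt (1 + (p y)\<^sup>2) \<le> C"
  shows "\<exists>\<gamma> L. L \<le> C * \<bar>u - t\<bar> \<and> connects M (rad t *\<^sub>R \<xi>, t) (rad u *\<^sub>R \<xi>, u) \<gamma> L"
proof -
  define y where "y s = t + s * (u - t)" for s
  have seg: "y s \<in> closed_segment t u" if "s \<in> {0..1}" for s
    using that unfolding closed_segment_def y_def
    by (auto simp: algebra_simps intro!: exI[of _ s])
  have I: "y s \<in> {-T<..<T}" if "s \<in> {0..1}" for s
  proof -
    have "convex {-T<..<T}" by simp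
    then show ?thesis
      using seg[OF that] closed_segment_subset[OF t u] by blast
  qed
  define r' where "r' s = (1 - (rad s)\<^sup>2) / 2 * p s" for s
  define \<gamma> where "\<gamma> s = (rad (y s) *\<^sub>R \<xi>, y s)" for s
  define \<gamma>' where "\<gamma>' s = ((r' (y s) * (u - t)) *\<^sub>R \<xi>, u - t)" for s
  have dy: "(y has_real_derivative (u - t)) (at s)" for s
    unfolding y_def by (auto intro!: derivative_eq_intros)
  have "\<exists>L\<le>C * \<bar>u - t\<bar>. connects M (\<gamma> 0) (\<gamma> 1) \<gamma> L"
  proof (rule connects_C1[of \<gamma> \<gamma>'])
    fix s :: real assume s: "s \<in> {0..1}"
    have "((\<lambda>s. rad (y s)) has_real_derivative r' (y s) * (u - t)) (at s)"
      unfolding r'_def by (rule DERIV_chain2[OF rad_has_derivative[OF I[OF s]] dy])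
    then have "((\<lambda>s. rad (y s) *\<^sub>R \<xi>) has_vector_derivative (r' (y s) * (u - t)) *\<^sub>R \<xi>) (at s)"
      using has_vector_derivative_scaleR[OF _ has_vector_derivative_const] by fastforce
    from has_vector_derivative_Pair[OF this dy[unfolded has_real_derivative_iff_has_vector_derivative]]
    show "(\<gamma> has_vector_derivative \<gamma>' s) (at s)"
      by (simp add: \<gamma>_def [abs_def] \<gamma>'_def)
    show "\<gamma> s \<in> M"
      using I[OF s] rad_bounds[OF I[OF s]] \<xi> by (simp add: \<gamma>_def M_iff)
    have n: "norm (rad (y s) *\<^sub>R \<xi>) = rad (y s)" using rad_bounds[OF I[OF s]] \<xi> by simp
    have "HxR_metric (\<gamma> s) (\<gamma>' s) (\<gamma>' s)
       = (2 / (1 - (rad (y s))\<^sup>2) * r' (y s))\<^sup>2 * (u - t)\<^sup>2 * (\<xi> \<bullet> \<xi>) + (u - t)\<^sup>2"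
      unfolding HxR_metric_def \<gamma>_def \<gamma>'_def fst_conv snd_conv n
      by (simp add: power2_eq_square)
    also have "\<dots> = (1 + (p (y s))\<^sup>2) * (u - t)\<^sup>2"
      unfolding r'_def conformal_rad_derivative[OF I[OF s]]
      using \<xi> by (simp add: dot_square_norm algebra_simps)
    finally have "sqrt (HxR_metric (\<gamma> s) (\<gamma>' s) (\<gamma>' s)) = sqrt (1 + (p (y s))\<^sup>2) * \<bar>u - t\<bar>"
      by (simp add: real_sqrt_mult)
    then show "sqrt (HxR_metric (\<gamma> s) (\<gamma>' s) (\<gamma>' s)) \<le> C * \<bar>u - t\<bar>"
      using C[OF seg[OF s]] by (simp add: mult_right_mono)
  next
    have "continuous_on {-T<..<T} rad" "continuous_on {-T<..<T} p"
      using rad_has_derivative p_has_derivative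
      by (meson DERIV_isCont continuous_at_imp_continuous_on)+
    then have "continuous_on {-T<..<T} r'"
      unfolding r'_def by (intro continuous_intros) auto
    then have "continuous_on {0..1} (\<lambda>s. r' (y s))"
      by (rule continuous_on_compose2) (use I in \<open>auto simp: y_def intro!: continuous_intros\<close>)
    then show "continuous_on {0..1} \<gamma>'"
      unfolding \<gamma>'_def by (intro continuous_intros)
  qed (rule M_subset)
  moreover have "\<gamma> 0 = (rad t *\<^sub>R \<xi>, t)" "\<gamma> 1 = (rad u *\<^sub>R \<xi>, u)"
    by (auto simp: \<gamma>_def y_def)
  ultimately show ?thesis by auto
qed

text \<open>A great circle arc of the slice at height \<open>t\<close>, which is isometric to a Euclidean sphere of
  radius \<open>sinh (f t)\<close>.\<close>

lemma connects_parallel: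
  fixes \<xi> \<zeta> :: "real ^ 'n"
  assumes n: "2 \<le> CARD('n)" and t: "t \<in> {-T<..<T}" and \<xi>: "norm \<xi> = 1" "norm \<zeta> = 1"
  shows "\<exists>\<gamma> L. L \<le> sinh (f t) * arccos (\<xi> \<bullet> \<zeta>) \<and> connects M (rad t *\<^sub>R \<xi>, t) (rad t *\<^sub>R \<zeta>, t) \<gamma> L"
proof -
  define k where "k = arccos (\<xi> \<bullet> \<zeta>)"
  have "2 \<le> DIM(real ^ 'n)" using n by simp
  from orthonormal_pair[OF this \<xi>] obtain w
    where w: "norm w = 1" "\<xi> \<bullet> w = 0" "\<zeta> = cos k *\<^sub>R \<xi> + sin k *\<^sub>R w"
    unfolding k_def by metis
  have "\<bar>\<xi> \<bullet> \<zeta>\<bar> \<le> 1" using Cauchy_Schwarz_ineq2[of \<xi> \<zeta>] \<xi> by simp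
  then have k: "0 \<le> k" by (auto simp: k_def intro!: arccos_lbound)
  define \<gamma> where "\<gamma> s = (rad t *\<^sub>R (cos (s * k) *\<^sub>R \<xi> + sin (s * k) *\<^sub>R w), t)" for s
  define \<gamma>' where "\<gamma>' s = ((rad t * k) *\<^sub>R (- sin (s * k) *\<^sub>R \<xi> + cos (s * k) *\<^sub>R w), 0 :: real)" for s
  have on: "\<xi> \<bullet> \<xi> = 1" "w \<bullet> w = 1" "w \<bullet> \<xi> = 0"
    using \<xi> w by (auto simp: dot_square_norm inner_commute)
  have circ: "norm (a *\<^sub>R \<xi> + b *\<^sub>R w) = sqrt (a\<^sup>2 + b\<^sup>2)" for a b
    by (simp add: norm_eq_sqrt_inner inner_add_left inner_add_right on w(2) power2_eq_square)
  have r: "0 < rad t" by (rule rad_bounds[OF t])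
  have "\<exists>L\<le>sinh (f t) * k. connects M (\<gamma> 0) (\<gamma> 1) \<gamma> L"
  proof (rule connects_C1[of \<gamma> \<gamma>'])
    fix s :: real assume s: "s \<in> {0..1}"
    have "((\<lambda>s. cos (s * k)) has_vector_derivative - sin (s * k) * k) (at s)"
      "((\<lambda>s. sin (s * k)) has_vector_derivative cos (s * k) * k) (at s)"
      unfolding has_real_derivative_iff_has_vector_derivative[symmetric]
      by (auto intro!: derivative_eq_intros)
    then have "((\<lambda>s. cos (s * k) *\<^sub>R \<xi> + sin (s * k) *\<^sub>R w) has_vector_derivative
        (- sin (s * k) * k) *\<^sub>R \<xi> + (cos (s * k) * k) *\<^sub>R w) (at s)"
      by (intro has_vector_derivative_add bounded_linear.has_vector_derivative[OF bounded_linear_scaleR_left])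
    then have "((\<lambda>s. rad t *\<^sub>R (cos (s * k) *\<^sub>R \<xi> + sin (s * k) *\<^sub>R w)) has_vector_derivative
        rad t *\<^sub>R ((- sin (s * k) * k) *\<^sub>R \<xi> + (cos (s * k) * k) *\<^sub>R w)) (at s)"
      by (rule bounded_linear.has_vector_derivative[OF bounded_linear_scaleR_right])
    from has_vector_derivative_Pair[OF this has_vector_derivative_const]
    show "(\<gamma> has_vector_derivative \<gamma>' s) (at s)"
      by (simp add: \<gamma>_def [abs_def] \<gamma>'_def algebra_simps)
    have n: "norm (rad t *\<^sub>R (cos (s * k) *\<^sub>R \<xi> + sin (s * k) *\<^sub>R w)) = rad t"
      using r by (simp add: circ)
    then show "\<gamma> s \<in> M" using t by (simp add: \<gamma>_def M_iff)
    have n': "norm (- sin (s * k) *\<^sub>R \<xi> + cos (s * k) *\<^sub>R w) = 1"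
      unfolding circ by simp
    have "HxR_metric (\<gamma> s) (\<gamma>' s) (\<gamma>' s) = (2 / (1 - (rad t)\<^sup>2))\<^sup>2 * (norm (fst (\<gamma>' s)))\<^sup>2"
      by (simp only: HxR_metric_def \<gamma>_def \<gamma>'_def fst_conv snd_conv n power2_norm_eq_inner
          mult_zero_left add_0_right)
    also have "norm (fst (\<gamma>' s)) = rad t * k"
      unfolding \<gamma>'_def fst_conv norm_scaleR n' using r k by simp
    also have "(2 / (1 - (rad t)\<^sup>2))\<^sup>2 * (rad t * k)\<^sup>2 = (2 / (1 - (rad t)\<^sup>2) * rad t)\<^sup>2 * k\<^sup>2"
      by (simp only: power_mult_distrib mult.assoc)
    also have "\<dots> = (sinh (f t) * k)\<^sup>2"
      unfolding conformal_factor_rad[OF t] by (simp add: power_mult_distrib)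
    finally show "sqrt (HxR_metric (\<gamma> s) (\<gamma>' s) (\<gamma>' s)) \<le> sinh (f t) * k"
      using sinh_f_pos[OF t] k by simp
  next
    show "continuous_on {0..1} \<gamma>'"
      unfolding \<gamma>'_def by (intro continuous_intros)
  qed (rule M_subset)
  moreover have "\<gamma> 0 = (rad t *\<^sub>R \<xi>, t)" "\<gamma> 1 = (rad t *\<^sub>R \<zeta>, t)"
    by (auto simp: \<gamma>_def w(3))
  ultimately show ?thesis unfolding k_def by auto
qed

lemma compact_slope_bound:
  assumes "c < T"
  shows "\<exists>C. \<forall>y. \<bar>y\<bar> \<le> c \<longrightarrow> sqrt (1 + (p y)\<^sup>2) \<le> C"
proof -
  have "continuous_on {-c..c} p"
    using assms by (intro continuous_at_imp_continuous_on ballI DERIV_isCont[OF p_has_derivative]) auto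
  then have "continuous_on {-c..c} (\<lambda>y. sqrt (1 + (p y)\<^sup>2))"
    by (intro continuous_intros)
  then have "bounded ((\<lambda>y. sqrt (1 + (p y)\<^sup>2)) ` {-c..c})"
    using compact_continuous_image compact_imp_bounded by blast
  then obtain C where "\<And>y. y \<in> {-c..c} \<Longrightarrow> norm (sqrt (1 + (p y)\<^sup>2)) \<le> C"
    unfolding bounded_iff by blast
  then show ?thesis by (intro exI[of _ C]) (auto simp: abs_le_iff)
qed

lemma M_direction:
  assumes "(x, t) \<in> (M :: ((real ^ 'n) \<times> real) set)"
  shows "norm (x /\<^sub>R rad t) = 1" "x = rad t *\<^sub>R (x /\<^sub>R rad t)"
  using assms rad_bounds[of t] by (auto simp: M_iff)

lemma connects_exists:
  fixes q q' :: "(real ^ 'n) \<times> real"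
  assumes n: "2 \<le> CARD('n)" and q: "q \<in> M" "q' \<in> M"
  shows "\<exists>\<gamma> L. connects M q q' \<gamma> L"
proof -
  obtain x t where x: "q = (x, t)" by (cases q)
  obtain y u where y: "q' = (y, u)" by (cases q')
  have t: "t \<in> {-T<..<T}" and u: "u \<in> {-T<..<T}" using q by (auto simp: x y M_iff)
  define c where "c = max \<bar>t\<bar> \<bar>u\<bar>"
  have "c < T" using t u by (auto simp: c_def)
  then obtain C where C: "\<And>z. \<bar>z\<bar> \<le> c \<Longrightarrow> sqrt (1 + (p z)\<^sup>2) \<le> C"
    using compact_slope_bound by blast
  have "\<bar>z\<bar> \<le> c" if "z \<in> closed_segment t u" for z
    using that by (auto simp: c_def closed_segment_eq_real_ivl split: if_splits)
  then obtain \<gamma> L where 1: "connects M q (rad u *\<^sub>R (x /\<^sub>R rad t), u) \<gamma> L"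
    using connects_meridian[OF t u, of "x /\<^sub>R rad t" C] M_direction[of x t] q x C by metis
  obtain \<delta> K where 2: "connects M (rad u *\<^sub>R (x /\<^sub>R rad t), u) q' \<delta> K"
    using connects_parallel[OF n u, of "x /\<^sub>R rad t" "y /\<^sub>R rad u"] M_direction[of x t] M_direction[of y u] q x y
    by metis
  show ?thesis using connects_join[OF 1 2] by blast
qed

lemma one_le_conformal_factor:
  fixes x :: "real ^ 'n"
  assumes "norm x < 1"
  shows "1 \<le> 2 / (1 - (norm x)\<^sup>2)"
proof -
  have "0 < 1 - (norm x)\<^sup>2"
    using power_strict_mono[of "norm x" 1 2] assms by simp
  moreover have "1 - (norm x)\<^sup>2 \<le> 2" using zero_le_power2[of "norm x"] by linarith
  ultimately show ?thesis by (simp add: pos_le_divide_eq)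
qed

text \<open>The metric dominates the Euclidean one, as the conformal factor is at least \<open>2\<close>.\<close>

lemma dist_le_length:
  fixes q q' :: "(real ^ 'n) \<times> real"
  assumes "connects M q q' \<gamma> L"
  shows "dist q q' \<le> L"
proof -
  have "norm (q' - q) \<le> L"
  proof (rule connects_lipschitz[OF assms, where \<psi> = "\<lambda>z. z" and \<psi>' = "\<lambda>_ v. v"])
    fix z v :: "(real ^ 'n) \<times> real" assume "z \<in> M"
    then have "norm (fst z) < 1" using M_subset by (auto simp: HxR_def)
    from one_le_conformal_factor[OF this]
    have "1 \<le> (2 / (1 - (norm (fst z))\<^sup>2))\<^sup>2" by (simp add: one_le_power)
    then have "1 * (fst v \<bullet> fst v) \<le> (2 / (1 - (norm (fst z))\<^sup>2))\<^sup>2 * (fst v \<bullet> fst v)"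
      by (rule mult_right_mono) simp
    then show "norm v \<le> sqrt (HxR_metric z v v)"
      by (simp add: HxR_metric_def norm_eq_sqrt_inner inner_prod_def)
  qed (rule has_derivative_ident)
  then show ?thesis by (simp add: dist_norm norm_minus_commute)
qed

text \<open>The differential of \<open>ln (1 - |x|\<^sup>2)\<close> has norm \<open>|x| < 1\<close> with respect to the hyperbolic
  metric.\<close>

lemma log_conformal_le_length:
  fixes q q' :: "(real ^ 'n) \<times> real"
  assumes "connects M q q' \<gamma> L"
  shows "\<bar>ln (1 - (norm (fst q'))\<^sup>2) - ln (1 - (norm (fst q))\<^sup>2)\<bar> \<le> L"
proof -
  let ?\<psi> = "\<lambda>z :: (real ^ 'n) \<times> real. ln (1 - fst z \<bullet> fst z)"
  have "norm (?\<psi> q' - ?\<psi> q) \<le> L"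
  proof (rule connects_lipschitz[OF assms, where \<psi> = ?\<psi>
        and \<psi>' = "\<lambda>z v. - (2 / (1 - (norm (fst z))\<^sup>2) * (fst z \<bullet> fst v))"])
    fix z :: "(real ^ 'n) \<times> real" assume "z \<in> M"
    then have z: "norm (fst z) < 1" using M_subset by (auto simp: HxR_def)
    then have pos: "0 < 1 - fst z \<bullet> fst z"
      using power_strict_mono[of "norm (fst z)" 1 2] by (simp add: dot_square_norm)
    have "((\<lambda>z. 1 - fst z \<bullet> fst z) has_derivative (\<lambda>v. - (2 * (fst z \<bullet> fst v)))) (at z)"
      by (auto intro!: derivative_eq_intros simp: inner_commute)
    from has_derivative_ln[OF pos this]
    have "(?\<psi> has_derivative (\<lambda>v. - (2 * (fst z \<bullet> fst v)) * inverse (1 - fst z \<bullet> fst z))) (at z)" .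
    then show "(?\<psi> has_derivative (\<lambda>v. - (2 / (1 - (norm (fst z))\<^sup>2) * (fst z \<bullet> fst v)))) (at z)"
      by (simp add: dot_square_norm divide_inverse mult_ac)
    fix v :: "(real ^ 'n) \<times> real"
    let ?l = "2 / (1 - (norm (fst z))\<^sup>2)"
    have l: "0 \<le> ?l" by (rule order_trans[OF zero_le_one one_le_conformal_factor[OF z]])
    have "\<bar>fst z \<bullet> fst v\<bar> \<le> norm (fst z) * norm (fst v)" by (rule Cauchy_Schwarz_ineq2)
    also have "\<dots> \<le> 1 * norm (fst v)" using z by (intro mult_right_mono) auto
    finally have "?l * \<bar>fst z \<bullet> fst v\<bar> \<le> ?l * norm (fst v)" by (intro mult_left_mono l) simp
    also have "\<dots> = sqrt (?l\<^sup>2 * (fst v \<bullet> fst v))"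
      using l by (simp add: real_sqrt_mult norm_eq_sqrt_inner)
    also have "\<dots> \<le> sqrt (HxR_metric z v v)" by (simp add: HxR_metric_def)
    finally show "norm (- (?l * (fst z \<bullet> fst v))) \<le> sqrt (HxR_metric z v v)"
      using l by (simp add: abs_mult)
  qed
  then show ?thesis by (simp add: dot_square_norm)
qed

lemma Metric_space_M:
  assumes n: "2 \<le> CARD('n)"
  shows "Metric_space (M :: ((real ^ 'n) \<times> real) set) (riemannian_dist HxR_metric M)"
proof
  let ?d = "riemannian_dist HxR_metric (M :: ((real ^ 'n) \<times> real) set)"
  fix x y z :: "(real ^ 'n) \<times> real"
  have ge: "c \<le> ?d x y" if "x \<in> M" "y \<in> M" "\<And>\<gamma> L. connects M x y \<gamma> L \<Longrightarrow> c \<le> L" for c x y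
    using connects_exists[OF n that(1,2)] riemannian_dist_ge that(3) by blast
  show "0 \<le> ?d x y"
  proof (cases "x \<in> M \<and> y \<in> M")
    case True
    then show ?thesis using ge[of x y 0] connects_nonneg by blast
  qed (auto simp: riemannian_dist_def)
  show "?d x y = ?d y x"
  proof (cases "x \<in> M \<and> y \<in> M")
    case True
    have "(\<exists>\<gamma>. connects M x y \<gamma> L) \<longleftrightarrow> (\<exists>\<gamma>. connects M y x \<gamma> L)" for L
      using connects_reversepath by blast
    then show ?thesis using True by (simp add: riemannian_dist_eq)
  qed (auto simp: riemannian_dist_def)
  show "?d x y = 0 \<longleftrightarrow> x = y" if "x \<in> M" "y \<in> M"
  proof
    assume "?d x y = 0"
    moreover have "dist x y \<le> ?d x y" using ge[OF that] dist_le_length by blast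
    ultimately show "x = y" by simp
  next
    assume "x = y"
    have "\<exists>L\<le>0. connects M x x (\<lambda>_. x) L"
      using connects_C1[of "\<lambda>_. x" "\<lambda>_. 0" M 0] that M_subset
      by (auto simp: HxR_metric_def intro: has_vector_derivative_const)
    then have "?d x x \<le> 0" using riemannian_dist_le order_trans by blast
    moreover have "0 \<le> ?d x x" using ge[OF that(1) that(1)] connects_nonneg by blast
    ultimately show "?d x y = 0" using \<open>x = y\<close> by simp
  qed
  show "?d x z \<le> ?d x y + ?d y z" if M: "x \<in> M" "y \<in> M" "z \<in> M"
  proof -
    have "?d x z - K \<le> ?d x y" if K: "connects M y z \<delta> K" for \<delta> K
    proof (rule ge[OF M(1,2)])
      fix \<gamma> L assume "connects M x y \<gamma> L"
      from riemannian_dist_le[OF connects_join[OF this K]] show "?d x z - K \<le> L" by simp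
    qed
    then have "?d x z - ?d x y \<le> ?d y z" by (intro ge[OF M(2,3)]) (simp add: algebra_simps)
    then show ?thesis by simp
  qed
qed

lemma dist_le_riemannian_dist:
  fixes q q' :: "(real ^ 'n) \<times> real"
  assumes "2 \<le> CARD('n)" "q \<in> M" "q' \<in> M"
  shows "dist q q' \<le> riemannian_dist HxR_metric M q q'"
    and "\<bar>ln (1 - (norm (fst q'))\<^sup>2) - ln (1 - (norm (fst q))\<^sup>2)\<bar> \<le> riemannian_dist HxR_metric M q q'"
  using connects_exists[OF assms] dist_le_length log_conformal_le_length riemannian_dist_ge by metis+

lemma rad_proper:
  assumes "C < 1"
  shows "\<exists>c<T. \<forall>t\<in>{-T<..<T}. rad t \<le> C \<longrightarrow> \<bar>t\<bar> \<le> c"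
proof (cases "-1 < C")
  case True
  define y where "y = ln (sqrt ((1 + C) / (1 - C)))"
  have "0 < (1 + C) / (1 - C)" using True assms by simp
  then have "tanh y = ((1 + C) / (1 - C) - 1) / ((1 + C) / (1 - C) + 1)"
    by (simp add: y_def tanh_ln_real)
  also have "\<dots> = C" using assms by (simp add: field_simps)
  finally have y: "tanh y = C" .
  obtain c where c: "c < T" "\<forall>t\<in>{-T<..<T}. f t \<le> 2 * y \<longrightarrow> \<bar>t\<bar> \<le> c"
    using f_proper by blast
  have "f t \<le> 2 * y" if "rad t \<le> C" for t
  proof -
    have "tanh (f t / 2) \<le> tanh y" using that by (simp add: rad_def y)
    then show ?thesis by simp
  qed
  then show ?thesis using c by blast
next
  case False
  then have "\<not> rad t \<le> C" if "t \<in> {-T<..<T}" for t using rad_bounds[OF that] by simp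
  then show ?thesis using T_pos by (intro exI[of _ 0]) auto
qed

text \<open>The points are joined by a piece of a meridian, followed by a great circle arc at the height of
  the limit.\<close>

lemma riemannian_dist_tendsto_0:
  fixes \<sigma> :: "nat \<Rightarrow> (real ^ 'n) \<times> real"
  assumes n: "2 \<le> CARD('n)" and \<sigma>M: "\<And>k. \<sigma> k \<in> M" and q: "q \<in> M" and lim: "\<sigma> \<longlonglongrightarrow> q"
  shows "(\<lambda>k. riemannian_dist HxR_metric M (\<sigma> k) q) \<longlonglongrightarrow> 0"
proof -
  interpret Metric_space "M :: ((real ^ 'n) \<times> real) set" "riemannian_dist HxR_metric M"
    by (rule Metric_space_M[OF n])
  define X where "X k = fst (\<sigma> k)" for k
  define \<tau> where "\<tau> k = snd (\<sigma> k)" for k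
  obtain x t where qq: "q = (x, t)" by (cases q)
  have \<sigma>: "\<sigma> k = (X k, \<tau> k)" for k by (simp add: X_def \<tau>_def)
  have limX: "X \<longlonglongrightarrow> x" and limt: "\<tau> \<longlonglongrightarrow> t"
    using tendsto_fst[OF lim] tendsto_snd[OF lim] by (auto simp: X_def [abs_def] \<tau>_def [abs_def] qq)
  have t: "t \<in> {-T<..<T}" using q by (simp add: qq M_iff)
  have \<tau>I: "\<tau> k \<in> {-T<..<T}" for k using \<sigma>M[of k] by (simp add: \<sigma> M_iff)
  define c where "c = (\<bar>t\<bar> + T) / 2"
  have c: "\<bar>t\<bar> < c" "c < T" using t by (auto simp: c_def)
  obtain C where C: "\<And>z. \<bar>z\<bar> \<le> c \<Longrightarrow> sqrt (1 + (p z)\<^sup>2) \<le> C"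
    using compact_slope_bound[OF c(2)] by blast
  define \<xi> where "\<xi> k = X k /\<^sub>R rad (\<tau> k)" for k
  define \<xi>0 where "\<xi>0 = x /\<^sub>R rad t"
  have nxi: "norm (\<xi> k) = 1" "X k = rad (\<tau> k) *\<^sub>R \<xi> k" for k
    using M_direction[of "X k" "\<tau> k"] \<sigma>M[of k] by (auto simp: \<sigma> \<xi>_def)
  have nxi0: "norm \<xi>0 = 1" "x = rad t *\<^sub>R \<xi>0"
    using M_direction[of x t] q by (auto simp: qq \<xi>0_def)
  have "eventually (\<lambda>k. \<bar>\<tau> k\<bar> < c) sequentially"
    using tendsto_rabs[OF limt] c(1) by (rule order_tendstoD)
  then have upper: "eventually (\<lambda>k. riemannian_dist HxR_metric M (\<sigma> k) q
      \<le> C * \<bar>t - \<tau> k\<bar> + sinh (f t) * arccos (\<xi> k \<bullet> \<xi>0)) sequentially"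
  proof eventually_elim
    case (elim k)
    have "\<bar>z\<bar> \<le> c" if "z \<in> closed_segment (\<tau> k) t" for z
      using that elim c(1) by (auto simp: closed_segment_eq_real_ivl split: if_splits)
    then obtain \<gamma> L where 1: "L \<le> C * \<bar>t - \<tau> k\<bar>" "connects M (\<sigma> k) (rad t *\<^sub>R \<xi> k, t) \<gamma> L"
      using connects_meridian[OF \<tau>I t nxi(1), of k C k] C nxi(2) \<sigma> by metis
    obtain \<delta> K where 2: "K \<le> sinh (f t) * arccos (\<xi> k \<bullet> \<xi>0)" "connects M (rad t *\<^sub>R \<xi> k, t) q \<delta> K"
      using connects_parallel[OF n t nxi(1) nxi0(1)] nxi0(2) qq by metis
    show ?case using riemannian_dist_le[OF connects_join[OF 1(2) 2(2)]] 1(1) 2(1) by simp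
  qed
  have "(\<lambda>k. C * \<bar>t - \<tau> k\<bar> + sinh (f t) * arccos (\<xi> k \<bullet> \<xi>0)) \<longlonglongrightarrow> C * \<bar>t - t\<bar> + sinh (f t) * arccos 1"
  proof (intro tendsto_intros limt)
    have "isCont rad t" using rad_has_derivative[OF t] DERIV_isCont by blast
    then have "(\<lambda>k. rad (\<tau> k)) \<longlonglongrightarrow> rad t" using limt by (rule isCont_tendsto_compose)
    then have "\<xi> \<longlonglongrightarrow> \<xi>0"
      unfolding \<xi>_def [abs_def] \<xi>0_def using rad_bounds(1)[OF t]
      by (intro tendsto_intros limX) auto
    then have "(\<lambda>k. \<xi> k \<bullet> \<xi>0) \<longlonglongrightarrow> \<xi>0 \<bullet> \<xi>0" by (intro tendsto_intros)
    then have lim1: "(\<lambda>k. \<xi> k \<bullet> \<xi>0) \<longlonglongrightarrow> 1"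
      using nxi0(1) by (simp add: dot_square_norm)
    have "\<xi> k \<bullet> \<xi>0 \<in> {-1..1}" for k
      using Cauchy_Schwarz_ineq2[of "\<xi> k" \<xi>0] nxi(1)[of k] nxi0(1) by (auto simp: abs_le_iff)
    then have "eventually (\<lambda>k. \<xi> k \<bullet> \<xi>0 \<in> {-1..1}) sequentially" by (intro always_eventually) blast
    then show "(\<lambda>k. arccos (\<xi> k \<bullet> \<xi>0)) \<longlonglongrightarrow> arccos 1"
      by (rule continuous_on_tendsto_compose[OF continuous_on_arccos' lim1, rotated]) simp
  qed
  then have lim0: "(\<lambda>k. C * \<bar>t - \<tau> k\<bar> + sinh (f t) * arccos (\<xi> k \<bullet> \<xi>0)) \<longlonglongrightarrow> 0" by simp
  have lower: "eventually (\<lambda>k. 0 \<le> riemannian_dist HxR_metric M (\<sigma> k) q) sequentially"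
    by (intro always_eventually allI nonneg)
  show ?thesis by (rule tendsto_sandwich[OF lower upper tendsto_const lim0])
qed

lemma complete_M:
  assumes n: "2 \<le> CARD('n)"
  shows "complete_hypersurface HxR HxR_metric (M :: ((real ^ 'n) \<times> real) set)"
  unfolding complete_hypersurface_def
proof (intro conjI hypersurface_M Metric_space_M[OF n])
  interpret Metric_space "M :: ((real ^ 'n) \<times> real) set" "riemannian_dist HxR_metric M"
    by (rule Metric_space_M[OF n])
  let ?d = "riemannian_dist HxR_metric (M :: ((real ^ 'n) \<times> real) set)"
  show mcomplete
    unfolding mcomplete_def
  proof (intro allI impI)
    fix \<sigma> :: "nat \<Rightarrow> (real ^ 'n) \<times> real" assume \<sigma>: "MCauchy \<sigma>"
    then have \<sigma>M: "\<sigma> k \<in> M" for k by (auto simp: MCauchy_def)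
    have "Cauchy \<sigma>"
      unfolding Cauchy_def
    proof (intro allI impI)
      fix e :: real assume "0 < e"
      then obtain N where "\<And>k l. N \<le> k \<Longrightarrow> N \<le> l \<Longrightarrow> ?d (\<sigma> k) (\<sigma> l) < e"
        using \<sigma> unfolding MCauchy_def by blast
      then show "\<exists>N. \<forall>k\<ge>N. \<forall>l\<ge>N. dist (\<sigma> k) (\<sigma> l) < e"
        using dist_le_riemannian_dist(1)[OF n \<sigma>M \<sigma>M] le_less_trans by blast
    qed
    then obtain q where lim: "\<sigma> \<longlonglongrightarrow> q"
      using Cauchy_convergent_iff convergent_def by blast
    define X where "X k = fst (\<sigma> k)" for k
    define \<tau> where "\<tau> k = snd (\<sigma> k)" for k
    obtain x t where qq: "q = (x, t)" by (cases q)
    have \<sigma>eq: "\<sigma> k = (X k, \<tau> k)" for k by (simp add: X_def \<tau>_def)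
    have limX: "X \<longlonglongrightarrow> x" and limt: "\<tau> \<longlonglongrightarrow> t"
      using tendsto_fst[OF lim] tendsto_snd[OF lim] by (auto simp: X_def [abs_def] \<tau>_def [abs_def] qq)
    have \<tau>I: "\<tau> k \<in> {-T<..<T}" and nX: "norm (X k) = rad (\<tau> k)" for k
      using \<sigma>M[of k] by (auto simp: \<sigma>eq M_iff)
    obtain N where N: "\<And>k. N \<le> k \<Longrightarrow> ?d (\<sigma> k) (\<sigma> N) < 1"
      using \<sigma> unfolding MCauchy_def by (metis order_refl zero_less_one)
    \<comment> \<open>a positive lower bound of \<open>1 - |X k|\<^sup>2\<close> for \<open>k \<ge> N\<close>, as its logarithm varies by less than \<open>1\<close>\<close>
    define b where "b = (1 - (norm (X N))\<^sup>2) * exp (-1)"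
    have lt1: "(norm (X k))\<^sup>2 < 1" for k
      using rad_bounds[OF \<tau>I[of k]] power_strict_mono[of "rad (\<tau> k)" 1 2] by (simp add: nX)
    have "b \<le> 1 - (norm (X k))\<^sup>2" if k: "N \<le> k" for k
    proof -
      have "ln (1 - (norm (X N))\<^sup>2) - 1 \<le> ln (1 - (norm (X k))\<^sup>2)"
        using dist_le_riemannian_dist(2)[OF n \<sigma>M[of k] \<sigma>M[of N]] N[OF k] by (simp add: X_def)
      then have "exp (ln (1 - (norm (X N))\<^sup>2) - 1) \<le> exp (ln (1 - (norm (X k))\<^sup>2))" by simp
      then show ?thesis
        using lt1[of k] lt1[of N] by (simp add: b_def exp_diff exp_minus divide_inverse)
    qed
    then have "rad (\<tau> k) \<le> sqrt (1 - b)" if k: "N \<le> k" for k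
      using k by (intro real_le_rsqrt) (simp add: nX[symmetric] algebra_simps)
    moreover have "0 < b" using lt1[of N] by (simp add: b_def)
    then have "sqrt (1 - b) < 1" by simp
    ultimately obtain c where c: "c < T" "\<And>k. N \<le> k \<Longrightarrow> \<bar>\<tau> k\<bar> \<le> c"
      using rad_proper \<tau>I by metis
    have "\<bar>t\<bar> \<le> c"
      using tendsto_rabs[OF limt] c(2) by (intro LIMSEQ_le_const2[of "\<lambda>k. \<bar>\<tau> k\<bar>"]) auto
    then have t: "t \<in> {-T<..<T}" using c(1) by auto
    have "isCont rad t" using rad_has_derivative[OF t] DERIV_isCont by blast
    then have "(\<lambda>k. rad (\<tau> k)) \<longlonglongrightarrow> rad t" using limt by (rule isCont_tendsto_compose)
    moreover have "(\<lambda>k. rad (\<tau> k)) \<longlonglongrightarrow> norm x" using tendsto_norm[OF limX] by (simp add: nX)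
    ultimately have "norm x = rad t" using LIMSEQ_unique by blast
    then have q: "q \<in> M" using t by (simp add: qq M_iff)
    have "limitin mtopology \<sigma> q sequentially"
      unfolding limitin_metric
    proof (intro conjI allI impI q)
      fix e :: real assume "0 < e"
      with riemannian_dist_tendsto_0[OF n \<sigma>M q lim]
      have "eventually (\<lambda>k. ?d (\<sigma> k) q < e) sequentially" by (rule order_tendstoD)
      then show "eventually (\<lambda>k. \<sigma> k \<in> M \<and> ?d (\<sigma> k) q < e) sequentially"
        using \<sigma>M by simp
    qed
    then show "\<exists>q. limitin mtopology \<sigma> q sequentially" by blast
  qed
qed

end

section \<open>The family of catenoids\<close>

lemma (in catenary_curve) rotation_profile_profile: "rotation_profile m a T profile (deriv profile)"
proof
  show "\<exists>c<T. \<forall>t\<in>{-T<..<T}. profile t \<le> C \<longrightarrow> \<bar>t\<bar> \<le> c" for C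
    by (rule bounded_profile_imp)
qed (use m_pos a_pos T_pos profile_pos profile_has_derivative deriv_profile_has_derivative
      profile_first_integral deriv_profile in auto)

lemma catenary_cong: "(\<And>t. t \<in> I \<Longrightarrow> f t = g t) \<Longrightarrow> catenary I f = catenary I g"
  by (auto simp: catenary_def)

lemma snd_rotation_hypersurface:
  "snd ` (rotation_hypersurface (catenary I f) :: ((real ^ 'n) \<times> real) set) = I"
proof (intro subset_antisym subsetI)
  fix t assume t: "t \<in> I"
  obtain \<xi> :: "real ^ 'n" where "norm \<xi> = 1" using vector_choose_size zero_le_one by blast
  then have "(tanh (f t / 2) *\<^sub>R \<xi>, t) \<in> rotation_hypersurface (catenary I f)"
    using t unfolding rotation_hypersurface_def catenary_def by auto
  then show "t \<in> snd ` (rotation_hypersurface (catenary I f) :: ((real ^ 'n) \<times> real) set)"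
    by (rule rev_image_eqI) simp
qed (auto simp: rotation_hypersurface_def catenary_def)

lemma catenary_Int:
  assumes m: "0 < m" and "0 < a" "0 < b" "a \<noteq> b"
    and fa: "\<And>t. t \<in> {-catenary_curve.T m a<..<catenary_curve.T m a} \<Longrightarrow> f t = catenary_curve.profile m a t"
    and fb: "\<And>t. t \<in> {-catenary_curve.T m b<..<catenary_curve.T m b} \<Longrightarrow> g t = catenary_curve.profile m b t"
  shows "\<exists>r t. 0 < t \<and> catenary {-catenary_curve.T m a<..<catenary_curve.T m a} f
    \<inter> catenary {-catenary_curve.T m b<..<catenary_curve.T m b} g = {(r, t), (r, - t)}"
proof -
  interpret A: catenary_curve m a using assms by unfold_locales auto
  interpret B: catenary_curve m b using assms by unfold_locales auto
  obtain t0 where t0: "0 < t0" "t0 < A.T" "t0 < B.T"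
    and iff: "\<And>t. \<bar>t\<bar> < A.T \<Longrightarrow> \<bar>t\<bar> < B.T \<Longrightarrow> A.profile t = B.profile t \<longleftrightarrow> \<bar>t\<bar> = t0"
    using catenary_crossing[OF assms(1-4)] by blast
  have in_A: "(r, t) \<in> catenary {-A.T<..<A.T} f \<longleftrightarrow> \<bar>t\<bar> < A.T \<and> r = tanh (A.profile t / 2)" for r t
    using fa by (auto simp: catenary_def abs_less_iff)
  have in_B: "(r, t) \<in> catenary {-B.T<..<B.T} g \<longleftrightarrow> \<bar>t\<bar> < B.T \<and> r = tanh (B.profile t / 2)" for r t
    using fb by (auto simp: catenary_def abs_less_iff)
  have "catenary {-A.T<..<A.T} f \<inter> catenary {-B.T<..<B.T} g
      = {(tanh (A.profile t0 / 2), t0), (tanh (A.profile t0 / 2), - t0)}"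
  proof (rule set_eqI, clarify)
    fix r t
    have "(r, t) \<in> catenary {-A.T<..<A.T} f \<inter> catenary {-B.T<..<B.T} g \<longleftrightarrow>
        \<bar>t\<bar> < A.T \<and> \<bar>t\<bar> < B.T \<and> r = tanh (A.profile t / 2) \<and> A.profile t = B.profile t"
      by (auto simp: in_A in_B)
    also have "\<dots> \<longleftrightarrow> \<bar>t\<bar> = t0 \<and> r = tanh (A.profile t / 2)"
      using iff t0 by auto
    also have "\<dots> \<longleftrightarrow> (r, t) \<in> {(tanh (A.profile t0 / 2), t0), (tanh (A.profile t0 / 2), - t0)}"
      using t0 A.profile_minus[of t0] by (auto simp: abs_if)
    finally show "(r, t) \<in> catenary {-A.T<..<A.T} f \<inter> catenary {-B.T<..<B.T} g \<longleftrightarrow>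
      (r, t) \<in> {(tanh (A.profile t0 / 2), t0), (tanh (A.profile t0 / 2), - t0)}" .
  qed
  then show ?thesis using t0 by blast
qed

theorem proposition3p2:
  assumes "2 \<le> CARD('n::finite)"
  shows "(\<forall>a>0. \<exists>J h. maximal_solution CARD('n) a J h \<and>
            (\<forall>J' h'. maximal_solution CARD('n) a J' h' \<longrightarrow> J' = J \<and> (\<forall>t\<in>J. h' t = h t)))
    \<and> (\<forall>(I :: real \<Rightarrow> real set) (f :: real \<Rightarrow> real \<Rightarrow> real)
         (\<C> :: real \<Rightarrow> ((real ^ 'n) \<times> real) set) (h\<^sub>R :: real \<Rightarrow> real).
         (\<forall>a>0. maximal_solution CARD('n) a (I a) (f a)) \<longrightarrow>
         (\<forall>a>0. \<C> a = rotation_hypersurface (catenary (I a) (f a))) \<longrightarrow>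
         (\<forall>a>0. h\<^sub>R a = vertical_height (\<C> a)) \<longrightarrow>
         (\<forall>a>0.
            minimal_hypersurface HxR HxR_metric (\<C> a) \<and>
            complete_hypersurface HxR HxR_metric (\<C> a) \<and>
            (\<exists>T>0.
               I a = {-T<..<T} \<and>
               (\<forall>t\<in>I a. f a (- t) = f a t) \<and>
               (\<forall>t\<in>I a. a \<le> f a t) \<and>
               (\<forall>t\<in>{0<..<T}. 0 < deriv (f a) t) \<and>
               (\<forall>t\<in>{-T<..<0}. deriv (f a) t < 0) \<and>
               bij_betw (f a) {0..<T} {a..} \<and>
               (\<forall>\<rho>\<ge>a. catenary_integrand CARD('n) a integrable_on {a..\<rho>} \<and>
                  inv_into {0..<T} (f a) \<rho>
                    = sinh a ^ (CARD('n) - 1) * integral {a..\<rho>} (catenary_integrand CARD('n) a))) \<and>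
            bounded (snd ` \<C> a) \<and>
            catenary_integrand CARD('n) a integrable_on {a..} \<and>
            h\<^sub>R a = 2 * sinh a ^ (CARD('n) - 1) * integral {a..} (catenary_integrand CARD('n) a)) \<and>
         strict_mono_on {0<..} h\<^sub>R \<and>
         (h\<^sub>R \<longlongrightarrow> 0) (at_right 0) \<and>
         (h\<^sub>R \<longlongrightarrow> pi / (real CARD('n) - 1)) at_top \<and>
         (\<forall>a>0. \<forall>b>0. a \<noteq> b \<longrightarrow>
            (\<exists>r t. 0 < t \<and> catenary (I a) (f a) \<inter> catenary (I b) (f b) = {(r, t), (r, - t)})))"
proof -
  obtain m where card: "CARD('n) = Suc m" and m: "0 < m"
    using assms by (cases "CARD('n)") auto
  have cc: "catenary_curve m a" if "0 < a" for a
    using that m by unfold_locales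
  let ?T = "\<lambda>a. catenary_curve.T m a" and ?pr = "\<lambda>a. catenary_curve.profile m a"
  show ?thesis
    unfolding card
  proof (intro conjI allI impI)
    show "\<exists>J h. maximal_solution (Suc m) a J h \<and>
        (\<forall>J' h'. maximal_solution (Suc m) a J' h' \<longrightarrow> J' = J \<and> (\<forall>t\<in>J. h' t = h t))" if "0 < a" for a
      using catenary_curve.maximal_solution_profile[OF cc[OF that]]
        catenary_curve.maximal_solution_unique[OF cc[OF that]] by metis
  next
    fix I :: "real \<Rightarrow> real set" and f :: "real \<Rightarrow> real \<Rightarrow> real"
      and \<C> :: "real \<Rightarrow> ((real ^ 'n) \<times> real) set" and h\<^sub>R :: "real \<Rightarrow> real"
    assume max: "\<forall>a>0. maximal_solution (Suc m) a (I a) (f a)"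
      and \<C>: "\<forall>a>0. \<C> a = rotation_hypersurface (catenary (I a) (f a))"
      and h: "\<forall>a>0. h\<^sub>R a = vertical_height (\<C> a)"
    have I: "I a = {-?T a<..<?T a}" if "0 < a" for a
      using catenary_curve.maximal_solution_unique(1)[OF cc[OF that]] max that by blast
    have f: "f a t = ?pr a t" if "0 < a" "t \<in> {-?T a<..<?T a}" for a t
      using catenary_curve.maximal_solution_unique(2)[OF cc[OF that(1)]] max that by blast
    have snd_\<C>: "snd ` \<C> a = {-?T a<..<?T a}" if "0 < a" for a
      using \<C> that by (simp add: snd_rotation_hypersurface I)
    have h_eq: "h\<^sub>R a = 2 * ?T a" if "0 < a" for a
      using h that catenary_curve.T_pos[OF cc[OF that]]
      by (simp add: vertical_height_def snd_\<C> cSup_greaterThanLessThan cInf_greaterThanLessThan)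
    {
      fix a :: real assume a: "0 < a"
      interpret catenary_curve m a by (rule cc[OF a])
      interpret rotation_profile m a T profile "deriv profile" by (rule rotation_profile_profile)
      have Ia: "I a = {-T<..<T}" and fa: "\<And>t. t \<in> {-T<..<T} \<Longrightarrow> f a t = profile t"
        using I[OF a] f[OF a] by auto
      have M: "\<C> a = M"
        using \<C> a catenary_cong[of "{-T<..<T}" "f a" profile] fa by (simp add: M_def Ia)
      have df: "deriv (f a) t = deriv profile t" if t: "t \<in> {-T<..<T}" for t
      proof -
        have "(profile has_real_derivative deriv profile t) (at t)"
          using f_has_derivative[OF t] .
        then have "(f a has_real_derivative deriv profile t) (at t)"
          by (rule has_field_derivative_transform_within_open[of _ _ _ "{-T<..<T}"])
            (use t fa in auto)
        then show ?thesis by (rule DERIV_imp_deriv)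
      qed
      have bij: "bij_betw (f a) {0..<T} {a..}"
        using bij_betw_profile bij_betw_cong[of "{0..<T}" "f a" profile] fa T_pos by auto
      show "minimal_hypersurface HxR HxR_metric (\<C> a)"
        unfolding M by (rule minimal_M[OF card])
      show "complete_hypersurface HxR HxR_metric (\<C> a)"
        unfolding M by (rule complete_M[OF assms])
      show "\<exists>T>0. I a = {-T<..<T} \<and> (\<forall>t\<in>I a. f a (- t) = f a t) \<and> (\<forall>t\<in>I a. a \<le> f a t) \<and>
          (\<forall>t\<in>{0<..<T}. 0 < deriv (f a) t) \<and> (\<forall>t\<in>{-T<..<0}. deriv (f a) t < 0) \<and>
          bij_betw (f a) {0..<T} {a..} \<and>
          (\<forall>\<rho>\<ge>a. catenary_integrand (Suc m) a integrable_on {a..\<rho>} \<and>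
             inv_into {0..<T} (f a) \<rho>
               = sinh a ^ (Suc m - 1) * integral {a..\<rho>} (catenary_integrand (Suc m) a))"
      proof (intro exI[of _ T] conjI T_pos Ia ballI allI impI bij)
        fix t assume "t \<in> I a"
        then have t: "t \<in> {-T<..<T}" "- t \<in> {-T<..<T}" by (auto simp: Ia)
        show "f a (- t) = f a t" using fa t profile_minus by simp
        show "a \<le> f a t" using fa t profile_ge by simp
      next
        fix t assume "t \<in> {0<..<T}"
        then show "0 < deriv (f a) t" using deriv_profile_pos[of t] df[of t] T_pos by auto
      next
        fix t assume "t \<in> {-T<..<0}"
        then show "deriv (f a) t < 0" using deriv_profile_neg[of t] df[of t] T_pos by auto
      next
        fix \<rho> assume \<rho>: "a \<le> \<rho>"
        show "catenary_integrand (Suc m) a integrable_on {a..\<rho>}"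
          using integrand_has_integral[OF \<rho>] by blast
        have "lam \<rho> \<in> {0..<T}" "lam \<rho> \<in> {-T<..<T}" using lam_in[OF \<rho>] T_pos by auto
        then have "f a (lam \<rho>) = \<rho>" using fa profile_lam[OF \<rho>] by simp
        then have "inv_into {0..<T} (f a) \<rho> = lam \<rho>"
          using bij \<open>lam \<rho> \<in> {0..<T}\<close> by (metis bij_betw_imp_inj_on inv_into_f_f)
        also have "lam \<rho> = sinh a ^ m * integral {a..\<rho>} (catenary_integrand (Suc m) a)"
          using integral_unique[OF integrand_has_integral[OF \<rho>]] sinh_a_pos by simp
        finally show "inv_into {0..<T} (f a) \<rho>
            = sinh a ^ (Suc m - 1) * integral {a..\<rho>} (catenary_integrand (Suc m) a)" by simp
      qed
      show "bounded (snd ` \<C> a)"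
        unfolding snd_\<C>[OF a] by (rule bounded_subset[OF bounded_closed_interval[of "-T" T]]) auto
      show "catenary_integrand (Suc m) a integrable_on {a..}"
        using integrand_has_integral_inf by blast
      show "h\<^sub>R a = 2 * sinh a ^ (Suc m - 1) * integral {a..} (catenary_integrand (Suc m) a)"
        using integral_unique[OF integrand_has_integral_inf] sinh_a_pos by (simp add: h_eq[OF a])
    }
    show "strict_mono_on {0<..} h\<^sub>R"
      by (rule strict_mono_onI) (use T_strict_mono[OF m] h_eq in auto)
    show "(h\<^sub>R \<longlongrightarrow> 0) (at_right 0)"
    proof (rule Lim_transform_eventually)
      show "((\<lambda>a. 2 * ?T a) \<longlongrightarrow> 0) (at_right 0)"
        using tendsto_mult[OF tendsto_const[of 2] T_tendsto_0[OF m]] by simp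
      show "eventually (\<lambda>a. 2 * ?T a = h\<^sub>R a) (at_right 0)"
        using eventually_at_right_less[of 0] by eventually_elim (simp add: h_eq)
    qed
    show "(h\<^sub>R \<longlongrightarrow> pi / (real (Suc m) - 1)) at_top"
    proof (rule Lim_transform_eventually)
      show "((\<lambda>a. 2 * ?T a) \<longlongrightarrow> pi / (real (Suc m) - 1)) at_top"
        using tendsto_mult[OF tendsto_const[of 2] T_tendsto_at_top[OF m]] by simp
      show "eventually (\<lambda>a. 2 * ?T a = h\<^sub>R a) at_top"
        using eventually_gt_at_top[of 0] by eventually_elim (simp add: h_eq)
    qed
    show "\<exists>r t. 0 < t \<and> catenary (I a) (f a) \<inter> catenary (I b) (f b) = {(r, t), (r, - t)}"
      if "0 < a" "0 < b" "a \<noteq> b" for a b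
      unfolding I[OF that(1)] I[OF that(2)]
      using catenary_Int[OF m that, of "f a" "f b"] f that by blast
  qed
qed

end
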